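(* Let $\mathbb I=\{\,1\le i\le d-1 \mid i\notin\{a_1,\dots,a_{k-1}\},\ \delta_1(\mathbf w_i)>\deg(\mathbf w_i)\,\}$. (i) The ring $K[S]$ is Cohen--Macaulay if and only if $\mathbb I=\emptyset$. (ii) Assume that $\mathbb I\neq\emptyset$. If $\delta_1(\mathbf w_i)=\delta_2(\mathbf w_i)=\deg(\mathbf w_i)+1$ for all $i\in\mathbb I$, then $H^1_{\mathfrak m}(K[S])\cong\bigoplus_{i\in\mathbb I}K\mathbf w_i$ as $K$-vector spaces. In particular, $\ell(H^1_{\mathfrak m}(K[S]))=\sharp(\mathbb I)\le d-k$. (iii) The ring $K[S]$ is non-Cohen--Macaulay and Buchsbaum if and only if $\mathbb I\neq\emptyset$, the condition $\delta_1(\mathbf w_i)=\delta_2(\mathbf w_i)=\deg(\mathbf w_i)+1$ holds for all $i\in\mathbb I$, and there is no pair $\{i,j\}\subseteq\mathbb I$ such that $\mathbf w_j-\mathbf w_i=\mathbf e_h$ for some $h\in\{a_1,\dots,a_{k-1}\}$.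
   Context: Let $K$ be a field, $\mathbb N$ the set of non-negative integers, $k\ge 3$, and let $0=:a_0<a_1<\cdots<a_k=:d$ be integers with $\gcd(a_1,\dots,a_k)=1$. Put $A_1=\{0,a_1,\dots,a_k\}$, $A_2=\{d-a_i\mid 0\le i\le k\}$, and $\mathbf e_h=(h,d-h)$ for integers $0\le h\le d$. Let $S\subset\mathbb N^2$ be the additive monoid generated by $\mathbf e_{a_0},\dots,\mathbf e_{a_k}$, and $K[S]$ its semigroup ring (isomorphic to $K[s^{a_i}t^{d-a_i}\mid 0\le i\le k]$), graded by $\deg(u_1,u_2)=(u_1+u_2)/d$; $\mathfrak m$ is the maximal homogeneous ideal generated by $S\setminus\{0\}$. $H^i_{\mathfrak m}$ denotes local cohomology and $\ell$ denotes length. $K[S]$ is called Buchsbaum if $\mathfrak m H^1_{\mathfrak m}(K[S])=0$. For $i\in\{1,2\}$ let $\langle A_i\rangle$ be the submonoid of $\mathbb N$ generated by $A_i$. For $0\le j\le d-1$ let $\omega_i(j)=\min\{\alpha\in\langle A_i\rangle\mid\alpha\equiv j \bmod d\}$, and set $\omega_i(d):=0$. For $n\in\langle A_i\rangle$ let $\delta_i(n)$ be the minimum of $\sum_{a}x_a$ over all representations $n=\sum_{a\in A_i\setminus\{0\}}x_a a$ with $x_a\in\mathbb N$. For $0\le j\le d-1$ put $\mathbf w_j=(\omega_1(j),\omega_2(d-j))$, so $\deg(\mathbf w_j)=(\omega_1(j)+\omega_2(d-j))/d$, and write $\delta_1(\mathbf w_j)=\delta_1(\omega_1(j))$, $\delta_2(\mathbf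 w_j)=\delta_2(\omega_2(d-j))$. *)

theory Defs
  imports
    "HOL-Algebra.Module"
    "HOL-Algebra.Ring_Divisibility"
    "HOL-Library.Poly_Mapping"
    "HOL-Library.Product_Plus"
    "HOL-Library.Extended_Nat"
begin

section \<open>Generated submonoids\<close>

definition submonoid_generated :: "('a, 'b) monoid_scheme \<Rightarrow> 'a set \<Rightarrow> 'a set" where
  "submonoid_generated G X = \<Inter>{H. submonoid H G \<and> X \<subseteq> H}"

definition add_submonoid :: "'a::comm_monoid_add set \<Rightarrow> 'a set" where
  "add_submonoid X = submonoid_generated \<lparr>carrier = UNIV, mult = (+), one = 0\<rparr> X"


section \<open>Cohen--Macaulay rings\<close>

definition regular_sequence :: "('a, 'b) ring_scheme \<Rightarrow> 'a list \<Rightarrow> bool" where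
  "regular_sequence R xs \<longleftrightarrow>
     set xs \<subseteq> carrier R \<and>
     (\<forall>i<length xs. \<forall>r\<in>carrier R.
        xs ! i \<otimes>\<^bsub>R\<^esub> r \<in> Idl\<^bsub>R\<^esub> (set (take i xs)) \<longrightarrow> r \<in> Idl\<^bsub>R\<^esub> (set (take i xs))) \<and>
     Idl\<^bsub>R\<^esub> (set xs) \<noteq> carrier R"

definition grade :: "('a, 'b) ring_scheme \<Rightarrow> 'a set \<Rightarrow> enat" where
  "grade R I = (SUP xs \<in> {xs. regular_sequence R xs \<and> set xs \<subseteq> I}. enat (length xs))"

definition ideal_height :: "('a, 'b) ring_scheme \<Rightarrow> 'a set \<Rightarrow> enat" where
  "ideal_height R P = Sup {enat n | n. \<exists>Q :: nat \<Rightarrow> 'a set.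
     (\<forall>i\<le>n. primeideal (Q i) R) \<and> (\<forall>i<n. Q i \<subset> Q (Suc i)) \<and> Q n = P}"

text \<open>
  For a maximal ideal \<open>P\<close> of a Noetherian ring, the grade of \<open>P\<close> is the depth of the local
  ring \<open>R\<^sub>P\<close> and the height of \<open>P\<close> is its dimension, so this is the usual condition
  \<open>depth R\<^sub>P = dim R\<^sub>P\<close> at all maximal ideals, in the formulation of Kaplansky,
  Commutative Rings, Section 3-1.
\<close>

definition cohen_macaulay :: "('a, 'b) ring_scheme \<Rightarrow> bool" where
  "cohen_macaulay R \<longleftrightarrow> cring R \<and> noetherian_ring R \<and>
     (\<forall>P. maximalideal P R \<longrightarrow> grade R P = ideal_height R P)"


section \<open>Modules\<close>

text \<open>
  The record type of modules extends that of rings. The fields \<open>mult\<close> and \<open>one\<close> play no role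
  for a module.
\<close>

definition quotient_module :: "('a, 'b, 'c) module_scheme \<Rightarrow> 'b set \<Rightarrow> ('a, 'b set) module" where
  "quotient_module M N =
     \<lparr>carrier = a_rcosets\<^bsub>M\<^esub> N, mult = undefined, one = undefined,
      zero = N, add = (\<lambda>X Y. X <+>\<^bsub>M\<^esub> Y),
      smult = (\<lambda>r X. \<Union>x\<in>X. N +>\<^bsub>M\<^esub> (r \<odot>\<^bsub>M\<^esub> x))\<rparr>"

definition restrict_scalars :: "('c \<Rightarrow> 'a) \<Rightarrow> ('a, 'b, 'd) module_scheme \<Rightarrow> ('c, 'b) module" where
  "restrict_scalars \<phi> M =
     \<lparr>carrier = carrier M, mult = mult M, one = one M, zero = zero M, add = add M,
      smult = (\<lambda>c x. \<phi> c \<odot>\<^bsub>M\<^esub> x)\<rparr>"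

definition modules_isomorphic ::
  "('a, 'd) ring_scheme \<Rightarrow> ('a, 'b, 'e) module_scheme \<Rightarrow> ('a, 'c, 'f) module_scheme \<Rightarrow> bool" where
  "modules_isomorphic R M N \<longleftrightarrow>
     (\<exists>f \<in> iso (add_monoid M) (add_monoid N).
        \<forall>r\<in>carrier R. \<forall>x\<in>carrier M. f (r \<odot>\<^bsub>M\<^esub> x) = r \<odot>\<^bsub>N\<^esub> f x)"

definition module_length :: "('a, 'd) ring_scheme \<Rightarrow> ('a, 'b) module \<Rightarrow> enat" where
  "module_length R M = Sup {enat n | n. \<exists>N :: nat \<Rightarrow> 'b set.
     (\<forall>i\<le>n. submodule (N i) R M) \<and> (\<forall>i<n. N i \<subset> N (Suc i))}"


section \<open>Localization\<close>

text \<open>\<open>T\<close> is a multiplicative subset of a commutative ring \<open>R\<close>; \<open>(r, t)\<close> stands for \<open>r/t\<close>.\<close>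

definition fraction_rel :: "('a, 'b) ring_scheme \<Rightarrow> 'a set \<Rightarrow> (('a \<times> 'a) \<times> ('a \<times> 'a)) set" where
  "fraction_rel R T = {((r, t), (r', t')). r \<in> carrier R \<and> r' \<in> carrier R \<and> t \<in> T \<and> t' \<in> T \<and>
     (\<exists>u\<in>T. u \<otimes>\<^bsub>R\<^esub> (r \<otimes>\<^bsub>R\<^esub> t') = u \<otimes>\<^bsub>R\<^esub> (r' \<otimes>\<^bsub>R\<^esub> t))}"

definition fraction :: "('a, 'b) ring_scheme \<Rightarrow> 'a set \<Rightarrow> 'a \<Rightarrow> 'a \<Rightarrow> ('a \<times> 'a) set" where
  "fraction R T r t = fraction_rel R T `` {(r, t)}"

text \<open>
  The operations are computed on all representatives; the union is over equal classes.
\<close>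

definition localization :: "('a, 'b) ring_scheme \<Rightarrow> 'a set \<Rightarrow> ('a, ('a \<times> 'a) set) module" where
  "localization R T =
     \<lparr>carrier = (carrier R \<times> T) // fraction_rel R T,
      mult = (\<lambda>X Y. \<Union>(r, t)\<in>X. \<Union>(r', t')\<in>Y. fraction R T (r \<otimes>\<^bsub>R\<^esub> r') (t \<otimes>\<^bsub>R\<^esub> t')),
      one = fraction R T \<one>\<^bsub>R\<^esub> \<one>\<^bsub>R\<^esub>,
      zero = fraction R T \<zero>\<^bsub>R\<^esub> \<one>\<^bsub>R\<^esub>,
      add = (\<lambda>X Y. \<Union>(r, t)\<in>X. \<Union>(r', t')\<in>Y.
               fraction R T (r \<otimes>\<^bsub>R\<^esub> t' \<oplus>\<^bsub>R\<^esub> r' \<otimes>\<^bsub>R\<^esub> t) (t \<otimes>\<^bsub>R\<^esub> t')),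
      smult = (\<lambda>s X. \<Union>(r, t)\<in>X. fraction R T (s \<otimes>\<^bsub>R\<^esub> r) t)\<rparr>"


section \<open>Local cohomology\<close>

text \<open>
  For a Noetherian ring \<open>R\<close>, local cohomology with support in the ideal generated by
  \<open>x\<^sub>0, \<dots>, x\<^bsub>n-1\<^esub>\<close> (the list \<open>xs\<close>) is the cohomology of the Cech complex
  \<open>0 \<rightarrow> R \<rightarrow> \<Oplus>\<^bsub>i\<^esub> R[1/x\<^sub>i] \<rightarrow> \<Oplus>\<^bsub>i<j\<^esub> R[1/(x\<^sub>i x\<^sub>j)] \<rightarrow> \<dots>\<close>. Its degree \<open>p\<close> part is indexed by the
  subsets \<open>J\<close> of \<open>{..<n}\<close> with \<open>p\<close> elements. The localization at the product of the \<open>x\<^sub>j\<close> with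
  \<open>j \<in> J\<close> is formed by inverting the multiplicative set generated by these \<open>x\<^sub>j\<close>, so that the
  localization maps of the complex send \<open>r/t\<close> to \<open>r/t\<close>. For \<open>J = {}\<close> it is \<open>R\<close>, viewed as the
  fractions \<open>r/1\<close>.
\<close>

definition cech_denominators :: "('a, 'b) ring_scheme \<Rightarrow> 'a list \<Rightarrow> nat set \<Rightarrow> 'a set" where
  "cech_denominators R xs J = submonoid_generated R ((\<lambda>j. xs ! j) ` J)"

definition cech_localization ::
  "('a, 'b) ring_scheme \<Rightarrow> 'a list \<Rightarrow> nat set \<Rightarrow> ('a, ('a \<times> 'a) set) module" where
  "cech_localization R xs J = localization R (cech_denominators R xs J)"

definition cech_restriction ::
  "('a, 'b) ring_scheme \<Rightarrow> 'a list \<Rightarrow> nat set \<Rightarrow> ('a \<times> 'a) set \<Rightarrow> ('a \<times> 'a) set" where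
  "cech_restriction R xs J X = (\<Union>(r, t)\<in>X. fraction R (cech_denominators R xs J) r t)"

definition cech_index :: "'a list \<Rightarrow> nat \<Rightarrow> nat set set" where
  "cech_index xs p = {J. J \<subseteq> {..<length xs} \<and> card J = p}"

definition cech_cochains ::
  "('a, 'b) ring_scheme \<Rightarrow> 'a list \<Rightarrow> nat \<Rightarrow> ('a, nat set \<Rightarrow> ('a \<times> 'a) set) module" where
  "cech_cochains R xs p =
     \<lparr>carrier = (\<Pi>\<^sub>E J\<in>cech_index xs p. carrier (cech_localization R xs J)),
      mult = undefined, one = undefined,
      zero = (\<lambda>J\<in>cech_index xs p. \<zero>\<^bsub>cech_localization R xs J\<^esub>),
      add = (\<lambda>c c'. \<lambda>J\<in>cech_index xs p. c J \<oplus>\<^bsub>cech_localization R xs J\<^esub> c' J),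
      smult = (\<lambda>r c. \<lambda>J\<in>cech_index xs p. r \<odot>\<^bsub>cech_localization R xs J\<^esub> c J)\<rparr>"

text \<open>The sign attached to \<open>j \<in> J\<close> is \<open>(-1)\<close> to the position of \<open>j\<close> in \<open>J\<close>, counted from \<open>0\<close>.\<close>

definition cech_differential ::
  "('a, 'b) ring_scheme \<Rightarrow> 'a list \<Rightarrow> nat \<Rightarrow>
     (nat set \<Rightarrow> ('a \<times> 'a) set) \<Rightarrow> (nat set \<Rightarrow> ('a \<times> 'a) set)" where
  "cech_differential R xs p c =
     (\<lambda>J\<in>cech_index xs (Suc p). \<Oplus>\<^bsub>cech_localization R xs J\<^esub>j\<in>J.
        (let y = cech_restriction R xs J (c (J - {j}))
         in if even (card {i\<in>J. i < j}) then y else \<ominus>\<^bsub>cech_localization R xs J\<^esub> y))"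

definition cech_cocycles ::
  "('a, 'b) ring_scheme \<Rightarrow> 'a list \<Rightarrow> nat \<Rightarrow> (nat set \<Rightarrow> ('a \<times> 'a) set) set" where
  "cech_cocycles R xs p =
     {c \<in> carrier (cech_cochains R xs p).
        cech_differential R xs p c = \<zero>\<^bsub>cech_cochains R xs (Suc p)\<^esub>}"

definition cech_coboundaries ::
  "('a, 'b) ring_scheme \<Rightarrow> 'a list \<Rightarrow> nat \<Rightarrow> (nat set \<Rightarrow> ('a \<times> 'a) set) set" where
  "cech_coboundaries R xs p =
     (case p of
        0 \<Rightarrow> {\<zero>\<^bsub>cech_cochains R xs 0\<^esub>}
      | Suc q \<Rightarrow> cech_differential R xs q ` carrier (cech_cochains R xs q))"

definition local_cohomology ::
  "('a, 'b) ring_scheme \<Rightarrow> 'a list \<Rightarrow> nat \<Rightarrow> ('a, (nat set \<Rightarrow> ('a \<times> 'a) set) set) module" where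
  "local_cohomology R xs p =
     quotient_module ((cech_cochains R xs p)\<lparr>carrier := cech_cocycles R xs p\<rparr>)
       (cech_coboundaries R xs p)"


section \<open>Semigroup rings\<close>

definition semigroup_ring :: "'m::comm_monoid_add set \<Rightarrow> ('m \<Rightarrow>\<^sub>0 'k::field) ring" where
  "semigroup_ring S =
     \<lparr>carrier = {f. Poly_Mapping.keys f \<subseteq> S}, mult = (*), one = 1, zero = 0, add = (+)\<rparr>"

abbreviation monomial :: "'m \<Rightarrow> ('m \<Rightarrow>\<^sub>0 'k::field)" where
  "monomial u \<equiv> Poly_Mapping.single u 1"

definition coefficient_field :: "'k::field ring" where
  "coefficient_field = \<lparr>carrier = UNIV, mult = (*), one = 1, zero = 0, add = (+)\<rparr>"

definition as_vector_space ::
  "('m::comm_monoid_add \<Rightarrow>\<^sub>0 'k::field, 'b, 'd) module_scheme \<Rightarrow> ('k, 'b) module" where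
  "as_vector_space M = restrict_scalars (\<lambda>c. Poly_Mapping.single 0 c) M"

text \<open>The \<open>K\<close>-vector space with basis \<open>W\<close>, that is, the direct sum of the lines \<open>K w\<close>, \<open>w \<in> W\<close>.\<close>

definition sum_of_lines :: "'m::comm_monoid_add set \<Rightarrow> ('k::field, 'm \<Rightarrow>\<^sub>0 'k) module" where
  "sum_of_lines W =
     \<lparr>carrier = {f. Poly_Mapping.keys f \<subseteq> W}, mult = undefined, one = undefined,
      zero = 0, add = (+), smult = (\<lambda>c f. Poly_Mapping.map ((*) c) f)\<rparr>"


section \<open>Projective monomial curves\<close>

text \<open>
  The data are integers \<open>0 = a 0 < \<dots> < a k = d\<close>; all subtractions of naturals below have arguments
  \<open>h \<le> d\<close> and are not truncated.
\<close>

definition e_vec :: "nat \<Rightarrow> nat \<Rightarrow> nat \<times> nat" where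
  "e_vec d h = (h, d - h)"

definition curve_monoid :: "(nat \<Rightarrow> nat) \<Rightarrow> nat \<Rightarrow> (nat \<times> nat) set" where
  "curve_monoid a k = add_submonoid ((\<lambda>i. e_vec (a k) (a i)) ` {0..k})"

definition set_A1 :: "(nat \<Rightarrow> nat) \<Rightarrow> nat \<Rightarrow> nat set" where
  "set_A1 a k = a ` {0..k}"

definition set_A2 :: "(nat \<Rightarrow> nat) \<Rightarrow> nat \<Rightarrow> nat set" where
  "set_A2 a k = (\<lambda>i. a k - a i) ` {0..k}"

definition omega :: "nat \<Rightarrow> nat set \<Rightarrow> nat \<Rightarrow> nat" where
  "omega d A j = (if j = d then 0 else (LEAST \<alpha>. \<alpha> \<in> add_submonoid A \<and> \<alpha> mod d = j mod d))"

definition delta :: "nat set \<Rightarrow> nat \<Rightarrow> nat" where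
  "delta A n = (LEAST m. \<exists>x :: nat \<Rightarrow> nat.
     n = (\<Sum>b\<in>A - {0}. x b * b) \<and> m = (\<Sum>b\<in>A - {0}. x b))"

definition proj_degree :: "nat \<Rightarrow> nat \<times> nat \<Rightarrow> rat" where
  "proj_degree d u = of_nat (fst u + snd u) / of_nat d"

definition w_vec :: "(nat \<Rightarrow> nat) \<Rightarrow> nat \<Rightarrow> nat \<Rightarrow> nat \<times> nat" where
  "w_vec a k j = (omega (a k) (set_A1 a k) j, omega (a k) (set_A2 a k) (a k - j))"

definition delta1 :: "(nat \<Rightarrow> nat) \<Rightarrow> nat \<Rightarrow> nat \<times> nat \<Rightarrow> rat" where
  "delta1 a k u = of_nat (delta (set_A1 a k) (fst u))"

definition delta2 :: "(nat \<Rightarrow> nat) \<Rightarrow> nat \<Rightarrow> nat \<times> nat \<Rightarrow> rat" where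
  "delta2 a k u = of_nat (delta (set_A2 a k) (snd u))"

definition maximal_homogeneous_ideal ::
  "'m::comm_monoid_add set \<Rightarrow> ('m \<Rightarrow>\<^sub>0 'k::field) set" where
  "maximal_homogeneous_ideal S = Idl\<^bsub>semigroup_ring S\<^esub> (monomial ` (S - {0}))"

text \<open>
  Local cohomology with support in the maximal homogeneous ideal, computed from its generators
  \<open>monomial (e_vec d (a i))\<close>, \<open>0 \<le> i \<le> k\<close>.
\<close>

definition curve_cohomology ::
  "(nat \<Rightarrow> nat) \<Rightarrow> nat \<Rightarrow> nat \<Rightarrow>
     ((nat \<times> nat) \<Rightarrow>\<^sub>0 'k::field,
      (nat set \<Rightarrow> (((nat \<times> nat) \<Rightarrow>\<^sub>0 'k) \<times> ((nat \<times> nat) \<Rightarrow>\<^sub>0 'k)) set) set) module" where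
  "curve_cohomology a k p =
     local_cohomology (semigroup_ring (curve_monoid a k))
       (map (\<lambda>i. monomial (e_vec (a k) (a i))) [0..<Suc k]) p"

definition buchsbaum_curve :: "'k::field itself \<Rightarrow> (nat \<Rightarrow> nat) \<Rightarrow> nat \<Rightarrow> bool" where
  "buchsbaum_curve _ a k \<longleftrightarrow>
     (let H = (curve_cohomology a k 1 :: ((nat \<times> nat) \<Rightarrow>\<^sub>0 'k, _) module) in
      \<forall>x\<in>maximal_homogeneous_ideal (curve_monoid a k). \<forall>y\<in>carrier H.
        x \<odot>\<^bsub>H\<^esub> y = \<zero>\<^bsub>H\<^esub>)"

end

theory Submission
  imports Defs "HOL-Library.Product_Lexorder"
begin

text \<open>
  Let \<open>S'\<close> be the set of \<open>w\<close> with \<open>w + n (d, 0) \<in> S\<close> and \<open>w + n (0, d) \<in> S\<close> for large \<open>n\<close>. A cocycle of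
  the Cech complex in degree 1 is a single Laurent polynomial that lies in every localization, so
  \<open>H\<^sup>1 = K[S'] / K[S]\<close>, with basis the finite set \<open>S' - S\<close>. Modulo \<open>(d, 0)\<close> and \<open>(0, d)\<close> the set \<open>S'\<close> is
  generated by the vectors \<open>w\<^sub>j\<close>, and \<open>\<delta>\<^sub>1\<close> and \<open>\<delta>\<^sub>2\<close> compared with the degree decide which of \<open>w\<^sub>j\<close>,
  \<open>w\<^sub>j + (0, d)\<close> and \<open>w\<^sub>j + (d, 0)\<close> belong to \<open>S\<close>.

  If \<open>w \<in> S' - S\<close> is lexicographically largest and \<open>x, y\<close> is a regular sequence in the maximal homogeneous
  ideal, then \<open>y (t\<^sup>w x) \<in> (x)\<close>, hence \<open>t\<^sup>w \<in> R\<close>, a contradiction; so Cohen--Macaulayness forces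
  \<open>S' = S\<close>. Conversely let \<open>S' = S\<close>. By the Nullstellensatz every maximal ideal contains nonzero
  polynomials \<open>f\<close> in \<open>t\<close> to the \<open>(0, d)\<close> and \<open>g\<close> in \<open>t\<close> to the \<open>(d, 0)\<close>, and comparing leading exponents
  shows that \<open>f, g\<close> is a regular sequence. Neither height nor grade exceeds 2, since any three
  elements of \<open>R\<close> are algebraically dependent over \<open>K\<close>.
\<close>

text \<open>Cohen--Macaulayness is tested at every maximal ideal and over an arbitrary field, so
  graded arguments at the origin do not suffice, and neither rational points nor a linear change of
  variables are available. This is why each member of the regular sequence is a polynomial in a
  single axis monomial: its leading exponent is then still pure. The common tool is the
  lexicographic order on pairs of naturals. It is a well-order compatible with addition, so leading
  exponents add under multiplication and division by leading terms terminates; it also orders the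
  gaps for the computation of the length. The numbers \<open>a i\<close> come in only at the end,
  when membership in \<open>S\<close> is translated into an inequality between \<open>delta\<close>
  and the degree: a vector is a sum of generators when its first coordinate needs no more summands
  than its degree provides, the rest of the degree being filled with copies of
  \<open>(0, d)\<close>.\<close>

instance prod :: (ordered_cancel_comm_monoid_add, ordered_cancel_comm_monoid_add)
  ordered_cancel_comm_monoid_add
proof
  fix x y z :: "'a \<times> 'b"
  assume "x \<le> y"
  then show "z + x \<le> z + y"
    by (auto simp: less_eq_prod_def add_strict_left_mono add_left_mono)
qed

section \<open>Polynomials with restricted support\<close>

type_synonym 'k plane_poly = "(nat \<times> nat) \<Rightarrow>\<^sub>0 'k"

abbreviation lookup :: "('m \<Rightarrow>\<^sub>0 'k::zero) \<Rightarrow> 'm \<Rightarrow> 'k" where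
  "lookup \<equiv> Poly_Mapping.lookup"

abbreviation keys :: "('m \<Rightarrow>\<^sub>0 'k::zero) \<Rightarrow> 'm set" where
  "keys \<equiv> Poly_Mapping.keys"

abbreviation single :: "'m \<Rightarrow> 'k \<Rightarrow> ('m \<Rightarrow>\<^sub>0 'k::zero)" where
  "single \<equiv> Poly_Mapping.single"

definition supported :: "'m set \<Rightarrow> ('m \<Rightarrow>\<^sub>0 'k::zero) set" where
  "supported S = {f. keys f \<subseteq> S}"

lemma supported_mono: "S \<subseteq> T \<Longrightarrow> supported S \<subseteq> supported T"
  by (auto simp: supported_def)

lemma supported_0 [simp]: "0 \<in> supported S"
  by (simp add: supported_def)

lemma supported_single [simp]: "u \<in> S \<Longrightarrow> single u c \<in> supported S"
  by (simp add: supported_def)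

lemma supported_single_iff: "single u c \<in> supported S \<longleftrightarrow> c = 0 \<or> u \<in> S"
  by (simp add: supported_def)

lemma supported_add [intro]:
  "f \<in> supported S \<Longrightarrow> g \<in> supported S \<Longrightarrow> f + g \<in> supported S"
  using Poly_Mapping.keys_add[of f g] by (auto simp: supported_def)

lemma supported_uminus [intro]:
  fixes f :: "'m \<Rightarrow>\<^sub>0 'k::ab_group_add"
  shows "f \<in> supported S \<Longrightarrow> - f \<in> supported S"
  by (simp add: supported_def)

lemma supported_diff [intro]:
  fixes f :: "'m \<Rightarrow>\<^sub>0 'k::ab_group_add"
  shows "f \<in> supported S \<Longrightarrow> g \<in> supported S \<Longrightarrow> f - g \<in> supported S"
  using keys_diff[of f g] by (auto simp: supported_def)

lemma supported_sum [intro]: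
  "(\<And>i. i \<in> A \<Longrightarrow> f i \<in> supported S) \<Longrightarrow> sum f A \<in> supported S"
  by (induction A rule: infinite_finite_induct) auto

lemma supported_mult:
  assumes "f \<in> supported S" "g \<in> supported T" "\<And>s t. s \<in> S \<Longrightarrow> t \<in> T \<Longrightarrow> s + t \<in> U"
  shows "f * g \<in> supported U"
  using keys_mult[of f g] assms by (fastforce simp: supported_def)

lemma supported_1: "0 \<in> T \<Longrightarrow> 1 \<in> supported T"
  for T :: "'m::zero set"
  by (simp add: supported_def)

lemma supported_power:
  fixes f :: "'m::comm_monoid_add \<Rightarrow>\<^sub>0 'k::comm_semiring_1"
  assumes "0 \<in> T" "\<And>s t. s \<in> T \<Longrightarrow> t \<in> T \<Longrightarrow> s + t \<in> T" "f \<in> supported T"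
  shows "f ^ n \<in> supported T"
proof (induction n)
  case (Suc n)
  show ?case unfolding power_Suc by (rule supported_mult[OF assms(3) Suc assms(2)])
qed (simp add: supported_1 assms(1))

lemma sum_of_terms:
  fixes f :: "'m \<Rightarrow>\<^sub>0 'k::comm_monoid_add"
  shows "f = (\<Sum>s\<in>keys f. single s (lookup f s))"
  by (rule poly_mapping_eqI)
    (auto simp: lookup_sum lookup_single when_def in_keys_iff)

lemma supported_induct [consumes 1, case_names zero single add]:
  fixes f :: "'m \<Rightarrow>\<^sub>0 'k::comm_monoid_add"
  assumes "f \<in> supported S"
    and "Q 0"
    and "\<And>s c. s \<in> S \<Longrightarrow> c \<noteq> 0 \<Longrightarrow> Q (single s c)"
    and "\<And>f g. f \<in> supported S \<Longrightarrow> g \<in> supported S \<Longrightarrow> Q f \<Longrightarrow> Q g \<Longrightarrow> Q (f + g)"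
  shows "Q f"
proof -
  have "(\<Sum>s\<in>A. single s (lookup f s)) \<in> supported S \<and>
      Q (\<Sum>s\<in>A. single s (lookup f s))"
    if "finite A" "A \<subseteq> keys f" for A
    using that
  proof (induction A)
    case empty
    then show ?case using assms(2) by simp
  next
    case (insert s A)
    moreover from insert have "s \<in> S" "lookup f s \<noteq> 0"
      using assms(1) by (auto simp: supported_def in_keys_iff)
    ultimately show ?case
      using assms(3,4) by (auto intro!: supported_add)
  qed
  from this[of "keys f"] show ?thesis
    by (simp flip: sum_of_terms)
qed

text \<open>Translation by \<open>u\<close> is injective by cancellation, so a single term of
  \<open>f\<close> contributes to the coefficient at \<open>u + v\<close>.\<close>

lemma lookup_single_mult:
  fixes f :: "'m::{cancel_ab_semigroup_add, comm_monoid_add} \<Rightarrow>\<^sub>0 'k::comm_semiring_0"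
  shows "lookup (single u c * f) (u + v) = c * lookup f v"
proof -
  have "f \<in> supported UNIV" by (simp add: supported_def)
  then show ?thesis
    by (induction f rule: supported_induct)
      (auto simp: mult_single lookup_single when_def distrib_left lookup_add)
qed

lemma keys_monomial_mult:
  fixes f :: "'m::{cancel_ab_semigroup_add, comm_monoid_add} \<Rightarrow>\<^sub>0 'k::field"
  assumes "v \<in> keys f"
  shows "u + v \<in> keys (monomial u * f)"
  using assms by (simp add: in_keys_iff lookup_single_mult)

lemma monomial_nonzero [simp]: "monomial u \<noteq> 0"
  by (metis lookup_single_eq lookup_zero zero_neq_one)

lemma monomial_mult: "monomial u * monomial v = monomial (u + v)"
  by (simp add: mult_single)

lemma supported_monomial_multD:
  fixes f :: "'m::{cancel_ab_semigroup_add, comm_monoid_add} \<Rightarrow>\<^sub>0 'k::field"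
  assumes "monomial u * f \<in> supported S" "v \<in> keys f"
  shows "u + v \<in> S"
  using keys_monomial_mult[OF assms(2), of u] assms(1) by (auto simp: supported_def)

section \<open>Leading exponents for a linear order compatible with addition\<close>

definition lead_exp :: "('m::linorder \<Rightarrow>\<^sub>0 'k::zero) \<Rightarrow> 'm" where
  "lead_exp f = Max (keys f)"

lemma lead_exp_in_keys: "f \<noteq> 0 \<Longrightarrow> lead_exp f \<in> keys f"
  by (simp add: lead_exp_def)

lemma le_lead_exp: "s \<in> keys f \<Longrightarrow> s \<le> lead_exp f"
  by (simp add: lead_exp_def)

lemma lead_exp_eqI:
  "s \<in> keys f \<Longrightarrow> (\<And>t. t \<in> keys f \<Longrightarrow> t \<le> s) \<Longrightarrow> lead_exp f = s"
  unfolding lead_exp_def by (rule Max_eqI) auto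

text \<open>With the leading term of \<open>f\<close> split off, a term of the rest
  \<open>f'\<close> times a term of \<open>g\<close> has exponent strictly below the sum of the
  leading exponents, so only the split-off term contributes there.\<close>

lemma lookup_mult_lead_exp:
  fixes f g :: "'m::{ordered_cancel_comm_monoid_add, linorder} \<Rightarrow>\<^sub>0 'k::field"
  assumes "f \<noteq> 0" "g \<noteq> 0"
  shows "lookup (f * g) (lead_exp f + lead_exp g) =
    lookup f (lead_exp f) * lookup g (lead_exp g)"
proof -
  let ?a = "lead_exp f" and ?b = "lead_exp g"
  define f' where "f' = f - single ?a (lookup f ?a)"
  have f': "s < ?a" if "s \<in> keys f'" for s
  proof -
    have "s \<noteq> ?a" "s \<in> keys f"
      using that by (auto simp: f'_def in_keys_iff lookup_minus lookup_single when_def split: if_splits)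
    then show ?thesis using le_lead_exp[of s f] by simp
  qed
  have "?a + ?b \<notin> keys (f' * g)"
  proof
    assume "?a + ?b \<in> keys (f' * g)"
    then obtain s t where st: "?a + ?b = s + t" "s \<in> keys f'" "t \<in> keys g"
      using keys_mult[of f' g] by blast
    then have "s + t < ?a + ?b"
      using f' le_lead_exp by (intro add_less_le_mono) auto
    then show False using st(1) by simp
  qed
  moreover have "f * g = single ?a (lookup f ?a) * g + f' * g"
    by (simp add: f'_def algebra_simps)
  ultimately show ?thesis
    by (simp add: lookup_add lookup_single_mult in_keys_iff)
qed

lemma lead_exp_mult:
  fixes f g :: "'m::{ordered_cancel_comm_monoid_add, linorder} \<Rightarrow>\<^sub>0 'k::field"
  assumes "f \<noteq> 0" "g \<noteq> 0"
  shows "lead_exp (f * g) = lead_exp f + lead_exp g"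
proof (rule lead_exp_eqI)
  show "lead_exp f + lead_exp g \<in> keys (f * g)"
    using assms lead_exp_in_keys[of f] lead_exp_in_keys[of g]
    by (simp add: in_keys_iff lookup_mult_lead_exp)
  fix t assume "t \<in> keys (f * g)"
  then obtain a b where "t = a + b" "a \<in> keys f" "b \<in> keys g"
    using keys_mult[of f g] by blast
  then show "t \<le> lead_exp f + lead_exp g"
    by (simp add: add_mono le_lead_exp)
qed

text \<open>One step of division: removing a multiple with the same leading term lowers the leading
  exponent, and the lexicographic order on pairs of naturals admits no infinite descent.
  \<open>noetherian_R\<close> and \<open>regular_pair\<close> iterate it.\<close>

lemma lead_exp_diff_less:
  fixes f g :: "'m::linorder \<Rightarrow>\<^sub>0 'k::field"
  assumes "lead_exp g = lead_exp f"
    and "lookup g (lead_exp f) = lookup f (lead_exp f)"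
    and "f - g \<noteq> 0"
  shows "lead_exp (f - g) < lead_exp f"
proof -
  have "lead_exp (f - g) \<in> keys (f - g)"
    using assms(3) by (rule lead_exp_in_keys)
  moreover have "lead_exp (f - g) \<noteq> lead_exp f"
    using assms(2) calculation by (auto simp: in_keys_iff lookup_minus)
  moreover have "s \<le> lead_exp f" if "s \<in> keys (f - g)" for s
    using that assms(1) keys_diff[of f g] le_lead_exp[of s f] le_lead_exp[of s g] by auto
  ultimately show ?thesis by force
qed

section \<open>Linear dependence\<close>

text \<open>Gaussian elimination, one exponent \<open>u\<close> at a time: a member with nonzero
  coefficient at \<open>u\<close> clears that coordinate from all others. Scalars are written
  \<open>single 0 c\<close> so that the dependence is an identity in the ring itself; it serves both
  for algebraic dependence and for the bound on the length.\<close>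

lemma linear_dependence:
  fixes \<phi> :: "'i \<Rightarrow> ('m::{cancel_ab_semigroup_add, comm_monoid_add} \<Rightarrow>\<^sub>0 'k::field)"
  assumes "finite U" "finite I" "card U < card I" "\<And>i. i \<in> I \<Longrightarrow> \<phi> i \<in> supported U"
  shows "\<exists>q. (\<exists>i\<in>I. q i \<noteq> 0) \<and> (\<Sum>i\<in>I. single 0 (q i) * \<phi> i) = 0"
  using assms
proof (induction U arbitrary: I \<phi> rule: finite_induct)
  case empty
  then have "\<phi> i = 0" if "i \<in> I" for i
    using that by (auto simp: supported_def)
  moreover from empty have "I \<noteq> {}" by auto
  ultimately show ?case by (intro exI[of _ "\<lambda>_. 1"]) auto
next
  case (insert u U)
  show ?case
  proof (cases "\<forall>i\<in>I. lookup (\<phi> i) u = 0")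
    case True
    then have "\<phi> i \<in> supported U" if "i \<in> I" for i
      using that insert.prems(3)[OF that] by (auto simp: supported_def in_keys_iff)
    then show ?thesis
      using insert by auto
  next
    case False
    then obtain j where j: "j \<in> I" "lookup (\<phi> j) u \<noteq> 0" by auto
    define c where "c i = lookup (\<phi> i) u / lookup (\<phi> j) u" for i
    define \<psi> where "\<psi> i = \<phi> i - single 0 (c i) * \<phi> j" for i
    have "\<psi> i \<in> supported U" if i: "i \<in> I - {j}" for i
    proof -
      have "\<psi> i \<in> supported (insert u U)"
        unfolding \<psi>_def using i j insert.prems(3)
        by (intro supported_diff supported_mult[of _ "{0}" _ "insert u U"]) auto
      moreover have "lookup (\<psi> i) u = 0"
        using j(2) lookup_single_mult[of 0 "c i" "\<phi> j" u]
        by (simp add: \<psi>_def lookup_minus c_def)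
      ultimately show ?thesis by (auto simp: supported_def in_keys_iff)
    qed
    moreover have "card U < card (I - {j})"
      using insert.prems j insert.hyps by simp
    ultimately obtain q where q: "\<exists>i\<in>I - {j}. q i \<noteq> 0"
      "(\<Sum>i\<in>I - {j}. single 0 (q i) * \<psi> i) = 0"
      using insert.IH[of "I - {j}" \<psi>] insert.prems(1) by auto
    \<comment> \<open>Each \<open>\<psi> i\<close> contains the pivot with coefficient
      \<open>- c i\<close>, so the pivot receives the total of these corrections.\<close>
    define q' where "q' = q(j := - (\<Sum>i\<in>I - {j}. q i * c i))"
    have "(\<Sum>i\<in>I. single 0 (q' i) * \<phi> i) =
      single 0 (q' j) * \<phi> j + (\<Sum>i\<in>I - {j}. single 0 (q' i) * \<phi> i)"
      using insert.prems(1) j(1) by (rule sum.remove)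
    also have "(\<Sum>i\<in>I - {j}. single 0 (q' i) * \<phi> i) =
      (\<Sum>i\<in>I - {j}. single 0 (q i) * \<phi> i)"
      by (intro sum.cong) (auto simp: q'_def)
    also have "single 0 (q' j) = - (\<Sum>i\<in>I - {j}. single 0 (q i * c i))"
      by (rule poly_mapping_eqI) (simp add: q'_def lookup_sum lookup_single when_def)
    also have "- (\<Sum>i\<in>I - {j}. single 0 (q i * c i)) * \<phi> j +
        (\<Sum>i\<in>I - {j}. single 0 (q i) * \<phi> i) =
      (\<Sum>i\<in>I - {j}. single 0 (q i) * \<phi> i - single 0 (q i * c i) * \<phi> j)"
      by (simp add: sum_subtractf sum_distrib_right)
    also have "\<dots> = (\<Sum>i\<in>I - {j}. single 0 (q i) * \<psi> i)"
      by (simp add: \<psi>_def right_diff_distrib mult_single flip: mult.assoc)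
    finally have "(\<Sum>i\<in>I. single 0 (q' i) * \<phi> i) = 0"
      using q(2) by simp
    moreover have "\<exists>i\<in>I. q' i \<noteq> 0"
      using q(1) by (auto simp: q'_def)
    ultimately show ?thesis by blast
  qed
qed

section \<open>Semigroup rings of planar monoids\<close>

text \<open>Fix one element \<open>(p, q)\<close> of \<open>B\<close>. An element that does not
  dominate it has first coordinate below \<open>p\<close> or second below \<open>q\<close>, hence
  lies on one of finitely many lines parallel to the axes, and each line needs only its lowest
  point.\<close>

lemma dickson_plane:
  fixes B :: "(nat \<times> nat) set"
  shows "\<exists>F\<subseteq>B. finite F \<and> (\<forall>b\<in>B. \<exists>f\<in>F. fst f \<le> fst b \<and> snd f \<le> snd b)"
proof (cases "B = {}")
  case False
  then obtain p q where pq: "(p, q) \<in> B" by auto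
  define row where "row i = (i, LEAST y. (i, y) \<in> B)" for i
  define col where "col j = (LEAST x. (x, j) \<in> B, j)" for j
  \<comment> \<open>The intersection with \<open>B\<close> discards the lines that miss
    \<open>B\<close>, where \<open>LEAST\<close> has an unspecified value.\<close>
  define F where "F = ({(p, q)} \<union> row ` {..<p} \<union> col ` {..<q}) \<inter> B"
  have "\<exists>f\<in>F. fst f \<le> x \<and> snd f \<le> y" if xy: "(x, y) \<in> B" for x y
  proof -
    consider "p \<le> x" "q \<le> y" | "x < p" | "y < q" by linarith
    then show ?thesis
    proof cases
      case 1
      then show ?thesis using pq by (intro bexI[of _ "(p, q)"]) (auto simp: F_def)
    next
      case 2
      have "row x \<in> B" unfolding row_def using xy by (rule LeastI)
      then have "row x \<in> F" using 2 by (auto simp: F_def)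
      moreover have "snd (row x) \<le> y" unfolding row_def using xy by (simp add: Least_le)
      ultimately show ?thesis by (intro bexI[of _ "row x"]) (auto simp: row_def)
    next
      case 3
      have "col y \<in> B" unfolding col_def using xy by (rule LeastI)
      then have "col y \<in> F" using 3 by (auto simp: F_def)
      moreover have "fst (col y) \<le> x" unfolding col_def using xy by (simp add: Least_le)
      ultimately show ?thesis by (intro bexI[of _ "col y"]) (auto simp: col_def)
    qed
  qed
  moreover have "F \<subseteq> B" "finite F" by (auto simp: F_def)
  ultimately show ?thesis by (intro exI[of _ F]) auto
qed auto

text \<open>Inside one residue class modulo \<open>d\<close> in both coordinates, domination means
  differing by multiples of \<open>(d, 0)\<close> and \<open>(0, d)\<close>. Applied to the monoid
  itself, this says that the ring is finite over the polynomials in the two axis monomials.\<close>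

lemma dickson_plane_mod:
  fixes B :: "(nat \<times> nat) set" and d :: nat
  assumes "d > 0"
  shows "\<exists>F\<subseteq>B. finite F \<and> (\<forall>b\<in>B. \<exists>f\<in>F. \<exists>i j. b = f + (i * d, j * d))"
proof -
  define C where "C r = {b \<in> B. (fst b mod d, snd b mod d) = r}" for r
  have "\<exists>F. F \<subseteq> C r \<and> finite F \<and> (\<forall>b\<in>C r. \<exists>f\<in>F. fst f \<le> fst b \<and> snd f \<le> snd b)" for r
    using dickson_plane[of "C r"] by blast
  then obtain F where F: "\<And>r. F r \<subseteq> C r" "\<And>r. finite (F r)"
    "\<And>r. \<forall>b\<in>C r. \<exists>f\<in>F r. fst f \<le> fst b \<and> snd f \<le> snd b"
    by metis
  let ?F = "\<Union>r\<in>{..<d} \<times> {..<d}. F r"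
  have "\<exists>f\<in>?F. \<exists>i j. b = f + (i * d, j * d)" if "b \<in> B" for b
  proof -
    let ?r = "(fst b mod d, snd b mod d)"
    have "b \<in> C ?r" using that by (simp add: C_def)
    then obtain f where f: "f \<in> F ?r" "fst f \<le> fst b" "snd f \<le> snd b"
      using F(3) by blast
    then have "fst b mod d = fst f mod d" "snd b mod d = snd f mod d"
      using F(1)[of ?r] by (auto simp: C_def)
    then obtain i j where "fst b = fst f + d * i" "snd b = snd f + d * j"
      using mod_eq_nat1E f(2,3) by metis
    moreover have "f \<in> ?F" using f(1) assms by force
    ultimately show ?thesis
      by (intro bexI[of _ f] exI[of _ i] exI[of _ j]) (auto simp: prod_eq_iff)
  qed
  moreover have "?F \<subseteq> B" using F(1) by (auto simp: C_def)
  moreover have "finite ?F" using F(2) by blast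
  ultimately show ?thesis by blast
qed

text \<open>The two axis elements place a polynomial ring in two variables inside \<open>R\<close>,
  over which \<open>R\<close> is finite by \<open>dickson_plane_mod\<close>. Dimension, depth and
  cohomology are treated at this level, before the degrees of the curve enter.\<close>

locale plane_monoid =
  fixes S :: "(nat \<times> nat) set" and d :: nat and R :: "(((nat \<times> nat) \<Rightarrow>\<^sub>0 'k::field)) ring"
  assumes R_def: "R = semigroup_ring S"
    and zero_S: "0 \<in> S" and add_S: "s \<in> S \<Longrightarrow> t \<in> S \<Longrightarrow> s + t \<in> S"
    and d_pos: "d > 0" and x_S: "(d, 0) \<in> S" and y_S: "(0, d) \<in> S"
begin

lemma carrier_R [simp]: "carrier R = supported S"
  and mult_R [simp]: "f \<otimes>\<^bsub>R\<^esub> g = f * g"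
  and one_R [simp]: "\<one>\<^bsub>R\<^esub> = 1"
  and zero_R [simp]: "\<zero>\<^bsub>R\<^esub> = 0"
  and add_R [simp]: "f \<oplus>\<^bsub>R\<^esub> g = f + g"
  by (simp_all add: R_def semigroup_ring_def supported_def)

lemma supported_S_mult [intro]:
  "f \<in> supported S \<Longrightarrow> g \<in> supported S \<Longrightarrow> f * g \<in> supported S"
  by (rule supported_mult) (auto intro: add_S)

lemma supported_S_1 [simp]: "1 \<in> supported S"
  by (simp add: supported_def zero_S)

lemma supported_S_const [simp]: "single 0 c \<in> supported S"
  by (simp add: zero_S)

lemma supported_S_power [intro]: "f \<in> supported S \<Longrightarrow> f ^ n \<in> supported S"
  by (induction n) auto

lemma x_multiple_S: "(i * d, 0) \<in> S"
proof (induction i)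
  case (Suc i)
  then show ?case using add_S[OF x_S Suc] by simp
qed (use zero_S in \<open>simp add: zero_prod_def\<close>)

lemma y_multiple_S: "(0, i * d) \<in> S"
proof (induction i)
  case (Suc i)
  then show ?case using add_S[OF y_S Suc] by simp
qed (use zero_S in \<open>simp add: zero_prod_def\<close>)

lemma base_S: "(i * d, j * d) \<in> S"
  using add_S[OF x_multiple_S y_multiple_S] by simp

lemma domain_R: "domain R"
proof (rule domainI)
  show "cring R"
  proof (rule cringI)
    show "abelian_group R"
    proof (rule abelian_groupI)
      fix f assume "f \<in> carrier R"
      then show "\<exists>g\<in>carrier R. g \<oplus>\<^bsub>R\<^esub> f = \<zero>\<^bsub>R\<^esub>"
        by (intro bexI[of _ "- f"]) auto
    qed (auto simp: ac_simps)
    show "comm_monoid R"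
      by (rule comm_monoidI) (auto simp: ac_simps)
  qed (auto simp: algebra_simps)
qed auto

lemma cring_R: "cring R"
  using domain_R domain.axioms(1) by blast

lemma ring_R: "ring R"
  using cring_R cring.axioms(1) by blast

lemma a_inv_R [simp]: "f \<in> supported S \<Longrightarrow> \<ominus>\<^bsub>R\<^esub> f = - f"
  using abelian_group.minus_equality[OF ring.is_abelian_group[OF ring_R], of "- f" f] by auto

lemma ideal_iff:
  "ideal J R \<longleftrightarrow> J \<subseteq> supported S \<and> 0 \<in> J \<and> (\<forall>f\<in>J. \<forall>g\<in>J. f + g \<in> J) \<and>
    (\<forall>f\<in>J. \<forall>r\<in>supported S. r * f \<in> J)" (is "_ \<longleftrightarrow> ?J")
proof
  assume "ideal J R"
  then interpret ideal J R .
  show ?J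
    using a_subset additive_subgroup.zero_closed[OF is_additive_subgroup]
      additive_subgroup.a_closed[OF is_additive_subgroup] I_l_closed by auto
next
  assume J: ?J
  have "- f \<in> J" if "f \<in> J" for f
    using J that supported_uminus[OF supported_S_1] by (metis mult_minus1)
  moreover have "inv\<^bsub>add_monoid R\<^esub> f = - f" if "f \<in> J" for f
    using that J a_inv_R[of f] by (auto simp: a_inv_def)
  ultimately have "subgroup J (add_monoid R)"
    using J by (intro group.subgroupI abelian_group.a_group ring.is_abelian_group ring_R) auto
  then show "ideal J R"
    by (rule idealI[OF ring_R]) (use J in \<open>auto simp: mult.commute\<close>)
qed

lemma
  assumes "ideal J R"
  shows ideal_subset: "f \<in> J \<Longrightarrow> f \<in> supported S"
    and ideal_0: "0 \<in> J"
    and ideal_add: "f \<in> J \<Longrightarrow> g \<in> J \<Longrightarrow> f + g \<in> J"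
    and ideal_mult: "f \<in> J \<Longrightarrow> r \<in> supported S \<Longrightarrow> r * f \<in> J"
    and ideal_mult': "f \<in> J \<Longrightarrow> r \<in> supported S \<Longrightarrow> f * r \<in> J"
    and ideal_diff: "f \<in> J \<Longrightarrow> g \<in> J \<Longrightarrow> f - g \<in> J"
proof -
  note J = assms[unfolded ideal_iff]
  have um: "- f \<in> J" if "f \<in> J" for f
    using J that supported_uminus[OF supported_S_1] by (metis mult_minus1)
  show "f - g \<in> J" if "f \<in> J" "g \<in> J" for f g
    using J um that by (metis diff_conv_add_uminus)
qed (use assms[unfolded ideal_iff] in \<open>auto simp: mult.commute\<close>)

lemma ideal_one_iff: "ideal J R \<Longrightarrow> 1 \<in> J \<longleftrightarrow> J = carrier R"
  using ideal.one_imp_carrier[of J R] by auto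

lemma genideal_ideal_R: "A \<subseteq> supported S \<Longrightarrow> ideal (Idl\<^bsub>R\<^esub> A) R"
  using ring.genideal_ideal[OF ring_R] by simp

lemma genideal_empty_R: "Idl\<^bsub>R\<^esub> {} = {0}"
  using ring.genideal_minimal[OF ring_R ring.zeroideal[OF ring_R], of "{}"]
    ideal_0[OF genideal_ideal_R[of "{}"]] by auto

lemma genideal_singleton_R: "f \<in> supported S \<Longrightarrow> Idl\<^bsub>R\<^esub> {f} = {r * f | r. r \<in> supported S}"
  using cring.cgenideal_eq_genideal[OF cring_R, of f] by (auto simp: cgenideal_def)

text \<open>A Groebner basis argument: the leading exponents of \<open>J\<close> are covered by
  finitely many of them up to multiples of \<open>(d, 0)\<close> and \<open>(0, d)\<close>, whose
  monomials lie in \<open>R\<close>. So any nonzero \<open>f\<close> in \<open>J\<close> shares its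
  leading term with a multiple of a chosen generator, and induction applies to the
  difference.\<close>

lemma noetherian_R: "noetherian_ring R"
proof (rule ring.noetherian_ringI[OF ring_R])
  fix J assume J: "ideal J R"
  define E where "E = lead_exp ` (J - {0})"
  obtain F where F: "F \<subseteq> E" "finite F" "\<forall>b\<in>E. \<exists>f\<in>F. \<exists>i j. b = f + (i * d, j * d)"
    using dickson_plane_mod[OF d_pos, of E] by blast
  have "\<exists>g. g \<in> J \<and> g \<noteq> 0 \<and> lead_exp g = b" if "b \<in> F" for b
    using subsetD[OF F(1) that] unfolding E_def by blast
  then obtain g where g: "\<And>b. b \<in> F \<Longrightarrow> g b \<in> J \<and> g b \<noteq> 0 \<and> lead_exp (g b) = b"
    by metis
  have gJ: "g ` F \<subseteq> J" using g by blast
  then have gR: "g ` F \<subseteq> supported S" using ideal_subset[OF J] by blast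
  note I = genideal_ideal_R[OF gR]
  have in_I: "f \<in> Idl\<^bsub>R\<^esub> (g ` F)" if "f \<in> J" for f
    using that
  proof (induction "lead_exp f" arbitrary: f rule: less_induct)
    case less
    show ?case
    proof (cases "f = 0")
      case True
      then show ?thesis using ideal_0[OF I] by simp
    next
      case False
      then have "lead_exp f \<in> E" unfolding E_def using less.prems by blast
      from bspec[OF F(3) this]
      obtain b i j where b: "b \<in> F" "lead_exp f = b + (i * d, j * d)" by blast
      let ?c = "lookup f (lead_exp f) / lookup (g b) b"
      let ?m = "single (i * d, j * d) ?c"
      have lg: "lookup (g b) b \<noteq> 0"
        using lead_exp_in_keys[of "g b"] g[OF b(1)] by (simp add: in_keys_iff)
      have c: "?c \<noteq> 0" using lg lead_exp_in_keys[OF False] by (simp add: in_keys_iff)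
      then have m0: "?m \<noteq> 0" by (metis lookup_single_eq lookup_zero)
      have "lead_exp ?m = (i * d, j * d)" using c by (simp add: lead_exp_def)
      then have lm: "lead_exp (?m * g b) = lead_exp f"
        using lead_exp_mult[OF m0, of "g b"] g[OF b(1)] b(2) by (simp add: add.commute)
      have "lookup (?m * g b) (lead_exp f) = lookup f (lead_exp f)"
        using lookup_single_mult[of "(i * d, j * d)" ?c "g b" b] lg b(2) by (simp add: add.commute)
      note smaller = lead_exp_diff_less[OF lm this]
      have mS: "?m \<in> supported S" by (simp add: base_S)
      have "g b \<in> Idl\<^bsub>R\<^esub> (g ` F)"
        using ring.genideal_self[OF ring_R] gR b(1) by auto
      then have h: "?m * g b \<in> Idl\<^bsub>R\<^esub> (g ` F)" using ideal_mult[OF I] mS by blast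
      have "f - ?m * g b \<in> J"
        using less.prems g[OF b(1)] mS by (intro ideal_diff[OF J] ideal_mult[OF J]) auto
      then have "f - ?m * g b \<in> Idl\<^bsub>R\<^esub> (g ` F)"
        using smaller less.hyps ideal_0[OF I] by (cases "f - ?m * g b = 0") auto
      from ideal_add[OF I this h] show ?thesis by simp
    qed
  qed
  have "J = Idl\<^bsub>R\<^esub> (g ` F)"
    using in_I ring.genideal_minimal[OF ring_R J gJ] by auto
  then show "\<exists>A\<subseteq>carrier R. finite A \<and> J = Idl\<^bsub>R\<^esub> A"
    using gR F(2) by auto
qed

end

section \<open>Algebraic dependence bounds dimension and grade\<close>

lemma supported_box_power:
  assumes "f \<in> supported ({..M} \<times> {..M::nat})"
  shows "f ^ n \<in> supported ({..n * M} \<times> {..n * M})"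
proof (induction n)
  case 0
  show ?case by (simp add: supported_def zero_prod_def)
next
  case (Suc n)
  show ?case
    unfolding power_Suc by (rule supported_mult[OF assms Suc]) auto
qed

lemma finite_subset_box:
  fixes A :: "(nat \<times> nat) set"
  assumes "finite A"
  shows "\<exists>M. A \<subseteq> {..M} \<times> {..M}"
proof (intro exI subsetI)
  fix z assume z: "z \<in> A"
  have "fst z \<le> Max (fst ` A)" "snd z \<le> Max (snd ` A)"
    using z assms by auto
  then show "z \<in> {..max (Max (fst ` A)) (Max (snd ` A))} \<times> {..max (Max (fst ` A)) (Max (snd ` A))}"
    by (cases z) auto
qed

text \<open>A count: the \<open>N ^ 3\<close> products have exponents in a square with
  \<open>(3 * N * M + 1) ^ 2\<close> points, and the cube wins for large \<open>N\<close>. The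
  relation has nested form because it is later stripped one variable at a time.\<close>

lemma algebraic_dependence:
  fixes x0 x1 x2 :: "((nat \<times> nat) \<Rightarrow>\<^sub>0 'k::field)"
  shows "\<exists>N q. (\<exists>a<N. \<exists>b<N. \<exists>c<N. q a b c \<noteq> (0::'k)) \<and>
    (\<Sum>a<N. x0 ^ a * (\<Sum>b<N. x1 ^ b * (\<Sum>c<N. x2 ^ c * single 0 (q a b c)))) = 0"
proof -
  obtain M where M: "keys x0 \<union> keys x1 \<union> keys x2
      \<subseteq> {..M} \<times> {..M}"
    using finite_subset_box[of "keys x0 \<union> keys x1 \<union> keys x2"]
    by auto
  \<comment> \<open>Since \<open>3 * N * M + 1 \<le> N * (3 * M + 1)\<close>, the square has at most
    \<open>N ^ 2 * (3 * M + 1) ^ 2\<close> points, and \<open>(3 * M + 1) ^ 2 < N\<close> makes this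
    less than \<open>N ^ 3\<close>.\<close>
  define N where "N = (3 * M + 1)\<^sup>2 + 1"
  let ?U = "{..3 * (N * M)} \<times> {..3 * (N * M)}"
  let ?I = "{..<N} \<times> {..<N} \<times> {..<N}"
  let ?\<phi> = "\<lambda>(a, b, c). x0 ^ a * (x1 ^ b * x2 ^ c)"
  have pow: "x ^ a \<in> supported ({..N * M} \<times> {..N * M})"
    if "a < N" "x \<in> {x0, x1, x2}" for a x
  proof -
    have "x \<in> supported ({..M} \<times> {..M})" using M that(2) by (auto simp: supported_def)
    from supported_box_power[OF this, of a] have "x ^ a \<in> supported ({..a * M} \<times> {..a * M})" .
    moreover have "{..a * M} \<times> {..a * M} \<subseteq> {..N * M} \<times> {..N * M}"
      using that(1) by (intro Sigma_mono) (simp_all only: atMost_subset_iff mult_le_mono1 less_imp_le)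
    ultimately show ?thesis using supported_mono by blast
  qed
  have "?\<phi> t \<in> supported ?U" if "t \<in> ?I" for t
  proof -
    obtain a b c where t': "t = (a, b, c)" by (cases t)
    with that have t: "t = (a, b, c)" "a < N" "b < N" "c < N" by auto
    have *: "x1 ^ b * x2 ^ c \<in> supported ({..2 * (N * M)} \<times> {..2 * (N * M)})"
      by (rule supported_mult[OF pow pow]) (use t in auto)
    show ?thesis
      unfolding t(1) prod.case by (rule supported_mult[OF pow *]) (use t in auto)
  qed
  moreover have "card ?U < card ?I"
  proof -
    have "3 * (N * M) + 1 \<le> N * (3 * M + 1)" by (simp add: N_def algebra_simps)
    then have "(3 * (N * M) + 1)\<^sup>2 \<le> N\<^sup>2 * (3 * M + 1)\<^sup>2"
      by (metis power_mono power_mult_distrib zero_le)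
    also have "\<dots> < N\<^sup>2 * N" by (simp add: N_def)
    finally show ?thesis by (simp add: card_cartesian_product power2_eq_square)
  qed
  ultimately obtain q where q: "\<exists>t\<in>?I. q t \<noteq> 0"
    "(\<Sum>t\<in>?I. single 0 (q t) * ?\<phi> t) = 0"
    using linear_dependence[of ?U ?I ?\<phi>] by (metis (no_types, lifting) finite_SigmaI finite_atMost finite_lessThan)
  have "(\<Sum>a<N. x0 ^ a * (\<Sum>b<N. x1 ^ b * (\<Sum>c<N. x2 ^ c * single 0 (q (a, b, c))))) =
    (\<Sum>a<N. \<Sum>b<N. \<Sum>c<N. single 0 (q (a, b, c)) * ?\<phi> (a, b, c))"
    by (simp add: sum_distrib_left ac_simps)
  also have "\<dots> = (\<Sum>t\<in>?I. single 0 (q t) * ?\<phi> t)"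
    by (simp add: sum.cartesian_product case_prod_unfold)
  finally have "(\<Sum>a<N. x0 ^ a * (\<Sum>b<N. x1 ^ b * (\<Sum>c<N. x2 ^ c * single 0 (q (a, b, c))))) = 0"
    using q(2) by simp
  moreover have "\<exists>a<N. \<exists>b<N. \<exists>c<N. q (a, b, c) \<noteq> 0" using q(1) by auto
  ultimately show ?thesis by (intro exI[of _ N] exI[of _ "\<lambda>a b c. q (a, b, c)"]) blast
qed

context plane_monoid
begin

text \<open>As \<open>x\<close> is a nonzerodivisor modulo \<open>J\<close>, the power
  \<open>x ^ m\<close> common to all remaining terms can be cancelled. What is left is
  \<open>G m\<close> plus a multiple of \<open>x\<close>, and \<open>x\<close> belongs to the larger
  ideal \<open>J'\<close>.\<close>

lemma lowest_coefficient_mem: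
  assumes J: "ideal J R" and J': "ideal J' R" "J \<subseteq> J'"
    and x: "x \<in> J'" "\<And>r. r \<in> supported S \<Longrightarrow> x * r \<in> J \<Longrightarrow> r \<in> J"
    and G: "\<And>a. G a \<in> supported S" "\<And>a. a < m \<Longrightarrow> G a = 0" "m < N"
    and sum: "(\<Sum>a<N. x ^ a * G a) \<in> J"
  shows "G m \<in> J'"
proof -
  note xS = ideal_subset[OF J'(1) x(1)]
  define rest where "rest = (\<Sum>a\<in>{Suc m..<N}. x ^ (a - Suc m) * G a)"
  have restS: "rest \<in> supported S"
    unfolding rest_def using xS G(1) by auto
  have "(\<Sum>a<N. x ^ a * G a) = (\<Sum>a\<in>{m..<N}. x ^ a * G a)"
    by (rule sum.mono_neutral_right) (auto simp: G(2))
  also have "\<dots> = (\<Sum>a\<in>{m..<N}. x ^ m * (x ^ (a - m) * G a))"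
    by (rule sum.cong) (auto simp: mult.assoc[symmetric] power_add[symmetric])
  also have "\<dots> = x ^ m * (\<Sum>a\<in>{m..<N}. x ^ (a - m) * G a)"
    by (simp add: sum_distrib_left)
  also have "(\<Sum>a\<in>{m..<N}. x ^ (a - m) * G a) = G m + (\<Sum>a\<in>{Suc m..<N}. x ^ (a - m) * G a)"
    using G(3) by (simp add: sum.atLeast_Suc_lessThan)
  also have "(\<Sum>a\<in>{Suc m..<N}. x ^ (a - m) * G a) = x * rest"
    unfolding rest_def sum_distrib_left
    by (rule sum.cong) (auto simp: mult.assoc[symmetric] Suc_diff_Suc simp flip: power_Suc)
  finally have "x ^ m * (G m + x * rest) \<in> J" using sum by simp
  moreover have "r \<in> J" if "r \<in> supported S" "x ^ n * r \<in> J" for r n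
    using that
  proof (induction n)
    case (Suc n)
    then show ?case using x(2)[of "x ^ n * r"] xS by (auto simp: mult.assoc)
  qed simp
  moreover have "G m + x * rest \<in> supported S" using G(1) xS restS by auto
  ultimately have "G m + x * rest \<in> J'" using J'(2) by blast
  moreover have "x * rest \<in> J'" using ideal_mult'[OF J'(1) x(1) restS] .
  ultimately show ?thesis using ideal_diff[OF J'(1)] by fastforce
qed

text \<open>
  Both for a chain of primes and for the ideals generated by the initial segments of a regular
  sequence, an algebraic relation between the \<open>x i\<close> can be divided by its lexicographically
  lowest monomial.
\<close>

lemma no_regular_chain_3:
  assumes J: "\<And>i. i \<le> 3 \<Longrightarrow> ideal (J i) R" "\<And>i. i < 3 \<Longrightarrow> J i \<subseteq> J (Suc i)"
    and x: "\<And>i. i < 3 \<Longrightarrow> x i \<in> J (Suc i)"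
      "\<And>i r. i < 3 \<Longrightarrow> r \<in> supported S \<Longrightarrow> x i * r \<in> J i \<Longrightarrow> r \<in> J i"
  shows "1 \<in> J 3"
proof -
  obtain N q where q: "\<exists>a<N. \<exists>b<N. \<exists>c<N. q a b c \<noteq> 0"
    "(\<Sum>a<N. x 0 ^ a * (\<Sum>b<N. x 1 ^ b * (\<Sum>c<N. x 2 ^ c * single 0 (q a b c)))) = 0"
    using algebraic_dependence[of "x 0" "x 1" "x 2"] by blast
  define G1 where "G1 a b = (\<Sum>c<N. x 2 ^ c * single 0 (q a b c))" for a b
  define G0 where "G0 a = (\<Sum>b<N. x 1 ^ b * G1 a b)" for a
  define q0 where "q0 a \<longleftrightarrow> (\<exists>b<N. \<exists>c<N. q a b c \<noteq> 0)" for a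
  define q1 where "q1 a b \<longleftrightarrow> (\<exists>c<N. q a b c \<noteq> 0)" for a b
  have least: "\<exists>n<N. P n \<and> (\<forall>m<n. \<not> P m)" if "\<exists>n<N. P n" for P
    using that exists_least_iff[of "\<lambda>n. n < N \<and> P n"] by (meson less_trans)
  obtain a where a: "a < N" "q0 a" "\<And>a'. a' < a \<Longrightarrow> \<not> q0 a'"
    using least[of q0] q(1) unfolding q0_def by blast
  obtain b where b: "b < N" "q1 a b" "\<And>b'. b' < b \<Longrightarrow> \<not> q1 a b'"
    using least[of "q1 a"] a(2) unfolding q0_def q1_def by blast
  obtain c where c: "c < N" "q a b c \<noteq> 0" "\<And>c'. c' < c \<Longrightarrow> q a b c' = 0"
    using least[of "\<lambda>c. q a b c \<noteq> 0"] b(2) unfolding q1_def by blast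
  have G1_0: "G1 a b = 0" if "\<not> q1 a b" for a b
    using that by (simp add: G1_def q1_def)
  have G0_0: "G0 a = 0" if "\<not> q0 a" for a
    using that G1_0 by (simp add: G0_def q0_def q1_def)
  have xS: "x i \<in> supported S" if "i < 3" for i
    using that x(1)[OF that] ideal_subset[OF J(1), of "Suc i"] by simp
  have G1_S: "G1 a b \<in> supported S" for a b
    unfolding G1_def using xS[of 2]
    by (intro supported_sum supported_S_mult supported_S_power) auto
  have G0_S: "G0 a \<in> supported S" for a
    unfolding G0_def using xS[of 1] G1_S
    by (intro supported_sum supported_S_mult supported_S_power) auto
  have sum: "(\<Sum>a<N. x 0 ^ a * G0 a) = 0"
    using q(2) by (simp add: G0_def G1_def)
  have J_le: "J 0 \<subseteq> J 1" "J 1 \<subseteq> J 2" "J 2 \<subseteq> J 3"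
    and x_in: "x 0 \<in> J 1" "x 1 \<in> J 2" "x 2 \<in> J 3"
    using J(2)[of 0] J(2)[of 1] J(2)[of 2] x(1)[of 0] x(1)[of 1] x(1)[of 2]
    by (simp_all add: eval_nat_numeral)
  have "(\<Sum>a<N. x 0 ^ a * G0 a) \<in> J 0"
    using sum ideal_0[OF J(1)[of 0]] by simp
  then have "G0 a \<in> J 1"
    by (rule lowest_coefficient_mem[OF J(1) J(1) J_le(1) x_in(1) x(2) G0_S G0_0[OF a(3)] a(1), rotated -1])
      auto
  then have "(\<Sum>b<N. x 1 ^ b * G1 a b) \<in> J 1"
    by (simp add: G0_def)
  then have "G1 a b \<in> J 2"
    by (rule lowest_coefficient_mem[OF J(1) J(1) J_le(2) x_in(2) x(2) G1_S G1_0[OF b(3)] b(1), rotated -1])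
      auto
  then have "(\<Sum>c<N. x 2 ^ c * single 0 (q a b c)) \<in> J 2"
    by (simp add: G1_def)
  then have q3: "single 0 (q a b c) \<in> J 3"
    by (rule lowest_coefficient_mem[OF J(1) J(1) J_le(3) x_in(3) x(2) _ _ c(1), rotated -1])
      (auto simp: c(3))
  have "single 0 (inverse (q a b c)) * single 0 (q a b c) \<in> J 3"
    by (rule ideal_mult[OF J(1) q3]) auto
  then show ?thesis using c(2) by (simp add: mult_single)
qed

text \<open>A chain of four primes would provide \<open>x i\<close> in \<open>Q (Suc i)\<close>
  outside \<open>Q i\<close>, and primeness makes \<open>x i\<close> a nonzerodivisor modulo
  \<open>Q i\<close>, as \<open>no_regular_chain_3\<close> requires.\<close>

lemma ideal_height_le_2: "ideal_height R P \<le> 2"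
  unfolding ideal_height_def
proof (rule Sup_least, safe)
  fix n and Q :: "nat \<Rightarrow> 'k plane_poly set"
  assume Q: "\<forall>i\<le>n. primeideal (Q i) R" "\<forall>i<n. Q i \<subset> Q (Suc i)"
  show "enat n \<le> 2"
  proof (rule ccontr)
    assume "\<not> enat n \<le> 2"
    then have n: "n \<ge> 3" by (simp add: numeral_eq_enat)
    have "\<forall>i<3. \<exists>x. x \<in> Q (Suc i) \<and> x \<notin> Q i" using Q(2) n by (meson less_le_trans psubset_imp_ex_mem DiffD1 DiffD2)
    then obtain x where x: "\<And>i. i < 3 \<Longrightarrow> x i \<in> Q (Suc i) \<and> x i \<notin> Q i" by metis
    have prime: "primeideal (Q i) R" if "i \<le> 3" for i using Q(1) n that by simp
    then have idl: "ideal (Q i) R" if "i \<le> 3" for i using that primeideal.axioms(1) by blast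
    have sub: "Q i \<subseteq> Q (Suc i)" if "i < 3" for i
      using Q(2) less_le_trans[OF that n] by blast
    have "1 \<in> Q 3"
    proof (rule no_regular_chain_3[of Q x])
      fix i r assume i: "i < (3::nat)" "r \<in> supported S" "x i * r \<in> Q i"
      have "x i \<in> supported S" using x[OF i(1)] ideal_subset[OF idl, of "Suc i"] i(1) by simp
      then show "r \<in> Q i"
        using primeideal.I_prime[OF prime, of i "x i" r] i x[OF i(1)] by auto
    qed (use idl x sub in auto)
    then show False
      using ideal_one_iff[OF idl, of 3] primeideal.I_notcarr[OF prime, of 3] by simp
  qed
qed

lemma grade_le_2: "grade R P \<le> 2"
  unfolding grade_def
proof (rule SUP_least, safe)
  fix xs assume xs: "regular_sequence R xs"
  show "enat (length xs) \<le> 2"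
  proof (rule ccontr)
    assume "\<not> enat (length xs) \<le> 2"
    then have n: "length xs \<ge> 3" by (simp add: numeral_eq_enat)
    let ?J = "\<lambda>i. Idl\<^bsub>R\<^esub> (set (take i xs))"
    have xsS: "set xs \<subseteq> supported S" using xs by (simp add: regular_sequence_def)
    then have sub: "set (take i xs) \<subseteq> supported S" for i using set_take_subset[of i xs] by blast
    have "1 \<in> ?J 3"
    proof (rule no_regular_chain_3[of ?J "\<lambda>i. xs ! i"])
      fix i assume i: "i < (3::nat)"
      have "set (take i xs) \<subseteq> set (take (Suc i) xs)" by (simp add: set_take_subset_set_take)
      then show "?J i \<subseteq> ?J (Suc i)" using ring.subset_Idl_subset[OF ring_R] sub by simp
      have "xs ! i \<in> set (take (Suc i) xs)" using i n by (simp add: take_Suc_conv_app_nth)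
      then show "xs ! i \<in> ?J (Suc i)" using ring.genideal_self[OF ring_R, of "set (take (Suc i) xs)"] sub by auto
      show "r \<in> ?J i" if "r \<in> supported S" "xs ! i * r \<in> ?J i" for r
        using that xs i n by (simp add: regular_sequence_def)
    qed (use genideal_ideal_R sub in auto)
    then have "1 \<in> Idl\<^bsub>R\<^esub> (set xs)"
      using ring.subset_Idl_subset[OF ring_R, of "set xs" "set (take 3 xs)"] xsS set_take_subset[of 3 xs] by auto
    then show False
      using ideal_one_iff[OF genideal_ideal_R[OF xsS]] xs by (simp add: regular_sequence_def)
  qed
qed

end

section \<open>Maximal ideals\<close>

context plane_monoid
begin

text \<open>For \<open>h\<close> outside \<open>P\<close>, maximality forces
  \<open>P + h R = R\<close>, so \<open>1\<close> is congruent to a multiple of \<open>h\<close>.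
  This is the form in which the field property of \<open>R / P\<close> is used.\<close>

lemma maximal_ideal:
  assumes "maximalideal P R"
  shows "ideal P R" and "primeideal P R" and "1 \<notin> P"
    and maximal_inverse: "h \<in> supported S \<Longrightarrow> h \<notin> P \<Longrightarrow> \<exists>b\<in>supported S. 1 - h * b \<in> P"
proof -
  show P: "ideal P R" using assms maximalideal.axioms(1) by blast
  show "primeideal P R" using cring.maximalideal_prime[OF cring_R assms] .
  show one: "1 \<notin> P" using ideal_one_iff[OF P] maximalideal.I_notcarr[OF assms] by auto
  assume h: "h \<in> supported S" "h \<notin> P"
  define J where "J = {p + h * r | p r. p \<in> P \<and> r \<in> supported S}"
  have J_I: "p + h * r \<in> J" if "p \<in> P" "r \<in> supported S" for p r
    using that unfolding J_def by blast
  have J_E: "\<exists>p r. f = p + h * r \<and> p \<in> P \<and> r \<in> supported S" if "f \<in> J" for f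
    using that unfolding J_def by blast
  have "ideal J R"
    unfolding ideal_iff
  proof (intro conjI ballI)
    show "J \<subseteq> supported S" using ideal_subset[OF P] h(1) by (auto simp: J_def)
    show "0 \<in> J" using J_I[OF ideal_0[OF P] supported_0] by simp
    fix f assume "f \<in> J"
    then obtain p r where f: "f = p + h * r" "p \<in> P" "r \<in> supported S" using J_E by blast
    show "f + g \<in> J" if "g \<in> J" for g
    proof -
      from that obtain p' r' where g: "g = p' + h * r'" "p' \<in> P" "r' \<in> supported S" using J_E by blast
      have "f + g = (p + p') + h * (r + r')" by (simp add: f(1) g(1) algebra_simps)
      moreover have "p + p' \<in> P" "r + r' \<in> supported S"
        using f g ideal_add[OF P] by auto
      ultimately show ?thesis using J_I by simp
    qed
    show "c * f \<in> J" if "c \<in> supported S" for c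
    proof -
      have "c * f = c * p + h * (c * r)" by (simp add: f(1) algebra_simps)
      moreover have "c * p \<in> P" "c * r \<in> supported S"
        using f that ideal_mult[OF P] by auto
      ultimately show ?thesis using J_I by simp
    qed
  qed
  moreover have "P \<subseteq> J" using J_I[OF _ supported_0] by auto
  moreover have "h \<in> J" using J_I[OF ideal_0[OF P] supported_S_1] by simp
  ultimately have J: "ideal J R" "P \<subseteq> J" "h \<in> J" by blast+
  from J(1) have "J \<subseteq> carrier R" unfolding carrier_R ideal_iff by (rule conjunct1)
  with maximalideal.I_maximal[OF assms J(1,2)] J(3) h(2) have "J = carrier R" by metis
  then have "1 \<in> J" by simp
  then obtain p r where "1 = p + h * r" "p \<in> P" "r \<in> supported S" using J_E by blast
  then show "\<exists>b\<in>supported S. 1 - h * b \<in> P"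
    by (metis add_diff_cancel_right')
qed

text \<open>
  Nakayama's lemma for the field \<open>R / P\<close>, finitely generated over the localization of the image of
  \<open>K[T]\<close> at the elements \<open>l ^ N + h * c\<close>: since \<open>h\<close> is invertible in the field, each
  generator \<open>v\<close> satisfies \<open>v \<in> h * (R / P)\<close> and is redundant.
\<close>

lemma nakayama:
  assumes P: "maximalideal P R"
    and T: "T \<subseteq> S" "0 \<in> T" "\<And>s t. s \<in> T \<Longrightarrow> t \<in> T \<Longrightarrow> s + t \<in> T"
    and h: "h \<in> supported T" "h \<notin> P" and l: "l \<in> supported T"
    and nonzero: "\<And>N c. c \<in> supported T \<Longrightarrow> l ^ N + h * c \<notin> P"
    and I: "finite I" "\<And>i. i \<in> I \<Longrightarrow> g i \<in> supported S"
    and span: "\<And>r. r \<in> supported S \<Longrightarrow> \<exists>N. \<exists>c\<in>supported T. \<exists>\<phi>. (\<forall>i\<in>I. \<phi> i \<in> supported T) \<and>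
      (l ^ N + h * c) * r - (\<Sum>i\<in>I. \<phi> i * g i) \<in> P"
  shows False
proof -
  note idl = maximal_ideal(1)[OF P]
  have TS: "supported T \<subseteq> supported S" using T(1) by (rule supported_mono)
  have T_mult: "a * b \<in> supported T" if "a \<in> supported T" "b \<in> supported T" for a b :: "_ \<Rightarrow>\<^sub>0 'k"
    using that T(3) by (rule supported_mult)
  have T_pow: "a ^ n \<in> supported T" if "a \<in> supported T" for a :: "_ \<Rightarrow>\<^sub>0 'k" and n
    by (rule supported_power[OF T(2,3) that])
  have hS: "h \<in> supported S" using h TS by blast
  obtain b where b: "b \<in> supported S" "1 - h * b \<in> P"
    using maximal_inverse[OF P hS h(2)] by blast
  show False
    using I span
  proof (induction I)
    case empty
    then show ?case using empty(2)[of 1] nonzero by auto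
  next
    case (insert j I)
    have gS: "g j \<in> supported S" using insert.prems by auto
    \<comment> \<open>\<open>b\<close> inverts \<open>h\<close> modulo \<open>P\<close>, so the
      relation for \<open>g j * b\<close>, multiplied by \<open>h\<close>, is a relation for
      \<open>g j\<close> in which \<open>g j\<close> occurs on the right with a factor
      \<open>h\<close>. That occurrence is absorbed into \<open>c'\<close>, and \<open>q'\<close>
      again has the form \<open>l ^ N + h * c\<close>.\<close>
    obtain N0 c0 \<phi> where 0: "c0 \<in> supported T" "\<forall>i\<in>insert j I. \<phi> i \<in> supported T"
      "(l ^ N0 + h * c0) * (g j * b) - (\<Sum>i\<in>insert j I. \<phi> i * g i) \<in> P"
      using insert.prems(2)[of "g j * b"] gS b(1) by auto
    define c' where "c' = c0 - \<phi> j"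
    define q' where "q' = l ^ N0 + h * c'"
    have c'T: "c' \<in> supported T" using 0 by (auto simp: c'_def)
    then have q'T: "q' \<in> supported T" using T_mult T_pow h(1) l by (auto simp: q'_def)
    let ?e0 = "(l ^ N0 + h * c0) * (g j * b) - (\<Sum>i\<in>insert j I. \<phi> i * g i)"
    have lhS: "(l ^ N0 + h * c0) * g j \<in> supported S"
      using 0(1) h(1) l TS gS by (intro supported_S_mult supported_add supported_S_power) auto
    have "h * ?e0 + ((l ^ N0 + h * c0) * g j) * (1 - h * b) \<in> P"
      using 0(3) b(2) hS lhS by (intro ideal_add[OF idl] ideal_mult[OF idl]) auto
    moreover have "h * ?e0 + ((l ^ N0 + h * c0) * g j) * (1 - h * b) =
        q' * g j - (\<Sum>i\<in>I. h * \<phi> i * g i)"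
      using insert.hyps by (simp add: q'_def c'_def algebra_simps sum_distrib_left)
    ultimately have e: "q' * g j - (\<Sum>i\<in>I. h * \<phi> i * g i) \<in> P" by simp
    show ?case
    proof (rule insert.IH)
      fix r :: "nat \<times> nat \<Rightarrow>\<^sub>0 'k" assume r: "r \<in> supported S"
      obtain N1 c1 \<psi> where 1: "c1 \<in> supported T" "\<forall>i\<in>insert j I. \<psi> i \<in> supported T"
        "(l ^ N1 + h * c1) * r - (\<Sum>i\<in>insert j I. \<psi> i * g i) \<in> P"
        using insert.prems(2)[OF r] by auto
      \<comment> \<open>Read off from the product
        \<open>(l ^ N0 + h * c') * (l ^ N1 + h * c1)\<close>.\<close>
      define c where "c = l ^ N0 * c1 + c' * l ^ N1 + h * c' * c1"
      define \<theta> where "\<theta> i = q' * \<psi> i + \<psi> j * (h * \<phi> i)" for i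
      have "q' * ((l ^ N1 + h * c1) * r - (\<Sum>i\<in>insert j I. \<psi> i * g i)) +
          \<psi> j * (q' * g j - (\<Sum>i\<in>I. h * \<phi> i * g i)) \<in> P"
        using e 1 q'T TS by (intro ideal_add[OF idl] ideal_mult[OF idl]) auto
      also have "q' * ((l ^ N1 + h * c1) * r - (\<Sum>i\<in>insert j I. \<psi> i * g i)) +
          \<psi> j * (q' * g j - (\<Sum>i\<in>I. h * \<phi> i * g i)) =
        q' * (l ^ N1 + h * c1) * r - (q' * (\<Sum>i\<in>I. \<psi> i * g i) + \<psi> j * (\<Sum>i\<in>I. h * \<phi> i * g i))"
        using insert.hyps by (simp add: algebra_simps)
      also have "q' * (\<Sum>i\<in>I. \<psi> i * g i) + \<psi> j * (\<Sum>i\<in>I. h * \<phi> i * g i) = (\<Sum>i\<in>I. \<theta> i * g i)"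
        by (simp add: \<theta>_def distrib_right sum.distrib sum_distrib_left mult.assoc)
      also have "q' * (l ^ N1 + h * c1) = l ^ (N0 + N1) + h * c"
        by (simp add: q'_def c_def algebra_simps power_add)
      finally have "(l ^ (N0 + N1) + h * c) * r - (\<Sum>i\<in>I. \<theta> i * g i) \<in> P" .
      moreover have "c \<in> supported T"
        unfolding c_def using 1 c'T h(1) l by (intro supported_add T_mult T_pow) auto
      moreover have "\<forall>i\<in>I. \<theta> i \<in> supported T"
        unfolding \<theta>_def using 0 1 q'T h(1) by (intro ballI supported_add T_mult) auto
      ultimately show "\<exists>N. \<exists>c\<in>supported T. \<exists>\<phi>. (\<forall>i\<in>I. \<phi> i \<in> supported T) \<and>
        (l ^ N + h * c) * r - (\<Sum>i\<in>I. \<phi> i * g i) \<in> P" by blast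
    qed (use insert.prems in auto)
  qed
qed

text \<open>In \<open>R / P\<close> with \<open>l\<close> inverted, the class of \<open>r\<close>
  lies in the module generated by the \<open>g i\<close> over the polynomials supported in
  \<open>T\<close>. Denominators are cleared, which leaves a power of \<open>l\<close>.\<close>

definition spanned ::
  "'k plane_poly set \<Rightarrow> (nat \<times> nat) set \<Rightarrow> 'k plane_poly \<Rightarrow> 'i set \<Rightarrow>
    ('i \<Rightarrow> 'k plane_poly) \<Rightarrow> 'k plane_poly \<Rightarrow> bool" where
  "spanned P T l I g r \<longleftrightarrow> (\<exists>N \<phi>. (\<forall>i\<in>I. \<phi> i \<in> supported T) \<and> l ^ N * r - (\<Sum>i\<in>I. \<phi> i * g i) \<in> P)"

context
  fixes P :: "'k plane_poly set" and T
    and l :: "'k plane_poly" and I :: "'i set"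
    and g :: "'i \<Rightarrow> 'k plane_poly"
  assumes P: "ideal P R" and T: "T \<subseteq> S" "0 \<in> T" "\<And>s t. s \<in> T \<Longrightarrow> t \<in> T \<Longrightarrow> s + t \<in> T"
    and l: "l \<in> supported T" and I: "finite I"
begin

private lemma T_mult: "a \<in> supported T \<Longrightarrow> b \<in> supported T \<Longrightarrow> a * b \<in> supported T"
  for a b :: "'k plane_poly"
  by (rule supported_mult) (auto intro: T)

private lemma T_pow: "a \<in> supported T \<Longrightarrow> a ^ n \<in> supported T"
  for a :: "'k plane_poly"
  by (rule supported_power[OF T(2,3)])

private lemma T_S: "a \<in> supported T \<Longrightarrow> a \<in> supported S"
  for a :: "'k plane_poly"
  using supported_mono[OF T(1)] by blast

lemma spanned_0: "spanned P T l I g 0"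
  unfolding spanned_def using ideal_0[OF P] by (intro exI[of _ 0] exI[of _ "\<lambda>_. 0"]) auto

lemma spanned_add:
  assumes "spanned P T l I g r" "spanned P T l I g r'"
  shows "spanned P T l I g (r + r')"
proof -
  obtain N \<phi> N' \<phi>' where *: "\<forall>i\<in>I. \<phi> i \<in> supported T" "l ^ N * r - (\<Sum>i\<in>I. \<phi> i * g i) \<in> P"
    "\<forall>i\<in>I. \<phi>' i \<in> supported T" "l ^ N' * r' - (\<Sum>i\<in>I. \<phi>' i * g i) \<in> P"
    using assms unfolding spanned_def by blast
  have "l ^ N' * (l ^ N * r - (\<Sum>i\<in>I. \<phi> i * g i)) + l ^ N * (l ^ N' * r' - (\<Sum>i\<in>I. \<phi>' i * g i)) \<in> P"
    using * l by (intro ideal_add[OF P] ideal_mult[OF P] T_S T_pow)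
  also have "l ^ N' * (l ^ N * r - (\<Sum>i\<in>I. \<phi> i * g i)) + l ^ N * (l ^ N' * r' - (\<Sum>i\<in>I. \<phi>' i * g i)) =
      l ^ (N + N') * (r + r') - (\<Sum>i\<in>I. (l ^ N' * \<phi> i + l ^ N * \<phi>' i) * g i)"
    by (simp add: algebra_simps power_add sum.distrib sum_distrib_left)
  finally show ?thesis
    unfolding spanned_def using * l
    by (intro exI[of _ "N + N'"] exI[of _ "\<lambda>i. l ^ N' * \<phi> i + l ^ N * \<phi>' i"])
      (auto intro!: supported_add T_mult T_pow)
qed

lemma spanned_mult:
  assumes "spanned P T l I g r" "a \<in> supported T"
  shows "spanned P T l I g (a * r)"
proof -
  obtain N \<phi> where *: "\<forall>i\<in>I. \<phi> i \<in> supported T" "l ^ N * r - (\<Sum>i\<in>I. \<phi> i * g i) \<in> P"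
    using assms unfolding spanned_def by blast
  have "a * (l ^ N * r - (\<Sum>i\<in>I. \<phi> i * g i)) \<in> P"
    using * assms(2) by (intro ideal_mult[OF P] T_S)
  also have "a * (l ^ N * r - (\<Sum>i\<in>I. \<phi> i * g i)) = l ^ N * (a * r) - (\<Sum>i\<in>I. (a * \<phi> i) * g i)"
    by (simp add: algebra_simps sum_distrib_left)
  finally show ?thesis
    unfolding spanned_def using * assms(2)
    by (intro exI[of _ "N"] exI[of _ "\<lambda>i. a * \<phi> i"]) (auto intro!: T_mult)
qed

lemma spanned_sum:
  "(\<And>j. j \<in> A \<Longrightarrow> spanned P T l I g (r j)) \<Longrightarrow> spanned P T l I g (sum r A)"
  by (induction A rule: infinite_finite_induct) (auto intro: spanned_0 spanned_add)

lemma spanned_generator: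
  assumes "j \<in> I"
  shows "spanned P T l I g (g j)"
proof -
  have "(\<Sum>i\<in>I. (if i = j then 1 else 0) * g i) = g j"
    using assms I by (simp add: if_distrib[of "\<lambda>x. x * _"] cong: if_cong)
  then show ?thesis
    unfolding spanned_def using ideal_0[OF P] T(2)
    by (intro exI[of _ 0] exI[of _ "\<lambda>i. if i = j then 1 else 0"]) (auto simp: supported_def)
qed

text \<open>Since \<open>l\<close> counts as invertible, it is enough to span \<open>l * r'\<close>
  up to \<open>P\<close>. This is how powers are lowered by a relation with leading coefficient
  \<open>l\<close>.\<close>

lemma spanned_cong:
  assumes "spanned P T l I g r" "l * r' - r \<in> P"
  shows "spanned P T l I g r'"
proof -
  obtain N \<phi> where *: "\<forall>i\<in>I. \<phi> i \<in> supported T" "l ^ N * r - (\<Sum>i\<in>I. \<phi> i * g i) \<in> P"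
    using assms unfolding spanned_def by blast
  have "l ^ N * (l * r' - r) + (l ^ N * r - (\<Sum>i\<in>I. \<phi> i * g i)) \<in> P"
    using * assms(2) l by (intro ideal_add[OF P] ideal_mult[OF P] T_S T_pow)
  also have "l ^ N * (l * r' - r) + (l ^ N * r - (\<Sum>i\<in>I. \<phi> i * g i)) =
      l ^ Suc N * r' - (\<Sum>i\<in>I. \<phi> i * g i)"
    by (simp add: algebra_simps)
  finally show ?thesis
    unfolding spanned_def using * by blast
qed

text \<open>The special case \<open>c = 0\<close> of the denominators in \<open>nakayama\<close>; as
  spanned elements are closed under addition, it suffices to span the terms of
  \<open>R\<close>.\<close>

lemma spanned_nakayama:
  assumes "maximalideal P R" "h \<in> supported T" "h \<notin> P"
    and "\<And>N c. c \<in> supported T \<Longrightarrow> l ^ N + h * c \<notin> P"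
    and "\<And>i. i \<in> I \<Longrightarrow> g i \<in> supported S"
    and "\<And>s c. s \<in> S \<Longrightarrow> spanned P T l I g (single s c)"
  shows False
proof (rule nakayama[OF assms(1) T assms(2,3) l assms(4) I assms(5)])
  fix r :: "'k plane_poly" assume "r \<in> supported S"
  then have "spanned P T l I g r"
    by (induction r rule: supported_induct) (auto intro: spanned_0 spanned_add assms(6))
  then obtain N \<phi> where "\<forall>i\<in>I. \<phi> i \<in> supported T" "l ^ N * r - (\<Sum>i\<in>I. \<phi> i * g i) \<in> P"
    unfolding spanned_def by blast
  then show "\<exists>N. \<exists>c\<in>supported T. \<exists>\<phi>. (\<forall>i\<in>I. \<phi> i \<in> supported T) \<and>
      (l ^ N + h * c) * r - (\<Sum>i\<in>I. \<phi> i * g i) \<in> P"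
    by (intro exI[of _ N] bexI[of _ 0] exI[of _ \<phi>]) auto
qed auto

end

text \<open>Otherwise the polynomials in the axis monomials \<open>X\<close> and \<open>Y\<close>
  would embed in the field \<open>R / P\<close>, which is finite over them. Nakayama with
  \<open>h = X\<close> and \<open>l = 1\<close> excludes this: the elements \<open>1 + X * c\<close>
  have constant term \<open>1\<close> and so stay nonzero modulo \<open>P\<close>.\<close>

lemma maximal_meets_plane:
  assumes P: "maximalideal P R"
  shows "\<exists>F\<in>supported {(i * d, j * d) | i j. True} \<inter> P. F \<noteq> 0"
proof (rule ccontr)
  let ?T = "{(i * d, j * d) | i j. True}"
  assume "\<not> ?thesis"
  then have no: "F = 0" if "F \<in> supported ?T" "F \<in> P" for F using that by blast
  have T: "?T \<subseteq> S" "0 \<in> ?T" "\<And>s t. s \<in> ?T \<Longrightarrow> t \<in> ?T \<Longrightarrow> s + t \<in> ?T"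
    using base_S by (auto simp: zero_prod_def simp flip: add_mult_distrib)
  obtain W where W: "W \<subseteq> S" "finite W" "\<forall>s\<in>S. \<exists>w\<in>W. \<exists>i j. s = w + (i * d, j * d)"
    using dickson_plane_mod[OF d_pos, of S] by blast
  have 1: "1 \<in> supported ?T" using T(2) by (auto simp: supported_def)
  have x: "monomial (d, 0) \<in> supported ?T"
    by (rule supported_single) (auto intro!: exI[of _ 1] exI[of _ 0])
  note idl = maximal_ideal(1)[OF P]
  show False
  proof (rule spanned_nakayama[OF idl T 1 W(2) P x])
    show "monomial (d, 0) \<notin> P" using no[OF x] by (metis lookup_single_eq lookup_zero zero_neq_one)
    show "monomial w \<in> supported S" if "w \<in> W" for w using that W(1) by auto
    show "1 ^ N + monomial (d, 0) * c \<notin> P" if c: "c \<in> supported ?T" for N c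
    proof
      assume *: "1 ^ N + monomial (d, 0) * c \<in> P"
      have "1 ^ N + monomial (d, 0) * c \<in> supported ?T"
        using 1 supported_mult[OF x c T(3)] by auto
      then have "1 + monomial (d, 0) * c = 0" using * no by simp
      then have "lookup (1 + monomial (d, 0) * c) 0 = 0" by simp
      moreover have "0 \<notin> keys (monomial (d, 0) * c)"
        using keys_mult[of "monomial (d, 0)" c] d_pos by (auto simp: zero_prod_def)
      ultimately show False by (simp add: lookup_add in_keys_iff)
    qed
    fix s :: "nat \<times> nat" and c :: 'k assume "s \<in> S"
    then obtain w i j where s: "w \<in> W" "s = w + (i * d, j * d)" using W(3) by blast
    have "single (i * d, j * d) c * monomial w = single s c"
      by (simp add: mult_single s(2) add.commute)
    moreover have "spanned P ?T 1 W monomial (single (i * d, j * d) c * monomial w)"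
      by (intro spanned_mult[OF idl T 1 W(2)] spanned_generator[OF idl T 1 W(2)] s(1) supported_single) auto
    ultimately show "spanned P ?T 1 W monomial (single s c)" by simp
  qed
qed

lemma monomial_power: "monomial u ^ n = (monomial (n * fst u, n * snd u) :: 'k plane_poly)"
proof (induction n)
  case 0
  then show ?case by (simp flip: zero_prod_def)
next
  case (Suc n)
  then show ?case by (cases u) (simp add: monomial_mult)
qed

text \<open>Let \<open>X\<close>, \<open>Y\<close> be the monomials of \<open>u\<close>,
  \<open>v\<close>, and suppose that \<open>K[X]\<close> embeds in \<open>R / P\<close>. A relation
  \<open>F\<close> from \<open>maximal_meets_plane\<close>, read as a polynomial in \<open>Y\<close>
  with leading coefficient \<open>l\<close> in \<open>K[X]\<close>, makes \<open>R / P\<close>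
  finite over \<open>K[X]\<close> with \<open>l\<close> inverted. In that ring
  \<open>h = 1 + X * l\<close> is not a unit, being nonconstant and coprime to \<open>l\<close>, and
  Nakayama gives a contradiction.\<close>

lemma maximal_meets_axis:
  assumes P: "maximalideal P R" and uv: "(u, v) = ((d, 0), (0, d)) \<or> (u, v) = ((0, d), (d, 0))"
  shows "\<exists>f\<in>supported (range (\<lambda>n. (n * fst u, n * snd u))) \<inter> P. f \<noteq> 0"
proof (rule ccontr)
  let ?u = "\<lambda>n. (n * fst u, n * snd u)" and ?v = "\<lambda>n. (n * fst v, n * snd v)"
  let ?T = "range ?u"
  let ?X = "monomial u :: _ \<Rightarrow>\<^sub>0 'k" and ?Y = "monomial v :: _ \<Rightarrow>\<^sub>0 'k"
  assume "\<not> ?thesis"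
  then have no: "F = 0" if "F \<in> supported ?T" "F \<in> P" for F using that by blast
  have u_add: "?u m + ?u n = ?u (m + n)" for m n by (simp add: add_mult_distrib)
  have T: "?T \<subseteq> S" "0 \<in> ?T" "\<And>s t. s \<in> ?T \<Longrightarrow> t \<in> ?T \<Longrightarrow> s + t \<in> ?T"
  proof -
    show "?T \<subseteq> S" using uv x_multiple_S y_multiple_S by auto
    show "0 \<in> ?T" by (rule image_eqI[of _ _ 0]) (auto simp: zero_prod_def)
    show "s + t \<in> ?T" if "s \<in> ?T" "t \<in> ?T" for s t using that u_add by auto
  qed
  note idl = maximal_ideal(1)[OF P]
  have T_mult: "a * b \<in> supported ?T" if "a \<in> supported ?T" "b \<in> supported ?T" for a b :: "_ \<Rightarrow>\<^sub>0 'k"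
    using that T(3) by (rule supported_mult)
  have T_pow: "a ^ n \<in> supported ?T" if "a \<in> supported ?T" for a :: "_ \<Rightarrow>\<^sub>0 'k" and n
    by (rule supported_power[OF T(2,3) that])
  have T_1: "1 \<in> supported ?T" by (rule supported_1[OF T(2)])
  have T_S: "a \<in> supported S" if "a \<in> supported ?T" for a :: "_ \<Rightarrow>\<^sub>0 'k"
    using that supported_mono[OF T(1)] by blast
  have X_T: "?X \<in> supported ?T"
    by (rule supported_single) (auto intro!: image_eqI[of _ _ 1])
  have u_T: "single (?u i) c \<in> supported ?T" for i and c :: 'k
    by (rule supported_single) (rule rangeI)
  have Y_S: "?Y \<in> supported S"
    using uv x_S y_S by auto
  obtain F where F: "F \<in> supported {(i * d, j * d) | i j. True}" "F \<in> P" "F \<noteq> 0"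
    using maximal_meets_plane[OF P] by blast
  \<comment> \<open>Expansions of length \<open>m\<close> in powers of \<open>Y\<close> over
    \<open>K[X]\<close>; taking \<open>m\<close> least later makes the top coefficient
    nonzero.\<close>
  define expansion where "expansion f m \<phi> \<longleftrightarrow> (\<forall>n. \<phi> n \<in> supported ?T) \<and> f = (\<Sum>n<m. \<phi> n * ?Y ^ n)"
    for f :: "_ \<Rightarrow>\<^sub>0 'k" and m \<phi>
  have "\<exists>m \<phi>. expansion F m \<phi>"
    using F(1)
  proof (induction F rule: supported_induct)
    case zero
    show ?case by (intro exI[of _ 0]) (auto simp: expansion_def intro: exI[of _ "\<lambda>_. 0"])
  next
    case (single s c)
    then obtain i j where "s = ?u i + ?v j" using uv by (fastforce simp: mult.commute)
    then have "single s c = single (?u i) c * ?Y ^ j"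
      by (simp add: monomial_power mult_single)
    also have "\<dots> = (\<Sum>n<Suc j. (if n = j then single (?u i) c else 0) * ?Y ^ n)"
      by (simp add: sum.neutral)
    finally show ?case
      by (intro exI[of _ "Suc j"] exI[of _ "\<lambda>n. if n = j then single (?u i) c else 0"])
        (auto simp: expansion_def intro: u_T)
  next
    case (add f g)
    then obtain m \<phi> m' \<phi>' where e: "expansion f m \<phi>" "expansion g m' \<phi>'" by blast
    have cut: "(\<Sum>n<m. \<phi> n * ?Y ^ n) = (\<Sum>n<M. (if n < m then \<phi> n else 0) * ?Y ^ n)" if "m \<le> M" for m M \<phi>
      using that by (intro sum.mono_neutral_cong_left) auto
    show ?case
      using e cut[of m "max m m'" \<phi>] cut[of m' "max m m'" \<phi>']
      by (intro exI[of _ "max m m'"]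
          exI[of _ "\<lambda>n. (if n < m then \<phi> n else 0) + (if n < m' then \<phi>' n else 0)"])
        (auto simp: expansion_def distrib_right sum.distrib)
  qed
  then have ex: "\<exists>m. \<exists>\<phi>. expansion F m \<phi>" .
  obtain m \<phi> where m: "expansion F m \<phi>" "\<And>k \<psi>. k < m \<Longrightarrow> \<not> expansion F k \<psi>"
    using exists_least_iff[of "\<lambda>m. \<exists>\<phi>. expansion F m \<phi>"] ex by blast
  have "m \<noteq> 0" using m(1) F(3) unfolding expansion_def by (metis lessThan_0 sum.empty)
  then obtain m' where m': "m = Suc m'" using not0_implies_Suc by blast
  define l where "l = \<phi> m'"
  have \<phi>_T: "\<phi> n \<in> supported ?T" for n using m(1) by (simp add: expansion_def)
  have F_eq: "F = (\<Sum>n<m'. \<phi> n * ?Y ^ n) + l * ?Y ^ m'"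
    using m(1) by (simp add: expansion_def m' l_def)
  have l0: "l \<noteq> 0"
    using m(2)[of m' \<phi>] F_eq \<phi>_T m' by (auto simp: expansion_def)
  have l_T: "l \<in> supported ?T" using \<phi>_T by (simp add: l_def)
  \<comment> \<open>Coprime to \<open>l\<close> by construction, whatever the field, and of larger
    degree than \<open>l\<close>, hence not a unit.\<close>
  define h where "h = 1 + ?X * l"
  have h_T: "h \<in> supported ?T" unfolding h_def using T_1 T_mult[OF X_T l_T] by auto
  have h_key: "lookup h (u + lead_exp l) \<noteq> 0"
  proof -
    have "u + lead_exp l \<noteq> 0" using uv d_pos by (cases "lead_exp l") (auto simp: zero_prod_def)
    then have "lookup h (u + lead_exp l) = lookup l (lead_exp l)"
      by (simp add: h_def lookup_add lookup_single_mult lookup_one when_def)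
    then show ?thesis using lead_exp_in_keys[OF l0] by (simp add: in_keys_iff)
  qed
  then have h0: "h \<noteq> 0" by auto
  have h_unit: "h * z \<noteq> 1" for z
  proof
    assume hz: "h * z = 1"
    then have "z \<noteq> 0" by auto
    from lead_exp_mult[OF h0 this] have "lead_exp h + lead_exp z = 0"
      using hz by (simp add: lead_exp_def)
    then have "lead_exp h = 0" by (cases "lead_exp h"; cases "lead_exp z") (auto simp: zero_prod_def)
    then have "u + lead_exp l \<le> 0" using le_lead_exp[of "u + lead_exp l" h] h_key by (simp add: in_keys_iff)
    then show False using uv d_pos by (cases "lead_exp l") (auto simp: zero_prod_def less_eq_prod_def)
  qed
  obtain W where W: "W \<subseteq> S" "finite W" "\<forall>s\<in>S. \<exists>w\<in>W. \<exists>i j. s = w + (i * d, j * d)"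
    using dickson_plane_mod[OF d_pos, of S] by blast
  let ?I = "{..<m'} \<times> W"
  let ?g = "\<lambda>(n, w). ?Y ^ n * monomial w"
  have fin: "finite ?I" using W(2) by simp
  note sp = idl T l_T fin
  have YW: "spanned P ?T l ?I ?g (?Y ^ n * monomial w)" if w: "w \<in> W" for n w
  proof (induction n rule: less_induct)
    case (less n)
    show ?case
    proof (cases "n < m'")
      case True
      then show ?thesis using spanned_generator[OF sp, of "(n, w)" ?g] w by simp
    next
      case False
      \<comment> \<open>Modulo \<open>P\<close>, the relation \<open>F\<close> rewrites
        \<open>l * Y ^ m'\<close> in lower powers of \<open>Y\<close>, so multiplication by
        \<open>l\<close> lowers the power \<open>n\<close>.\<close>
      let ?r = "?Y ^ (n - m') * monomial w"
      let ?t = "\<Sum>i<m'. (- \<phi> i) * (?Y ^ (i + (n - m')) * monomial w)"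
      have t: "spanned P ?T l ?I ?g ?t"
      proof (intro spanned_sum[OF sp])
        fix i assume "i \<in> {..<m'}"
        then have "i + (n - m') < n" using False by auto
        then show "spanned P ?T l ?I ?g ((- \<phi> i) * (?Y ^ (i + (n - m')) * monomial w))"
          by (intro spanned_mult[OF sp] less.IH supported_uminus[OF \<phi>_T])
      qed
      have "?Y ^ n = ?Y ^ m' * ?Y ^ (n - m')" using False by (simp flip: power_add)
      then have "l * (?Y ^ n * monomial w) = (F - (\<Sum>n<m'. \<phi> n * ?Y ^ n)) * ?r"
        by (simp add: F_eq algebra_simps)
      also have "\<dots> = F * ?r + ?t"
        by (simp add: left_diff_distrib sum_distrib_right power_add sum_negf mult.assoc)
      finally have "l * (?Y ^ n * monomial w) - ?t = F * ?r" by simp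
      moreover have "F * ?r \<in> P"
        using F(2) Y_S w W(1) by (intro ideal_mult'[OF idl] supported_S_mult supported_S_power) auto
      ultimately show ?thesis using spanned_cong[OF sp t] by simp
    qed
  qed
  show False
  proof (rule spanned_nakayama[OF sp P h_T])
    show "h \<notin> P" using no[OF h_T] h0 by blast
    show "?g i \<in> supported S" if "i \<in> ?I" for i
      using that Y_S W(1) by (auto intro!: supported_S_mult supported_S_power)
    show "l ^ N + h * c \<notin> P" if c: "c \<in> supported ?T" for N c
    proof
      assume *: "l ^ N + h * c \<in> P"
      have "l ^ N + h * c \<in> supported ?T"
        using T_pow[OF l_T] T_mult[OF h_T c] by blast
      then have "l ^ N = h * (- c)" using * no by (simp add: eq_neg_iff_add_eq_0)
      \<comment> \<open>Since \<open>X * l = h - 1\<close>, the element \<open>X ^ N * l ^ N\<close>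
        is congruent to \<open>(- 1) ^ N\<close> modulo \<open>h\<close>, so a divisor
        \<open>h\<close> of \<open>l ^ N\<close> would divide \<open>1\<close>.\<close>
      then have "h dvd l ^ N" by (rule dvdI)
      then have "h dvd ?X ^ N * l ^ N" by simp
      moreover have "h dvd (h - 1) ^ N - (- 1) ^ N"
        using power_diff_sumr2[of "h - 1" N "- 1"] by simp
      moreover have "?X ^ N * l ^ N = (h - 1) ^ N" by (simp add: h_def power_mult_distrib)
      ultimately have "h dvd (- 1) ^ N" by (metis dvd_diff_right_iff dvd_diffD)
      then have "h dvd (- 1) ^ N * (- 1) ^ N" by (rule dvd_mult2)
      then show False using h_unit by (auto simp: dvd_def simp flip: power_mult_distrib)
    qed
    fix s :: "nat \<times> nat" and c :: 'k assume "s \<in> S"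
    then obtain w i j where s: "w \<in> W" "s = w + (i * d, j * d)" using W(3) by blast
    then obtain i j where s': "s = ?u i + (?v j + w)"
      using uv by (fastforce simp: mult.commute prod_eq_iff)
    have "single (?u i) c * (?Y ^ j * monomial w) = single s c"
      unfolding s' by (simp add: monomial_power mult_single)
    moreover have "spanned P ?T l ?I ?g (single (?u i) c * (?Y ^ j * monomial w))"
      by (rule spanned_mult[OF sp YW[OF s(1)] u_T])
    ultimately show "spanned P ?T l ?I ?g (single s c)" by simp
  qed
qed

end

section \<open>The Cohen--Macaulay property\<close>

context plane_monoid
begin

text \<open>The exponents of the sections of \<open>R\<close> over the punctured spectrum. Pairs of
  naturals suffice: a vector with negative second coordinate cannot enter the monoid by adding
  \<open>(n * d, 0)\<close>, and symmetrically.\<close>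

definition saturation :: "(nat \<times> nat) set" where
  "saturation = {w. (\<exists>n. w + (n * d, 0) \<in> S) \<and> (\<exists>n. w + (0, n * d) \<in> S)}"

lemma S_subset_saturation: "S \<subseteq> saturation"
  unfolding saturation_def by (auto intro!: exI[of _ 0])

lemma saturation_add:
  assumes "w \<in> saturation" "s \<in> S"
  shows "s + w \<in> saturation"
proof -
  obtain m n where "w + (m * d, 0) \<in> S" "w + (0, n * d) \<in> S"
    using assms(1) by (auto simp: saturation_def)
  then have "(s + w) + (m * d, 0) \<in> S" "(s + w) + (0, n * d) \<in> S"
    using add_S[OF assms(2)] by (metis add.assoc)+
  then show ?thesis unfolding saturation_def by blast
qed

text \<open>Enlarging just one of the coordinates by enough already reaches \<open>S\<close>. So the
  vectors \<open>w + (i * d, j * d)\<close> outside \<open>S\<close> have both indices below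
  \<open>N\<close>, which is the source of \<open>finite_gaps\<close>.\<close>

lemma saturation_eventually:
  assumes "w \<in> saturation"
  shows "\<exists>N. \<forall>i j. N \<le> i \<or> N \<le> j \<longrightarrow> w + (i * d, j * d) \<in> S"
proof -
  obtain m n where *: "w + (m * d, 0) \<in> S" "w + (0, n * d) \<in> S"
    using assms by (auto simp: saturation_def)
  have "w + (i * d, j * d) \<in> S" if "max m n \<le> i \<or> max m n \<le> j" for i j
  proof -
    from that consider "m \<le> i" | "n \<le> j" by linarith
    then show ?thesis
    proof cases
      case 1
      then have "w + (i * d, j * d) = (w + (m * d, 0)) + ((i - m) * d, j * d)"
        by (cases w) (simp add: left_diff_distrib')
      then show ?thesis using add_S[OF *(1) base_S] by simp
    next
      case 2
      then have "w + (i * d, j * d) = (w + (0, n * d)) + (i * d, (j - n) * d)"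
        by (cases w) (simp add: left_diff_distrib')
      then show ?thesis using add_S[OF *(2) base_S] by simp
    qed
  qed
  then show ?thesis by blast
qed

text \<open>\<open>N * d\<close> copies of \<open>s\<close> amount to \<open>N * fst s\<close>
  copies of \<open>(d, 0)\<close> plus \<open>N * snd s\<close> copies of \<open>(0, d)\<close>, and
  one of these numbers reaches the bound of \<open>saturation_eventually\<close>. Hence any nonzero
  \<open>s\<close>, not only an axis element, can serve as denominator.\<close>

lemma saturation_absorbed:
  assumes "w \<in> saturation" "s \<in> S" "s \<noteq> 0"
  shows "\<exists>n. (n * fst s, n * snd s) + w \<in> S"
proof -
  obtain N where N: "\<And>i j. N \<le> i \<or> N \<le> j \<Longrightarrow> w + (i * d, j * d) \<in> S"
    using saturation_eventually[OF assms(1)] by blast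
  have "fst s \<noteq> 0 \<or> snd s \<noteq> 0" using assms(3) by (cases s) (auto simp: zero_prod_def)
  then have "N \<le> N * fst s \<or> N \<le> N * snd s" by auto
  from N[OF this] show ?thesis
    by (intro exI[of _ "N * d"]) (simp add: ac_simps)
qed

lemma finite_gaps: "finite (saturation - S)"
proof -
  obtain F where F: "F \<subseteq> saturation" "finite F" "\<forall>b\<in>saturation. \<exists>f\<in>F. \<exists>i j. b = f + (i * d, j * d)"
    using dickson_plane_mod[OF d_pos, of saturation] by blast
  have "\<exists>N. \<forall>i j. N \<le> i \<or> N \<le> j \<longrightarrow> f + (i * d, j * d) \<in> S" if "f \<in> F" for f
    using that F(1) by (intro saturation_eventually) auto
  then obtain N where N: "\<And>f i j. f \<in> F \<Longrightarrow> N f \<le> i \<or> N f \<le> j \<Longrightarrow> f + (i * d, j * d) \<in> S"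
    by metis
  have "saturation - S \<subseteq> (\<Union>f\<in>F. (\<lambda>(i, j). f + (i * d, j * d)) ` ({..<N f} \<times> {..<N f}))"
  proof
    fix w assume w: "w \<in> saturation - S"
    then obtain f i j where f: "f \<in> F" "w = f + (i * d, j * d)" using F(3) by blast
    then have "i < N f" "j < N f" using N[OF f(1), of i j] w by (auto simp: not_le[symmetric])
    then show "w \<in> (\<Union>f\<in>F. (\<lambda>(i, j). f + (i * d, j * d)) ` ({..<N f} \<times> {..<N f}))"
      using f by (intro UN_I[OF f(1)] image_eqI[of _ _ "(i, j)"]) auto
  qed
  then show ?thesis by (rule finite_subset) (use F(2) in auto)
qed

lemma add_eq_0_plane: "s + t = 0 \<Longrightarrow> s = (0 :: nat \<times> nat)"
  by (cases s; cases t) (auto simp: zero_prod_def)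

text \<open>Adding a nonzero element of \<open>S\<close> strictly raises a vector lexicographically
  and keeps it in the saturation, so the largest gap can only move into \<open>S\<close>.\<close>

lemma socle_exists:
  assumes "\<not> saturation \<subseteq> S"
  shows "\<exists>w\<in>saturation - S. \<forall>s\<in>S - {0}. s + w \<in> S"
proof -
  have ne: "saturation - S \<noteq> {}" using assms by blast
  define w where "w = Max (saturation - S)"
  have w: "w \<in> saturation - S" unfolding w_def using Max_in[OF finite_gaps ne] .
  have "s + w \<in> S" if "s \<in> S - {0}" for s
  proof (rule ccontr)
    assume "s + w \<notin> S"
    then have "s + w \<in> saturation - S" using that w saturation_add by auto
    then have "s + w \<le> w" unfolding w_def using finite_gaps by (intro Max_ge) auto
    then show False
      using that by (cases s; cases w) (auto simp: less_eq_prod_def zero_prod_def)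
  qed
  then show ?thesis using w by blast
qed

text \<open>The leading exponents of \<open>r\<close> and \<open>h\<close> are
  \<open>s + (0, m * d)\<close> and \<open>s + (n * d, 0)\<close> for a common \<open>s\<close>.
  Both lie in \<open>S\<close>, so \<open>s\<close> is in the saturation, hence in \<open>S\<close>,
  and \<open>f\<close> times a term at \<open>s\<close> cancels the leading term of
  \<open>r\<close>.\<close>

lemma regular_pair:
  fixes f g r h :: "'k plane_poly"
  assumes sat: "saturation \<subseteq> S"
    and f: "f \<in> supported S" "f \<noteq> 0" "lead_exp f = (0, m * d)"
    and g: "g \<in> supported S" "g \<noteq> 0" "lead_exp g = (n * d, 0)"
    and "r \<in> supported S" "h \<in> supported S" "g * r = f * h"
  shows "\<exists>q\<in>supported S. r = f * q"
  using assms(8-)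
proof (induction "lead_exp r" arbitrary: r h rule: less_induct)
  case less
  show ?case
  proof (cases "r = 0")
    case True
    then show ?thesis by (intro bexI[of _ 0]) auto
  next
    case False
    then have "h \<noteq> 0" using less.prems g(2) by auto
    then have leads: "(n * d, 0) + lead_exp r = (0, m * d) + lead_exp h"
      using lead_exp_mult[OF g(2) False] lead_exp_mult[OF f(2) \<open>h \<noteq> 0\<close>] less.prems f g by simp
    \<comment> \<open>By \<open>leads\<close>, \<open>h\<close> exceeds \<open>r\<close> by
      \<open>n * d\<close> in the first coordinate and \<open>r\<close> exceeds \<open>h\<close> by
      \<open>m * d\<close> in the second; \<open>s\<close> takes the smaller value of each, which
      avoids subtraction.\<close>
    define s where "s = (fst (lead_exp r), snd (lead_exp h))"
    have s: "s + (0, m * d) = lead_exp r" "s + (n * d, 0) = lead_exp h"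
      using leads by (cases "lead_exp r"; cases "lead_exp h"; simp add: s_def)+
    have "lead_exp r \<in> S" "lead_exp h \<in> S"
      using less.prems lead_exp_in_keys[OF False] lead_exp_in_keys[OF \<open>h \<noteq> 0\<close>]
      by (auto simp: supported_def)
    then have "s + (0, m * d) \<in> S" "s + (n * d, 0) \<in> S" by (simp_all add: s)
    then have "s \<in> saturation" unfolding saturation_def by blast
    then have sS: "s \<in> S" using sat by blast
    let ?c = "lookup r (lead_exp r) / lookup f (lead_exp f)"
    let ?q = "single s ?c"
    have lf: "lookup f (lead_exp f) \<noteq> 0"
      using lead_exp_in_keys[OF f(2)] by (simp add: in_keys_iff)
    have c: "?c \<noteq> 0" using lf lead_exp_in_keys[OF False] by (simp add: in_keys_iff)
    have q0: "?q \<noteq> 0" using c by (metis lookup_single_eq lookup_zero)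
    have "lead_exp ?q = s" using c by (simp add: lead_exp_def)
    then have lm: "lead_exp (f * ?q) = lead_exp r"
      using lead_exp_mult[OF f(2) q0] f(3) s(1) by (simp add: add.commute)
    have "lookup (f * ?q) (lead_exp r) = lookup r (lead_exp r)"
      using lookup_single_mult[of s ?c f "lead_exp f"] lf f(3) s(1) by (simp add: mult.commute)
    note smaller = lead_exp_diff_less[OF lm this]
    have qS: "?q \<in> supported S" using sS by simp
    have "\<exists>q\<in>supported S. r - f * ?q = f * q"
    proof (cases "r - f * ?q = 0")
      case True
      then show ?thesis by (intro bexI[of _ 0]) auto
    next
      case False
      show ?thesis
      proof (rule less.hyps[OF smaller[OF False]])
        show "g * (r - f * ?q) = f * (h - g * ?q)"
          using less.prems by (simp add: algebra_simps)
      qed (use less.prems f g qS in auto)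
    qed
    then obtain q where "q \<in> supported S" "r - f * ?q = f * q" by blast
    then show ?thesis
      using qS by (intro bexI[of _ "q + ?q"]) (auto simp: algebra_simps)
  qed
qed

text \<open>An ideal \<open>Q\<close> maximal among those containing \<open>f\<close> and missing
  the multiplicative set \<open>M\<close> is prime, omits \<open>g\<close> and lies in
  \<open>P\<close>, so \<open>{0}\<close>, \<open>Q\<close>, \<open>P\<close> is a strict chain. The
  hypothesis \<open>avoid\<close> says that the principal ideal of \<open>f\<close> misses
  \<open>M\<close>: locally at \<open>P\<close>, no power of \<open>g\<close> is a multiple of
  \<open>f\<close>.\<close>

lemma ideal_height_ge_2:
  fixes f g :: "'k plane_poly"
  assumes P: "primeideal P R" and f: "f \<in> P" "f \<noteq> 0" and g: "g \<in> P"
    and avoid: "\<And>s n r. s \<in> supported S \<Longrightarrow> s \<notin> P \<Longrightarrow> r \<in> supported S \<Longrightarrow> s * g ^ n \<noteq> f * r"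
  shows "2 \<le> ideal_height R P"
proof -
  note idl = primeideal.axioms(1)[OF P]
  have one_P: "1 \<notin> P" using ideal_one_iff[OF idl] primeideal.I_notcarr[OF P] by auto
  have fS: "f \<in> supported S" and gS: "g \<in> supported S" using ideal_subset[OF idl] f g by auto
  define M where "M = {s * g ^ n | s n. s \<in> supported S \<and> s \<notin> P}"
  have M_I: "s * g ^ n \<in> M" if "s \<in> supported S" "s \<notin> P" for s n
    using that unfolding M_def by blast
  have M_E: "\<exists>s n. m = s * g ^ n \<and> s \<in> supported S \<and> s \<notin> P" if "m \<in> M" for m
    using that unfolding M_def by blast
  have M_mult: "m * m' \<in> M" if mM: "m \<in> M" "m' \<in> M" for m m'
  proof -
    obtain s n s' n' where m: "m = s * g ^ n" "s \<in> supported S" "s \<notin> P"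
      "m' = s' * g ^ n'" "s' \<in> supported S" "s' \<notin> P"
      using M_E[OF mM(1)] M_E[OF mM(2)] by blast
    then have "s * s' \<notin> P" using primeideal.I_prime[OF P, of s s'] by auto
    moreover have "m * m' = (s * s') * g ^ (n + n')" by (simp add: m power_add ac_simps)
    moreover have "s * s' \<in> supported S" using m by auto
    ultimately show ?thesis using M_I[of "s * s'" "n + n'"] by simp
  qed
  define C where "C = {J. ideal J R \<and> f \<in> J \<and> J \<inter> M = {}}"
  have "\<exists>Q\<in>C. \<forall>J\<in>C. Q \<subseteq> J \<longrightarrow> J = Q"
  proof (rule subset_Zorn_nonempty)
    have "r * f \<notin> M" if "r \<in> supported S" for r
      using avoid[OF _ _ that] M_E[of "r * f"] by (metis mult.commute)
    then have "Idl\<^bsub>R\<^esub> {f} \<inter> M = {}"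
      unfolding genideal_singleton_R[OF fS] by blast
    moreover have "f \<in> Idl\<^bsub>R\<^esub> {f}" using ring.genideal_self'[OF ring_R] fS by simp
    ultimately have "Idl\<^bsub>R\<^esub> {f} \<in> C"
      using genideal_ideal_R[of "{f}"] fS unfolding C_def by simp
    then show "C \<noteq> {}" by blast
    fix D assume D: "D \<noteq> {}" "subset.chain C D"
    then have "subset.chain {I. ideal I R} D"
      by (auto simp: subset_chain_def C_def)
    then have "\<Union>D \<in> D"
      by (rule noetherian_ring.ideal_chain_is_trivial[OF noetherian_R D(1)])
    then show "\<Union>D \<in> C" using D(2) by (auto simp: subset_chain_def)
  qed
  then obtain Q where "Q \<in> C" and Q_max: "\<forall>J\<in>C. Q \<subseteq> J \<longrightarrow> J = Q" by blast
  then have Q: "ideal Q R" "f \<in> Q" "Q \<inter> M = {}" by (simp_all add: C_def)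
  have max: "J = Q" if "ideal J R" "f \<in> J" "J \<inter> M = {}" "Q \<subseteq> J" for J
    using Q_max that by (simp add: C_def)
  have meets: "\<exists>q\<in>Q. \<exists>r\<in>supported S. q + a * r \<in> M" if a: "a \<in> supported S" "a \<notin> Q" for a
  proof (rule ccontr)
    assume *: "\<not> ?thesis"
    define J where "J = {q + a * r | q r. q \<in> Q \<and> r \<in> supported S}"
    have J_I: "q + a * r \<in> J" if "q \<in> Q" "r \<in> supported S" for q r
      using that unfolding J_def by blast
    have J_E: "\<exists>q r. z = q + a * r \<and> q \<in> Q \<and> r \<in> supported S" if "z \<in> J" for z
      using that unfolding J_def by blast
    have "ideal J R"
      unfolding ideal_iff
    proof (intro conjI ballI)
      show "J \<subseteq> supported S" using ideal_subset[OF Q(1)] a(1) by (auto simp: J_def)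
      show "0 \<in> J" using J_I[OF ideal_0[OF Q(1)] supported_0] by simp
      fix z assume "z \<in> J"
      then obtain q r where z: "z = q + a * r" "q \<in> Q" "r \<in> supported S" using J_E by blast
      show "z + z' \<in> J" if "z' \<in> J" for z'
      proof -
        from that obtain q' r' where z': "z' = q' + a * r'" "q' \<in> Q" "r' \<in> supported S" using J_E by blast
        have "z + z' = (q + q') + a * (r + r')" by (simp add: z(1) z'(1) algebra_simps)
        moreover have "q + q' \<in> Q" "r + r' \<in> supported S" using z z' ideal_add[OF Q(1)] by auto
        ultimately show ?thesis using J_I by simp
      qed
      show "c * z \<in> J" if "c \<in> supported S" for c
      proof -
        have "c * z = c * q + a * (c * r)" by (simp add: z(1) algebra_simps)
        moreover have "c * q \<in> Q" "c * r \<in> supported S" using z that ideal_mult[OF Q(1)] by auto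
        ultimately show ?thesis using J_I by simp
      qed
    qed
    moreover have "Q \<subseteq> J" using J_I[OF _ supported_0] by auto
    moreover have "a \<in> J" using J_I[OF ideal_0[OF Q(1)] supported_S_1] by simp
    moreover have "J \<inter> M = {}" using * by (auto simp: J_def)
    ultimately show False using max[of J] Q(2) a(2) by blast
  qed
  have prime: "primeideal Q R"
  proof (rule primeidealI[OF Q(1) cring_R])
    have "1 \<in> M" using M_I[OF supported_S_1 one_P, of 0] by simp
    then show "carrier R \<noteq> Q" using Q(3) supported_S_1 carrier_R by blast
    fix a b assume ab: "a \<in> carrier R" "b \<in> carrier R" "a \<otimes>\<^bsub>R\<^esub> b \<in> Q"
    show "a \<in> Q \<or> b \<in> Q"
    proof (rule ccontr)
      assume "\<not> ?thesis"
      with meets ab obtain q r q' r' where *: "q \<in> Q" "r \<in> supported S" "q + a * r \<in> M"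
        "q' \<in> Q" "r' \<in> supported S" "q' + b * r' \<in> M"
        by (metis carrier_R)
      have abS: "a \<in> supported S" "b \<in> supported S" "a * b \<in> Q" using ab by simp_all
      have "(q' + b * r') * q \<in> Q" "(a * r) * q' \<in> Q" "(r * r') * (a * b) \<in> Q"
        using * abS ideal_subset[OF Q(1) *(4)]
        by (intro ideal_mult[OF Q(1) *(1)] ideal_mult[OF Q(1) *(4)] ideal_mult[OF Q(1) abS(3)]
            supported_add supported_S_mult; simp)+
      then have "(q' + b * r') * q + (a * r) * q' + (r * r') * (a * b) \<in> Q"
        by (intro ideal_add[OF Q(1)])
      also have "(q' + b * r') * q + (a * r) * q' + (r * r') * (a * b) = (q + a * r) * (q' + b * r')"
        by (simp add: algebra_simps)
      finally show False using M_mult[OF *(3) *(6)] Q(3) by blast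
    qed
  qed
  have "Q \<subseteq> P"
  proof
    fix z assume z: "z \<in> Q"
    show "z \<in> P"
    proof (rule ccontr)
      assume "z \<notin> P"
      then have "z \<in> M" using M_I[of z 0] ideal_subset[OF Q(1) z] by simp
      then show False using Q(3) z by blast
    qed
  qed
  moreover have "g \<notin> Q" using M_I[OF supported_S_1 one_P, of 1] Q(3) by auto
  ultimately have "Q \<subset> P" using g by blast
  moreover have "{0} \<subset> Q" using Q(2) f(2) ideal_0[OF Q(1)] by auto
  moreover have "primeideal {0} R" using domain.zeroprimeideal[OF domain_R] by simp
  ultimately have "\<exists>L. (\<forall>i\<le>2. primeideal (L i) R) \<and> (\<forall>i<2. L i \<subset> L (Suc i)) \<and> L 2 = P"
    using prime P
    by (intro exI[of _ "\<lambda>i. if i = 0 then {0} else if i = 1 then Q else P"])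
      (auto simp: less_2_cases_iff)
  then have "enat 2 \<le> ideal_height R P"
    unfolding ideal_height_def by (intro Sup_upper) blast
  then show ?thesis by (simp add: numeral_eq_enat)
qed

text \<open>The quotient is the coefficient field: an element of \<open>R\<close> with nonzero
  constant term differs from a nonzero scalar by an element of this ideal. It contains the maximal
  homogeneous ideal, and it is where the depth drops if there are gaps.\<close>

lemma maximal_supported: "maximalideal (supported (S - {0})) R"
proof (rule maximalidealI)
  show idl: "ideal (supported (S - {0})) R"
    unfolding ideal_iff
  proof (intro conjI ballI)
    show "r * f \<in> supported (S - {0})" if "f \<in> supported (S - {0})" "r \<in> supported S" for f r :: "_ \<Rightarrow>\<^sub>0 'k"
    proof (rule supported_mult[OF that(2,1)])
      fix s t assume "s \<in> S" "t \<in> S - {0}"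
      then show "s + t \<in> S - {0}" using add_S[of s t] add_eq_0_plane[of t s] by (metis DiffD1 DiffD2 DiffI add.commute singletonD singletonI)
    qed
  qed (use supported_mono[of "S - {0}" S] in auto)
  show "carrier R \<noteq> supported (S - {0})"
  proof -
    have "(1 :: _ \<Rightarrow>\<^sub>0 'k) \<notin> supported (S - {0})" by (simp add: supported_def)
    then show ?thesis using supported_S_1 carrier_R by metis
  qed
  fix J assume J: "ideal J R" "supported (S - {0}) \<subseteq> J" "J \<subseteq> carrier R"
  show "J = supported (S - {0}) \<or> J = carrier R"
  proof (rule disjCI)
    assume "J \<noteq> carrier R"
    then have one: "1 \<notin> J" using ideal_one_iff[OF J(1)] by simp
    have "f \<in> supported (S - {0})" if f: "f \<in> J" for f
    proof (rule ccontr)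
      assume "f \<notin> supported (S - {0})"
      have fS: "f \<in> supported S" using J(1) f by (rule ideal_subset)
      let ?c = "lookup f 0"
      have c: "?c \<noteq> 0"
        using fS \<open>f \<notin> supported (S - {0})\<close> by (auto simp: supported_def in_keys_iff)
      have "f - single 0 ?c \<in> supported S" using fS by (intro supported_diff) auto
      moreover have "lookup (f - single 0 ?c) 0 = 0" by (simp add: lookup_minus)
      ultimately have "f - single 0 ?c \<in> supported (S - {0})"
        by (auto simp: supported_def in_keys_iff)
      then have "f - (f - single 0 ?c) \<in> J"
        using ideal_diff[OF J(1) f] J(2) by blast
      then have "single 0 (inverse ?c) * (f - (f - single 0 ?c)) \<in> J"
        using J(1) by (intro ideal_mult) auto
      then show False using c one by (simp add: mult_single)
    qed
    then show "J = supported (S - {0})" using J(2) by blast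
  qed
qed

lemma lead_exp_axis:
  fixes f :: "'k plane_poly" and u :: "nat \<times> nat"
  assumes "f \<in> supported (range (\<lambda>n. (n * fst u, n * snd u)))" "f \<noteq> 0"
  shows "\<exists>n. lead_exp f = (n * fst u, n * snd u)"
  using lead_exp_in_keys[OF assms(2)] assms(1) by (auto simp: supported_def)

theorem cohen_macaulay_iff: "cohen_macaulay R \<longleftrightarrow> saturation \<subseteq> S"
proof
  assume sat: "saturation \<subseteq> S"
  have "grade R P = ideal_height R P" if P: "maximalideal P R" for P
  proof -
    note idl = maximal_ideal(1)[OF P]
    obtain f where f: "f \<in> supported (range (\<lambda>n. (n * fst (0::nat, d), n * snd (0::nat, d))))" "f \<in> P" "f \<noteq> 0"
      using maximal_meets_axis[OF P, of "(0, d)" "(d, 0)"] by auto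
    obtain m where m: "lead_exp f = (0, m * d)" using lead_exp_axis[OF f(1,3)] by auto
    obtain g where g: "g \<in> supported (range (\<lambda>n. (n * fst (d, 0::nat), n * snd (d, 0::nat))))" "g \<in> P" "g \<noteq> 0"
      using maximal_meets_axis[OF P, of "(d, 0)" "(0, d)"] by auto
    obtain n where n: "lead_exp g = (n * d, 0)" using lead_exp_axis[OF g(1,3)] by auto
    have fS: "f \<in> supported S" and gS: "g \<in> supported S" using ideal_subset[OF idl] f g by auto
    note regular = regular_pair[OF sat fS f(3) m gS g(3) n]
    have fg_P: "Idl\<^bsub>R\<^esub> {f, g} \<subseteq> P"
      using ring.genideal_minimal[OF ring_R idl] f g by simp
    have "regular_sequence R [f, g]"
      unfolding regular_sequence_def
    proof (intro conjI allI impI ballI)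
      fix i r assume i: "i < length [f, g]" and r: "r \<in> carrier R"
        and *: "[f, g] ! i \<otimes>\<^bsub>R\<^esub> r \<in> Idl\<^bsub>R\<^esub> (set (take i [f, g]))"
      from i consider "i = 0" | "i = 1" by fastforce
      then show "r \<in> Idl\<^bsub>R\<^esub> (set (take i [f, g]))"
      proof cases
        case 1
        then show ?thesis using * f(3) by (simp add: genideal_empty_R)
      next
        case 2
        then have "g * r \<in> Idl\<^bsub>R\<^esub> {f}" using * by simp
        then obtain h where "h \<in> supported S" "g * r = f * h"
          unfolding genideal_singleton_R[OF fS] by (auto simp: mult.commute)
        then obtain q where "q \<in> supported S" "r = f * q" using regular[of r h] r by auto
        then show ?thesis using 2 genideal_singleton_R[OF fS] by (auto simp: mult.commute)
      qed
    next
      show "Idl\<^bsub>R\<^esub> (set [f, g]) \<noteq> carrier R"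
        using fg_P maximal_ideal(3)[OF P] supported_S_1 carrier_R
        by (metis empty_set list.simps(15) subsetD)
    qed (use fS gS in auto)
    then have "enat (length [f, g]) \<le> grade R P"
      unfolding grade_def using f g by (intro SUP_upper) auto
    then have grade: "grade R P = 2"
      using grade_le_2[of P] by (intro antisym) (simp_all add: numeral_eq_enat eval_nat_numeral)
    have "2 \<le> ideal_height R P"
    proof (rule ideal_height_ge_2[OF maximal_ideal(2)[OF P] f(2,3) g(2)])
      fix s r :: "'k plane_poly" and n' assume s: "s \<in> supported S" "s \<notin> P" "r \<in> supported S"
      show "s * g ^ n' \<noteq> f * r"
      proof
        assume "s * g ^ n' = f * r"
        \<comment> \<open>Powers of \<open>g\<close> again lead with a pure power, so
          \<open>regular_pair\<close> applies to \<open>g ^ n'\<close> in place of \<open>g\<close>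
          and makes \<open>s\<close> a multiple of \<open>f\<close>, contrary to \<open>s\<close>
          lying outside \<open>P\<close>.\<close>
        moreover have "lead_exp (g ^ n') = (n' * n * d, 0) \<and> g ^ n' \<noteq> 0"
        proof (induction n')
          case (Suc n')
          then show ?case using lead_exp_mult[OF g(3), of "g ^ n'"] n g(3) by (simp add: algebra_simps)
        qed (simp add: lead_exp_def zero_prod_def)
        ultimately obtain q where "q \<in> supported S" "s = f * q"
          using regular_pair[OF sat fS f(3) m, of "g ^ n'" "n' * n" s r] s gS
          by (auto simp: mult.commute)
        then show False using s(2) ideal_mult'[OF idl f(2)] by simp
      qed
    qed
    then have "ideal_height R P = 2" using ideal_height_le_2[of P] by (rule antisym[rotated])
    then show ?thesis using grade by simp
  qed
  then show "cohen_macaulay R"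
    unfolding cohen_macaulay_def using cring_R noetherian_R by blast
next
  assume cm: "cohen_macaulay R"
  show "saturation \<subseteq> S"
  proof (rule ccontr)
    assume "\<not> saturation \<subseteq> S"
    then obtain w where w: "w \<in> saturation - S" "\<And>s. s \<in> S - {0} \<Longrightarrow> s + w \<in> S"
      using socle_exists by blast
    let ?m = "supported (S - {0}) :: (_ \<Rightarrow>\<^sub>0 'k) set"
    let ?x = "monomial (d, 0) :: _ \<Rightarrow>\<^sub>0 'k" and ?y = "monomial (0, d) :: _ \<Rightarrow>\<^sub>0 'k"
    note max = maximal_supported
    have "2 \<le> ideal_height R ?m"
    proof (rule ideal_height_ge_2[OF maximal_ideal(2)[OF max]])
      show "?x \<in> ?m" "?y \<in> ?m" using x_S y_S d_pos by (auto simp: zero_prod_def)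
      show "?x \<noteq> 0" by (metis lookup_single_eq lookup_zero zero_neq_one)
      fix s r :: "'k plane_poly" and n assume s: "s \<in> supported S" "s \<notin> ?m" and r: "r \<in> supported S"
      \<comment> \<open>An element of \<open>R\<close> outside this ideal has a nonzero constant
        term, so \<open>s * ?y ^ n\<close> has a term on the second axis, which no multiple of
        \<open>?x\<close> has.\<close>
      have "0 \<in> keys s" using s by (auto simp: supported_def)
      then have "(n * 0, n * d) + 0 \<in> keys (monomial (n * 0, n * d) * s)"
        by (rule keys_monomial_mult)
      then have *: "(0, n * d) \<in> keys (s * ?y ^ n)"
        by (simp add: monomial_power mult.commute)
      moreover have "(0, n * d) \<notin> keys (?x * r)"
        using keys_mult[of ?x r] d_pos by auto
      ultimately show "s * ?y ^ n \<noteq> ?x * r" by metis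
    qed
    then have "2 \<le> grade R ?m" using cm max unfolding cohen_macaulay_def by simp
    then obtain xs where xs: "regular_sequence R xs" "set xs \<subseteq> ?m" "2 \<le> length xs"
    proof -
      have "\<exists>xs. regular_sequence R xs \<and> set xs \<subseteq> ?m \<and> 2 \<le> length xs"
      proof (rule ccontr)
        assume "\<not> ?thesis"
        then have "grade R ?m \<le> 1"
          unfolding grade_def by (intro SUP_least) (auto simp: one_enat_def)
        with \<open>2 \<le> grade R ?m\<close> have "(2::enat) \<le> 1" by (rule order_trans)
        then show False by simp
      qed
      then show ?thesis using that by blast
    qed
    define x0 where "x0 = xs ! 0"
    define x1 where "x1 = xs ! 1"
    have len: "0 < length xs" "1 < length xs" using xs(3) by linarith+
    have x_m: "x0 \<in> ?m" "x1 \<in> ?m"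
      unfolding x0_def x1_def using nth_mem[OF len(1)] nth_mem[OF len(2)] xs(2) by blast+
    have xS: "x0 \<in> supported S" "x1 \<in> supported S"
      using x_m supported_mono[of "S - {0}" S] by blast+
    have tw: "monomial w * f \<in> supported S" if "f \<in> ?m" for f :: "_ \<Rightarrow>\<^sub>0 'k"
      using supported_mult[OF that supported_single, of w "{w}" S 1] w(2) by (simp add: mult.commute)
    have take: "set (take 0 xs) = {}" "set (take 1 xs) = {x0}"
      using xs(3) by (cases xs; simp add: x0_def)+
    have reg0: "r \<in> Idl\<^bsub>R\<^esub> {}" if "x0 * r \<in> Idl\<^bsub>R\<^esub> {}" "r \<in> supported S" for r
      using xs(1) len(1) that take(1) unfolding regular_sequence_def x0_def by (metis carrier_R mult_R)
    have reg1: "r \<in> Idl\<^bsub>R\<^esub> {x0}" if "x1 * r \<in> Idl\<^bsub>R\<^esub> {x0}" "r \<in> supported S" for r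
      using xs(1) len(2) that take(2) unfolding regular_sequence_def x1_def by (metis carrier_R mult_R)
    have "x0 \<noteq> 0" using reg0[of 1] by (auto simp: genideal_empty_R)
    have "x1 * (monomial w * x0) \<in> Idl\<^bsub>R\<^esub> {x0}"
      unfolding genideal_singleton_R[OF xS(1)] using tw[OF x_m(2)]
      by (intro CollectI exI[of _ "monomial w * x1"]) (auto simp: ac_simps)
    then have "monomial w * x0 \<in> Idl\<^bsub>R\<^esub> {x0}" using reg1 tw[OF x_m(1)] by blast
    then obtain r where "r \<in> supported S" "monomial w * x0 = r * x0"
      unfolding genideal_singleton_R[OF xS(1)] by auto
    then have "monomial w \<in> (supported S :: (_ \<Rightarrow>\<^sub>0 'k) set)" using \<open>x0 \<noteq> 0\<close> by simp
    then show False using w(1) by (simp add: supported_single_iff)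
  qed
qed

end

lemma (in abelian_group) a_minus_eq_zero_iff:
  assumes "x \<in> carrier G" "y \<in> carrier G"
  shows "x \<ominus> y = \<zero> \<longleftrightarrow> x = y"
proof
  assume *: "x \<ominus> y = \<zero>"
  have "x = x \<oplus> (\<ominus> y \<oplus> y)" using assms by (simp add: l_neg)
  also have "\<dots> = (x \<ominus> y) \<oplus> y" using assms by (simp add: a_assoc minus_eq)
  finally show "x = y" using * assms by simp
qed (use assms in \<open>simp add: minus_eq r_neg\<close>)

section \<open>Localizations of the semigroup ring\<close>

context plane_monoid
begin

text \<open>Excluding \<open>0\<close> reduces equality of fractions to cross-multiplication:
  \<open>R\<close> is a domain, so the factor \<open>u\<close> of \<open>fraction_rel\<close>
  cancels.\<close>

definition multiplicative :: "'k plane_poly set \<Rightarrow> bool" where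
  "multiplicative T \<longleftrightarrow> T \<subseteq> supported S \<and> 1 \<in> T \<and> 0 \<notin> T \<and> (\<forall>s\<in>T. \<forall>t\<in>T. s * t \<in> T)"

text \<open>
  The element \<open>f\<close> of \<open>T\<^sup>-\<^sup>1R\<close>, for a polynomial \<open>f\<close> that need not lie in \<open>R\<close>.
\<close>

definition fraction_of :: "'k plane_poly set \<Rightarrow> 'k plane_poly \<Rightarrow>
    ('k plane_poly \<times> 'k plane_poly) set" where
  "fraction_of T f = {(r, t). r \<in> supported S \<and> t \<in> T \<and> r = t * f}"

context
  fixes T :: "'k plane_poly set"
  assumes T: "multiplicative T"
begin

lemma T_facts: "t \<in> T \<Longrightarrow> t \<in> supported S" "1 \<in> T" "t \<in> T \<Longrightarrow> t \<noteq> 0"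
  "s \<in> T \<Longrightarrow> t \<in> T \<Longrightarrow> s * t \<in> T"
  using T by (auto simp: multiplicative_def)

lemma fraction_eq:
  assumes "r \<in> supported S" "t \<in> T"
  shows "fraction R T r t = {(r', t'). r' \<in> supported S \<and> t' \<in> T \<and> r * t' = r' * t}"
  using assms T_facts(2,3) unfolding fraction_def fraction_rel_def by fastforce

lemma fraction_eq_iff:
  assumes "r \<in> supported S" "t \<in> T" "r' \<in> supported S" "t' \<in> T"
  shows "fraction R T r t = fraction R T r' t' \<longleftrightarrow> r * t' = r' * t"
proof
  assume eq: "fraction R T r t = fraction R T r' t'"
  have "(r', t') \<in> fraction R T r' t'" using assms by (simp add: fraction_eq)
  then have "(r', t') \<in> fraction R T r t" by (simp add: eq)
  then show "r * t' = r' * t" using assms by (simp add: fraction_eq)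
next
  assume eq: "r * t' = r' * t"
  have "r * t'' = r'' * t \<longleftrightarrow> r' * t'' = r'' * t'" if "t'' \<in> T" for r'' t''
  proof -
    have "r * t'' = r'' * t \<longleftrightarrow> t' * (r * t'') = t' * (r'' * t)" using T_facts(3)[OF assms(4)] by simp
    also have "t' * (r * t'') = (r * t') * t''" by (simp add: ac_simps)
    also have "\<dots> = t * (r' * t'')" unfolding eq by (simp add: ac_simps)
    also have "t' * (r'' * t) = t * (r'' * t')" by (simp add: ac_simps)
    also have "t * (r' * t'') = t * (r'' * t') \<longleftrightarrow> r' * t'' = r'' * t'"
      using T_facts(3)[OF assms(2)] by simp
    finally show ?thesis .
  qed
  then show "fraction R T r t = fraction R T r' t'" using assms by (auto simp: fraction_eq)
qed

lemma fraction_self: "r \<in> supported S \<Longrightarrow> t \<in> T \<Longrightarrow> (r, t) \<in> fraction R T r t"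
  by (simp add: fraction_eq)

lemma carrier_localization:
  "carrier (localization R T) = {fraction R T r t | r t. r \<in> supported S \<and> t \<in> T}"
  by (auto simp: localization_def quotient_def fraction_def)

lemma fraction_in_carrier:
  "r \<in> supported S \<Longrightarrow> t \<in> T \<Longrightarrow> fraction R T r t \<in> carrier (localization R T)"
  unfolding carrier_localization by blast

text \<open>The operations of \<open>localization\<close> are unions over representatives. A union
  of equal sets over a nonempty class is their common value, so each operation is evaluated by
  checking independence of the representative.\<close>

lemma UN_fraction:
  assumes "r \<in> supported S" "t \<in> T"
    and "\<And>r' t'. r' \<in> supported S \<Longrightarrow> t' \<in> T \<Longrightarrow> r * t' = r' * t \<Longrightarrow> F r' t' = C"
  shows "(\<Union>(r, t)\<in>fraction R T r t. F r t) = C"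
  by (rule UN_constant_eq[OF fraction_self[OF assms(1,2)]]) (use assms in \<open>auto simp: fraction_eq\<close>)

lemma add_fraction:
  assumes "r \<in> supported S" "t \<in> T" "r' \<in> supported S" "t' \<in> T"
  shows "fraction R T r t \<oplus>\<^bsub>localization R T\<^esub> fraction R T r' t' =
    fraction R T (r * t' + r' * t) (t * t')"
proof -
  have *: "fraction R T (p * q' + p' * q) (q * q') = fraction R T (r * t' + r' * t) (t * t')"
    if "p \<in> supported S" "q \<in> T" "r * q = p * t" "p' \<in> supported S" "q' \<in> T" "r' * q' = p' * t'"
    for p q p' q'
  proof -
    have "(p * q' + p' * q) * (t * t') = (p * t) * (q' * t') + (p' * t') * (q * t)"
      by (simp add: algebra_simps)
    also have "\<dots> = (r * t' + r' * t) * (q * q')"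
      unfolding that(3,6)[symmetric] by (simp add: algebra_simps)
    finally show ?thesis
      using that assms T_facts by (subst fraction_eq_iff) auto
  qed
  have "fraction R T r t \<oplus>\<^bsub>localization R T\<^esub> fraction R T r' t' =
    (\<Union>(p, q)\<in>fraction R T r t. \<Union>(p', q')\<in>fraction R T r' t'. fraction R T (p * q' + p' * q) (q * q'))"
    by (simp add: localization_def)
  also have "\<dots> = fraction R T (r * t' + r' * t) (t * t')"
    by (intro UN_fraction assms *)
  finally show ?thesis .
qed

lemma smult_fraction:
  assumes "r \<in> supported S" "t \<in> T" "s \<in> supported S"
  shows "s \<odot>\<^bsub>localization R T\<^esub> fraction R T r t = fraction R T (s * r) t"
proof -
  have *: "fraction R T (s * p) q = fraction R T (s * r) t"
    if "p \<in> supported S" "q \<in> T" "r * q = p * t" for p q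
    using that assms T_facts by (subst fraction_eq_iff) (auto simp: mult.assoc)
  have "s \<odot>\<^bsub>localization R T\<^esub> fraction R T r t = (\<Union>(p, q)\<in>fraction R T r t. fraction R T (s * p) q)"
    by (simp add: localization_def)
  also have "\<dots> = fraction R T (s * r) t"
    by (intro UN_fraction assms *)
  finally show ?thesis .
qed

lemma zero_localization: "\<zero>\<^bsub>localization R T\<^esub> = fraction R T 0 1"
  by (simp add: localization_def)

lemma abelian_group_localization: "abelian_group (localization R T)"
proof (rule abelian_groupI)
  show "\<zero>\<^bsub>localization R T\<^esub> \<in> carrier (localization R T)"
    unfolding zero_localization by (rule fraction_in_carrier[OF supported_0 T_facts(2)])
  fix x assume "x \<in> carrier (localization R T)"
  then obtain r t where x: "x = fraction R T r t" "r \<in> supported S" "t \<in> T"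
    by (auto simp: carrier_localization)
  show "\<zero>\<^bsub>localization R T\<^esub> \<oplus>\<^bsub>localization R T\<^esub> x = x"
    unfolding x(1) zero_localization add_fraction[OF supported_0 T_facts(2) x(2,3)] by simp
  have "fraction R T (- r) t \<oplus>\<^bsub>localization R T\<^esub> x = fraction R T (- r * t + r * t) (t * t)"
    unfolding x(1) by (rule add_fraction[OF supported_uminus[OF x(2)] x(3) x(2,3)])
  also have "\<dots> = \<zero>\<^bsub>localization R T\<^esub>"
    unfolding zero_localization using fraction_eq_iff[of 0 "t * t" 0 1] T_facts(2,4) x(3) by simp
  finally have "fraction R T (- r) t \<oplus>\<^bsub>localization R T\<^esub> x = \<zero>\<^bsub>localization R T\<^esub>" .
  then show "\<exists>y\<in>carrier (localization R T). y \<oplus>\<^bsub>localization R T\<^esub> x = \<zero>\<^bsub>localization R T\<^esub>"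
    by (rule bexI) (rule fraction_in_carrier[OF supported_uminus[OF x(2)] x(3)])
  fix y assume "y \<in> carrier (localization R T)"
  then obtain r' t' where y: "y = fraction R T r' t'" "r' \<in> supported S" "t' \<in> T"
    by (auto simp: carrier_localization)
  show "x \<oplus>\<^bsub>localization R T\<^esub> y \<in> carrier (localization R T)"
    unfolding x(1) y(1) add_fraction[OF x(2,3) y(2,3)]
    using x y T_facts by (intro fraction_in_carrier supported_add supported_S_mult) simp_all
  show "x \<oplus>\<^bsub>localization R T\<^esub> y = y \<oplus>\<^bsub>localization R T\<^esub> x"
    unfolding x(1) y(1) add_fraction[OF x(2,3) y(2,3)] add_fraction[OF y(2,3) x(2,3)]
    by (simp add: ac_simps)
  fix z assume "z \<in> carrier (localization R T)"
  then obtain r'' t'' where z: "z = fraction R T r'' t''" "r'' \<in> supported S" "t'' \<in> T"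
    by (auto simp: carrier_localization)
  have xyS: "r * t' + r' * t \<in> supported S" "r' * t'' + r'' * t' \<in> supported S"
    using x y z T_facts(1) by auto
  show "x \<oplus>\<^bsub>localization R T\<^esub> y \<oplus>\<^bsub>localization R T\<^esub> z =
    x \<oplus>\<^bsub>localization R T\<^esub> (y \<oplus>\<^bsub>localization R T\<^esub> z)"
    unfolding x(1) y(1) z(1) add_fraction[OF x(2,3) y(2,3)] add_fraction[OF y(2,3) z(2,3)]
      add_fraction[OF xyS(1) T_facts(4)[OF x(3) y(3)] z(2,3)]
      add_fraction[OF x(2,3) xyS(2) T_facts(4)[OF y(3) z(3)]]
    by (simp add: algebra_simps)
qed

lemma fraction_of_eq:
  assumes "t \<in> T" "t * f \<in> supported S"
  shows "fraction_of T f = fraction R T (t * f) t"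
proof -
  have "t * f * t' = r' * t \<longleftrightarrow> r' = t' * f" for r' t'
  proof -
    have "t * f * t' = t * (t' * f)" "r' * t = t * r'" by (simp_all add: ac_simps)
    then show ?thesis using T_facts(3)[OF assms(1)] by auto
  qed
  then show ?thesis using assms by (auto simp: fraction_of_def fraction_eq)
qed

lemma fraction_of_R: "f \<in> supported S \<Longrightarrow> fraction_of T f = fraction R T f 1"
  using fraction_of_eq[OF T_facts(2), of f] by simp

text \<open>Without some \<open>t\<close> carrying \<open>f\<close> into \<open>R\<close> the set
  \<open>fraction_of T f\<close> would be empty; one such \<open>t\<close> determines
  \<open>f\<close> by cancellation.\<close>

lemma fraction_of_inject:
  assumes "t \<in> T" "t * f \<in> supported S" "fraction_of T f = fraction_of T g"
  shows "f = g"
proof -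
  have "(t * f, t) \<in> fraction_of T f" using assms(1,2) by (simp add: fraction_of_def)
  then have "(t * f, t) \<in> fraction_of T g" by (simp add: assms(3))
  then have "t * f = t * g" by (simp add: fraction_of_def)
  then show ?thesis using T_facts(3)[OF assms(1)] by simp
qed

lemma fraction_of_add:
  assumes "t \<in> T" "t * f \<in> supported S" "t' \<in> T" "t' * g \<in> supported S"
  shows "fraction_of T f \<oplus>\<^bsub>localization R T\<^esub> fraction_of T g = fraction_of T (f + g)"
proof -
  have *: "t * t' * (f + g) = t * f * t' + t' * g * t" by (simp add: algebra_simps)
  then have "t * t' * (f + g) \<in> supported S" using assms T_facts(1) by auto
  then have "fraction_of T (f + g) = fraction R T (t * t' * (f + g)) (t * t')"
    using assms T_facts(4) by (intro fraction_of_eq) auto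
  then show ?thesis
    using assms by (simp add: fraction_of_eq[OF assms(1,2)] fraction_of_eq[OF assms(3,4)] add_fraction *)
qed

lemma fraction_of_smult:
  assumes "t \<in> T" "t * f \<in> supported S" "s \<in> supported S"
  shows "s \<odot>\<^bsub>localization R T\<^esub> fraction_of T f = fraction_of T (s * f)"
proof -
  have *: "t * (s * f) = s * (t * f)" by (simp add: ac_simps)
  then have "t * (s * f) \<in> supported S" using supported_S_mult[OF assms(3,2)] by (simp only: *)
  from fraction_of_eq[OF assms(1) this] show ?thesis
    using assms by (simp add: fraction_of_eq[OF assms(1,2)] smult_fraction *)
qed

end

end

section \<open>The Cech complex\<close>

text \<open>\<open>gs\<close> lists the exponents whose monomials define the Cech complex. The two
  axis elements among them detect the saturation, and every other nonzero element absorbs it by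
  \<open>saturation_absorbed\<close>, so the first cohomology is the same for each such
  list.\<close>

locale plane_cech = plane_monoid S d R
  for S d and R :: "(((nat \<times> nat) \<Rightarrow>\<^sub>0 'k::field)) ring" +
  fixes gs :: "(nat \<times> nat) list"
  assumes gs_S: "set gs \<subseteq> S - {0}" and x_gs: "(d, 0) \<in> set gs" and y_gs: "(0, d) \<in> set gs"
begin

abbreviation xs :: "'k plane_poly list" where
  "xs \<equiv> map monomial gs"

abbreviation den :: "nat set \<Rightarrow> 'k plane_poly set" where
  "den \<equiv> cech_denominators R xs"

abbreviation restr where
  "restr \<equiv> cech_restriction R xs"

abbreviation loc :: "nat set \<Rightarrow> ('k plane_poly, ('k plane_poly \<times> 'k plane_poly) set) module" where
  "loc \<equiv> cech_localization R xs"

lemma submonoid_R_iff: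
  "submonoid H R \<longleftrightarrow> H \<subseteq> supported S \<and> 1 \<in> H \<and> (\<forall>f\<in>H. \<forall>g\<in>H. f * g \<in> H)"
  by (auto simp: submonoid_def)

lemma den_least:
  "H \<subseteq> supported S \<Longrightarrow> 1 \<in> H \<Longrightarrow> (\<And>f g. f \<in> H \<Longrightarrow> g \<in> H \<Longrightarrow> f * g \<in> H) \<Longrightarrow>
    (\<And>j. j \<in> J \<Longrightarrow> xs ! j \<in> H) \<Longrightarrow> den J \<subseteq> H"
  unfolding cech_denominators_def submonoid_generated_def submonoid_R_iff
  by (rule Inter_lower) auto

lemma gs_nth_S: "j < length gs \<Longrightarrow> gs ! j \<in> S" "j < length gs \<Longrightarrow> gs ! j \<noteq> 0"
  using gs_S nth_mem by blast+

lemma den_monomials: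
  assumes "J \<subseteq> {..<length gs}"
  shows "den J \<subseteq> monomial ` S"
proof (rule den_least)
  show "1 \<in> monomial ` S" using zero_S by (metis image_eqI single_one)
  show "f * g \<in> monomial ` S" if "f \<in> monomial ` S" "g \<in> monomial ` S" for f g :: "_ \<Rightarrow>\<^sub>0 'k"
    using that add_S by (auto simp: monomial_mult)
  show "xs ! j \<in> monomial ` S" if "j \<in> J" for j
    using that assms gs_nth_S(1)[of j] by auto
qed auto

lemma
  assumes "J \<subseteq> {..<length gs}"
  shows den_1: "1 \<in> den J" and den_mult: "f \<in> den J \<Longrightarrow> g \<in> den J \<Longrightarrow> f * g \<in> den J"
    and den_gen: "j \<in> J \<Longrightarrow> monomial (gs ! j) \<in> den J"
proof -
  show "1 \<in> den J" "f \<in> den J \<Longrightarrow> g \<in> den J \<Longrightarrow> f * g \<in> den J"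
    unfolding cech_denominators_def submonoid_generated_def submonoid_R_iff by auto
  assume "j \<in> J"
  then have "xs ! j \<in> den J"
    unfolding cech_denominators_def submonoid_generated_def by blast
  then show "monomial (gs ! j) \<in> den J" using \<open>j \<in> J\<close> assms by auto
qed

lemma multiplicative_den:
  assumes "J \<subseteq> {..<length gs}"
  shows "multiplicative (den J)"
proof -
  have "0 \<notin> (monomial ` S :: (_ \<Rightarrow>\<^sub>0 'k) set)"
    using monomial_nonzero by (metis imageE)
  then show ?thesis
    unfolding multiplicative_def
    using den_monomials[OF assms] den_1[OF assms] den_mult[OF assms] by fastforce
qed

lemma den_mono: "J \<subseteq> J' \<Longrightarrow> den J \<subseteq> den J'"
  unfolding cech_denominators_def submonoid_generated_def by (rule Inter_anti_mono) auto

lemma den_empty: "den {} = {1}"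
proof
  show "den {} \<subseteq> {1}" by (rule den_least) auto
qed (use den_1[of "{}"] in simp)

lemma den_singleton:
  assumes "j < length gs"
  shows "den {j} = range (\<lambda>n. monomial (gs ! j) ^ n)"
proof
  have g: "monomial (gs ! j) \<in> (supported S :: (_ \<Rightarrow>\<^sub>0 'k) set)"
    using gs_nth_S(1)[OF assms] by simp
  show "den {j} \<subseteq> range (\<lambda>n. monomial (gs ! j) ^ n)"
  proof (rule den_least)
    show "range (\<lambda>n. monomial (gs ! j) ^ n) \<subseteq> (supported S :: (_ \<Rightarrow>\<^sub>0 'k) set)"
      using supported_S_power[OF g] by blast
    show "1 \<in> range (\<lambda>n. (monomial (gs ! j) :: _ \<Rightarrow>\<^sub>0 'k) ^ n)"
      by (rule image_eqI[of _ _ 0]) auto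
    show "xs ! i \<in> range (\<lambda>n. monomial (gs ! j) ^ n)" if "i \<in> {j}" for i
      using that assms by (intro image_eqI[of _ _ 1]) auto
  qed (auto simp flip: power_add)
  have "monomial (gs ! j) ^ n \<in> den {j}" for n
    using den_1[of "{j}"] den_mult[of "{j}"] den_gen[of "{j}" j] assms by (induction n) auto
  then show "range (\<lambda>n. monomial (gs ! j) ^ n) \<subseteq> den {j}" by blast
qed

lemma restriction_fraction:
  assumes "J \<subseteq> J'" "J' \<subseteq> {..<length gs}" "r \<in> supported S" "t \<in> den J"
  shows "restr J' (fraction R (den J) r t) = fraction R (den J') r t"
proof -
  have J: "multiplicative (den J)" "multiplicative (den J')" using assms multiplicative_den by auto
  show ?thesis
    unfolding cech_restriction_def
  proof (rule UN_fraction[OF J(1) assms(3,4)])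
    fix r' t' assume "r' \<in> supported S" "t' \<in> den J" "r * t' = r' * t"
    then show "fraction R (den J') r' t' = fraction R (den J') r t"
      using assms den_mono[OF assms(1)] by (subst fraction_eq_iff[OF J(2)]) auto
  qed
qed

lemma restriction_fraction_of:
  assumes "J \<subseteq> J'" "J' \<subseteq> {..<length gs}" "t \<in> den J" "t * f \<in> supported S"
  shows "restr J' (fraction_of (den J) f) = fraction_of (den J') f"
proof -
  have J: "multiplicative (den J)" "multiplicative (den J')" using assms multiplicative_den by auto
  have "t \<in> den J'" using assms den_mono by blast
  then show ?thesis
    using restriction_fraction[OF assms(1,2,4,3)]
    by (simp add: fraction_of_eq[OF J(1) assms(3,4)] fraction_of_eq[OF J(2) _ assms(4)])
qed

section \<open>The complex in degrees 0, 1 and 2\<close>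

lemma index_0: "cech_index xs 0 = {{}}"
  by (auto simp: cech_index_def dest: finite_subset)

lemma index_1: "cech_index xs (Suc 0) = (\<lambda>j. {j}) ` {..<length gs}"
  by (auto simp: cech_index_def card_1_singleton_iff)

lemma index_2: "J \<in> cech_index xs 2 \<longleftrightarrow> (\<exists>i j. i < j \<and> j < length gs \<and> J = {i, j})"
proof
  assume "J \<in> cech_index xs 2"
  then obtain i j where "J = {i, j}" "i \<noteq> j" "i < length gs" "j < length gs"
    by (auto simp: cech_index_def card_2_iff)
  then show "\<exists>i j. i < j \<and> j < length gs \<and> J = {i, j}"
    by (metis insert_commute nat_neq_iff)
qed (auto simp: cech_index_def)

lemma abelian_group_loc: "J \<subseteq> {..<length gs} \<Longrightarrow> abelian_group (loc J)"
  unfolding cech_localization_def by (intro abelian_group_localization multiplicative_den)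

lemma carrier_loc:
  "J \<subseteq> {..<length gs} \<Longrightarrow> carrier (loc J) = {fraction R (den J) r t | r t. r \<in> supported S \<and> t \<in> den J}"
  unfolding cech_localization_def by (intro carrier_localization multiplicative_den)

lemma restriction_carrier:
  assumes "J \<subseteq> J'" "J' \<subseteq> {..<length gs}" "x \<in> carrier (loc J)"
  shows "restr J' x \<in> carrier (loc J')"
proof -
  have "J \<subseteq> {..<length gs}" using assms by auto
  then obtain r t where "x = fraction R (den J) r t" "r \<in> supported S" "t \<in> den J"
    using assms(3) carrier_loc by auto
  then show ?thesis
    using restriction_fraction[OF assms(1,2)] den_mono[OF assms(1)]
    unfolding carrier_loc[OF assms(2)] by blast
qed

lemma differential_0:
  assumes "c \<in> carrier (cech_cochains R xs 0)" "j < length gs"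
  shows "cech_differential R xs 0 c {j} = restr {j} (c {})"
proof -
  have J: "{j} \<subseteq> {..<length gs}" using assms(2) by simp
  interpret L: abelian_group "loc {j}" by (rule abelian_group_loc[OF J])
  have "c {} \<in> carrier (loc {})" using assms(1) by (auto simp: cech_cochains_def index_0)
  then have "restr {j} (c {}) \<in> carrier (loc {j})"
    by (intro restriction_carrier[OF _ J]) auto
  moreover have e: "{i. i = j \<and> i < j} = {}" by auto
  ultimately show ?thesis
    using assms(2) by (simp add: cech_differential_def index_1 L.finsum_insert Let_def e)
qed

lemma differential_1:
  assumes "c \<in> carrier (cech_cochains R xs 1)" "i < j" "j < length gs"
  shows "cech_differential R xs 1 c {i, j} =
    restr {i, j} (c {j}) \<ominus>\<^bsub>loc {i, j}\<^esub> restr {i, j} (c {i})"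
proof -
  have J: "{i, j} \<subseteq> {..<length gs}" using assms(2,3) by simp
  interpret L: abelian_group "loc {i, j}" by (rule abelian_group_loc[OF J])
  have c: "c {l} \<in> carrier (loc {l})" if "l < length gs" for l
    using assms(1) that by (auto simp: cech_cochains_def index_1)
  have *: "restr {i, j} (c {j}) \<in> carrier (loc {i, j})"
    "restr {i, j} (c {i}) \<in> carrier (loc {i, j})"
    using c[of j] c[of i] assms(2,3)
      restriction_carrier[of "{j}", OF _ J] restriction_carrier[of "{i}", OF _ J] by simp_all
  have "{i, j} \<in> cech_index xs (Suc 1)"
    using index_2[of "{i, j}"] assms(2,3) by (auto simp: numeral_2_eq_2)
  moreover have "{i, j} - {i} = {j}" "{i, j} - {j} = {i}" using assms(2) by auto
  moreover have e: "{l. (l = i \<or> l = j) \<and> l < i} = {}" "{l. (l = i \<or> l = j) \<and> l < j} = {i}"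
    using assms(2) by auto
  ultimately show ?thesis
    using assms(2) * by (simp add: cech_differential_def L.finsum_insert a_minus_def Let_def e)
qed

text \<open>On a pair of indices the signs make the differential the difference of two restrictions,
  so a cocycle is a family of fractions that agree on overlaps.\<close>

lemma cocycle_iff:
  assumes "c \<in> carrier (cech_cochains R xs 1)"
  shows "c \<in> cech_cocycles R xs 1 \<longleftrightarrow> (\<forall>i j. i < j \<longrightarrow> j < length gs \<longrightarrow>
    restr {i, j} (c {j}) = restr {i, j} (c {i}))"
proof -
  have c: "c {l} \<in> carrier (loc {l})" if "l < length gs" for l
    using assms(1) that by (auto simp: cech_cochains_def index_1)
  have iff: "cech_differential R xs 1 c {i, j} = \<zero>\<^bsub>loc {i, j}\<^esub> \<longleftrightarrow>
    restr {i, j} (c {j}) = restr {i, j} (c {i})"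
    if ij: "i < j" "j < length gs" for i j
  proof -
    have J: "{i, j} \<subseteq> {..<length gs}" using ij by simp
    interpret L: abelian_group "loc {i, j}" by (rule abelian_group_loc[OF J])
    have "restr {i, j} (c {j}) \<in> carrier (loc {i, j})"
      "restr {i, j} (c {i}) \<in> carrier (loc {i, j})"
      using c[of j] c[of i] ij
        restriction_carrier[of "{j}", OF _ J] restriction_carrier[of "{i}", OF _ J] by simp_all
    then show ?thesis
      unfolding differential_1[OF assms ij] by (rule L.a_minus_eq_zero_iff)
  qed
  have "c \<in> cech_cocycles R xs 1 \<longleftrightarrow>
    (\<forall>J\<in>cech_index xs 2. cech_differential R xs 1 c J = \<zero>\<^bsub>loc J\<^esub>)"
  proof -
    let ?z = "\<lambda>J\<in>cech_index xs 2. \<zero>\<^bsub>loc J\<^esub>"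
    have "\<zero>\<^bsub>cech_cochains R xs (Suc 1)\<^esub> = ?z"
      by (simp add: cech_cochains_def numeral_2_eq_2)
    then have "c \<in> cech_cocycles R xs 1 \<longleftrightarrow> cech_differential R xs 1 c = ?z"
      using assms unfolding cech_cocycles_def by simp
    moreover have "cech_differential R xs 1 c J = ?z J" if "J \<notin> cech_index xs 2" for J
      using that by (simp add: cech_differential_def numeral_2_eq_2)
    then have "cech_differential R xs 1 c = ?z \<longleftrightarrow>
        (\<forall>J\<in>cech_index xs 2. cech_differential R xs 1 c J = ?z J)"
      unfolding fun_eq_iff by blast
    ultimately show ?thesis by simp
  qed
  also have "\<dots> \<longleftrightarrow> (\<forall>i j. i < j \<longrightarrow> j < length gs \<longrightarrow> cech_differential R xs 1 c {i, j} = \<zero>\<^bsub>loc {i, j}\<^esub>)"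
    unfolding Ball_def index_2 by blast
  also have "\<dots> \<longleftrightarrow> (\<forall>i j. i < j \<longrightarrow> j < length gs \<longrightarrow>
      restr {i, j} (c {j}) = restr {i, j} (c {i}))"
    using iff by simp
  finally show ?thesis .
qed

definition cochain_of :: "'k plane_poly \<Rightarrow>
    (nat set \<Rightarrow> ('k plane_poly \<times> 'k plane_poly) set)" where
  "cochain_of f = (\<lambda>J\<in>cech_index xs (Suc 0). fraction_of (den J) f)"

lemma cochain_of_singleton: "j < length gs \<Longrightarrow> cochain_of f {j} = fraction_of (den {j}) f"
  by (simp add: cochain_of_def index_1)

text \<open>Each term is carried into \<open>S\<close> by some power of the generator; multiplying
  these powers gives one denominator for the whole polynomial.\<close>

lemma saturation_denominator:
  assumes "f \<in> supported saturation" "j < length gs"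
  shows "\<exists>t\<in>den {j}. t * f \<in> supported S"
proof -
  let ?x = "monomial (gs ! j) :: _ \<Rightarrow>\<^sub>0 'k"
  have "\<exists>n. ?x ^ n * f \<in> supported S"
    using assms(1)
  proof (induction f rule: supported_induct)
    case (single w c)
    then obtain n where "(n * fst (gs ! j), n * snd (gs ! j)) + w \<in> S"
      using saturation_absorbed gs_nth_S[OF assms(2)] by blast
    then show ?case by (intro exI[of _ n]) (simp add: monomial_power mult_single)
  next
    case (add f g)
    then obtain m n where "?x ^ m * f \<in> supported S" "?x ^ n * g \<in> supported S" by blast
    moreover have "?x ^ (m + n) * (f + g) = ?x ^ n * (?x ^ m * f) + ?x ^ m * (?x ^ n * g)"
      by (simp add: algebra_simps power_add)
    moreover have "?x \<in> supported S" using gs_nth_S(1)[OF assms(2)] by simp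
    ultimately show ?case by (intro exI[of _ "m + n"]) auto
  qed auto
  then show ?thesis using den_singleton[OF assms(2)] by auto
qed

lemma cochain_of_cocycle:
  assumes "f \<in> supported saturation"
  shows "cochain_of f \<in> cech_cocycles R xs 1"
proof -
  have sub: "{j} \<subseteq> {..<length gs}" if "j < length gs" for j using that by simp
  have "cochain_of f \<in> carrier (cech_cochains R xs 1)"
  proof -
    have "fraction_of (den {j}) f \<in> carrier (loc {j})" if j: "j < length gs" for j
    proof -
      obtain t where "t \<in> den {j}" "t * f \<in> supported S"
        using saturation_denominator[OF assms j] by blast
      then show ?thesis
        using fraction_of_eq[OF multiplicative_den[OF sub[OF j]]] carrier_loc[OF sub[OF j]] by auto
    qed
    then show ?thesis by (auto simp: cech_cochains_def cochain_of_def index_1)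
  qed
  moreover have "restr {i, j} (cochain_of f {j}) = restr {i, j} (cochain_of f {i})"
    if ij: "i < j" "j < length gs" for i j
  proof -
    have J: "{i, j} \<subseteq> {..<length gs}" and i: "i < length gs" using ij by auto
    obtain t t' where "t \<in> den {i}" "t * f \<in> supported S" "t' \<in> den {j}" "t' * f \<in> supported S"
      using saturation_denominator[OF assms i] saturation_denominator[OF assms ij(2)] by blast
    then have "restr {i, j} (fraction_of (den {j}) f) = fraction_of (den {i, j}) f"
      "restr {i, j} (fraction_of (den {i}) f) = fraction_of (den {i, j}) f"
      using restriction_fraction_of[OF _ J, of "{j}" t' f] restriction_fraction_of[OF _ J, of "{i}" t f]
      by simp_all
    then show ?thesis using i ij(2) by (simp add: cochain_of_singleton)
  qed
  ultimately show ?thesis using cocycle_iff by blast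
qed

text \<open>Coprimality of the two axis monomials: multiplication by \<open>monomial (m, 0)\<close>
  leaves second coordinates unchanged, so those of \<open>p\<close> are at least \<open>n\<close>
  and the subtraction in the quotient is not truncated.\<close>

lemma monomial_divides:
  fixes p q :: "'k plane_poly"
  assumes "monomial (m, 0) * p = monomial (0, n) * q"
  shows "\<exists>f. p = monomial (0, n) * f"
proof -
  have n: "n \<le> snd s" if "s \<in> keys p" for s
  proof -
    have "(m, 0) + s \<in> keys (monomial (0, n) * q)"
      using keys_monomial_mult[OF that, of "(m, 0)"] assms by simp
    then obtain t where "(m, 0) + s = (0, n) + t"
      using keys_mult[of "monomial (0, n)" q] by auto
    then show ?thesis by (cases s; cases t) auto
  qed
  define f where "f = (\<Sum>s\<in>keys p. single (fst s, snd s - n) (lookup p s))"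
  have "monomial (0, n) * f = (\<Sum>s\<in>keys p. single s (lookup p s))"
    unfolding f_def sum_distrib_left using n by (intro sum.cong) (auto simp: mult_single)
  then show ?thesis using sum_of_terms[of p] by metis
qed

text \<open>The components at the two axis generators are equal fractions over powers of coprime
  monomials, hence given by one polynomial \<open>f\<close>. Comparison with the component at
  \<open>(0, d)\<close> identifies every other component with \<open>f\<close>, and the two axis
  denominators place the exponents of \<open>f\<close> in the saturation.\<close>

lemma cocycle_is_cochain_of:
  assumes "c \<in> cech_cocycles R xs 1"
  shows "\<exists>f\<in>supported saturation. c = cochain_of f"
proof -
  have c: "c \<in> carrier (cech_cochains R xs 1)" using assms by (simp add: cech_cocycles_def)
  have sub: "{j} \<subseteq> {..<length gs}" if "j < length gs" for j using that by simp
  have frac: "\<exists>r t. c {j} = fraction R (den {j}) r t \<and> r \<in> supported S \<and> t \<in> den {j}"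
    if "j < length gs" for j
  proof -
    have "c {j} \<in> carrier (loc {j})" using c that by (auto simp: cech_cochains_def index_1)
    then show ?thesis unfolding carrier_loc[OF sub[OF that]] by blast
  qed
  have agree: "r * t' = r' * t"
    if ij: "i < length gs" "j < length gs" "i \<noteq> j"
      and i: "c {i} = fraction R (den {i}) r t" "r \<in> supported S" "t \<in> den {i}"
      and j: "c {j} = fraction R (den {j}) r' t'" "r' \<in> supported S" "t' \<in> den {j}" for i j r t r' t'
  proof -
    have J: "{i, j} \<subseteq> {..<length gs}" using ij by simp
    have "restr {i, j} (c {i}) = restr {i, j} (c {j})"
    proof -
      have *: "\<forall>i j. i < j \<longrightarrow> j < length gs \<longrightarrow>
          restr {i, j} (c {j}) = restr {i, j} (c {i})"
        using assms unfolding cocycle_iff[OF c] .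
      from ij(3) consider "i < j" | "j < i" by linarith
      then show ?thesis
        using *[rule_format, of i j] *[rule_format, of j i] ij by cases (simp_all add: insert_commute)
    qed
    then have "fraction R (den {i, j}) r t = fraction R (den {i, j}) r' t'"
      using i j restriction_fraction[OF _ J, of "{i}" r t] restriction_fraction[OF _ J, of "{j}" r' t'] by simp
    moreover have "t \<in> den {i, j}" "t' \<in> den {i, j}"
      using i(3) j(3) den_mono[of "{i}" "{i, j}"] den_mono[of "{j}" "{i, j}"] by auto
    ultimately show ?thesis
      using i(2) j(2) by (simp add: fraction_eq_iff[OF multiplicative_den[OF J]])
  qed
  obtain p where p: "p < length gs" "gs ! p = (0, d)" using y_gs by (auto simp: in_set_conv_nth)
  obtain q where q: "q < length gs" "gs ! q = (d, 0)" using x_gs by (auto simp: in_set_conv_nth)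
  have pq: "p \<noteq> q" using p q d_pos by auto
  obtain rp tp where cp: "c {p} = fraction R (den {p}) rp tp" "rp \<in> supported S" "tp \<in> den {p}"
    using frac[OF p(1)] by blast
  obtain rq tq where cq: "c {q} = fraction R (den {q}) rq tq" "rq \<in> supported S" "tq \<in> den {q}"
    using frac[OF q(1)] by blast
  obtain n where n: "tp = monomial (0, n * d)"
    using cp(3) p den_singleton[OF p(1)] by (auto simp: monomial_power)
  obtain m where m: "tq = monomial (m * d, 0)"
    using cq(3) q den_singleton[OF q(1)] by (auto simp: monomial_power)
  have "tq * rp = tp * rq" using agree[OF p(1) q(1) pq cp cq] by (simp add: mult.commute)
  then obtain f where f: "rp = tp * f" using monomial_divides[of "m * d" rp "n * d" rq] n m by auto
  have tp0: "tp \<noteq> 0"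
    using multiplicative_den[OF sub[OF p(1)]] cp(3) by (auto simp: multiplicative_def)
  have r_eq: "r = t * f"
    if j: "j < length gs" "c {j} = fraction R (den {j}) r t" "r \<in> supported S" "t \<in> den {j}" for j r t
  proof (cases "j = p")
    case True
    then have "rp * t = r * tp"
      using j(2) cp j(3,4) by (simp add: fraction_eq_iff[OF multiplicative_den[OF sub[OF p(1)]]])
    then have "tp * (t * f) = tp * r" by (simp add: f ac_simps)
    then show ?thesis using tp0 by simp
  next
    case False
    then have "rp * t = r * tp" using agree[OF p(1) j(1) _ cp j(2-4)] by auto
    then have "tp * (t * f) = tp * r" by (simp add: f ac_simps)
    then show ?thesis using tp0 by simp
  qed
  have "w \<in> saturation" if "w \<in> keys f" for w
  proof -
    have "monomial (0, n * d) * f \<in> supported S" using cp(2) by (simp add: f n)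
    from supported_monomial_multD[OF this that] have 1: "w + (0, n * d) \<in> S" by (simp add: add.commute)
    have "monomial (m * d, 0) * f \<in> supported S" using cq(2) r_eq[OF q(1) cq] by (simp add: m)
    from supported_monomial_multD[OF this that] have 2: "w + (m * d, 0) \<in> S" by (simp add: add.commute)
    from 1 2 show ?thesis unfolding saturation_def by blast
  qed
  then have f_sat: "f \<in> supported saturation" by (auto simp: supported_def)
  have "c J = cochain_of f J" for J
  proof (cases "J \<in> cech_index xs (Suc 0)")
    case True
    then obtain j where j: "j < length gs" "J = {j}" by (auto simp: index_1)
    obtain r t where rt: "c {j} = fraction R (den {j}) r t" "r \<in> supported S" "t \<in> den {j}"
      using frac[OF j(1)] by blast
    with r_eq[OF j(1)] show ?thesis
      using fraction_of_eq[OF multiplicative_den[OF sub[OF j(1)]] rt(3), of f] j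
      by (simp add: cochain_of_singleton)
  next
    case False
    moreover have "c \<in> extensional (cech_index xs (Suc 0))"
      using c by (auto simp: cech_cochains_def PiE_def)
    ultimately show ?thesis by (auto simp: cochain_of_def extensional_def)
  qed
  then show ?thesis using f_sat by auto
qed

lemma cocycles_eq: "cech_cocycles R xs 1 = cochain_of ` supported saturation"
  using cochain_of_cocycle cocycle_is_cochain_of by blast

lemma coboundaries_eq: "cech_coboundaries R xs 1 = cochain_of ` supported S"
proof -
  have "cech_coboundaries R xs 1 = cech_differential R xs 0 ` carrier (cech_cochains R xs 0)"
    by (simp add: cech_coboundaries_def)
  also have "\<dots> = cochain_of ` supported S"
  proof -
    have d: "cech_differential R xs 0 c = cochain_of f"
      if c: "c \<in> carrier (cech_cochains R xs 0)" "c {} = fraction_of (den {}) f" and f: "f \<in> supported S" for c f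
    proof
      fix J
      show "cech_differential R xs 0 c J = cochain_of f J"
      proof (cases "J \<in> cech_index xs (Suc 0)")
        case True
        then obtain j where j: "j < length gs" "J = {j}" by (auto simp: index_1)
        then show ?thesis
          using differential_0[OF c(1) j(1)] c(2) restriction_fraction_of[of "{}" "{j}" 1 f] f
          by (simp add: cochain_of_singleton den_empty)
      qed (simp add: cech_differential_def cochain_of_def)
    qed
    have "\<exists>f\<in>supported S. c {} = fraction_of (den {}) f" if "c \<in> carrier (cech_cochains R xs 0)" for c
    proof -
      have "c {} \<in> carrier (loc {})" using that by (auto simp: cech_cochains_def index_0)
      then obtain r where "r \<in> supported S" "c {} = fraction R (den {}) r 1"
        using carrier_loc[of "{}"] by (auto simp: den_empty)
      then show ?thesis using fraction_of_R[OF multiplicative_den[of "{}"]] by auto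
    qed
    moreover have "\<exists>c\<in>carrier (cech_cochains R xs 0). c {} = fraction_of (den {}) f"
      if "f \<in> supported S" for f
    proof -
      have "fraction_of (den {}) f \<in> carrier (loc {})"
        using fraction_of_R[OF multiplicative_den[of "{}"] that] carrier_loc[of "{}"] that
        by (auto simp: den_empty)
      then show ?thesis
        by (intro bexI[of _ "\<lambda>J\<in>cech_index xs 0. fraction_of (den {}) f"])
          (auto simp: cech_cochains_def index_0)
    qed
    ultimately show ?thesis using d by (auto simp: image_iff) metis+
  qed
  finally show ?thesis .
qed

lemma cochain_of_add:
  assumes "f \<in> supported saturation" "g \<in> supported saturation"
  shows "cochain_of f \<oplus>\<^bsub>cech_cochains R xs 1\<^esub> cochain_of g = cochain_of (f + g)"
proof -
  have "fraction_of (den {j}) f \<oplus>\<^bsub>loc {j}\<^esub> fraction_of (den {j}) g = fraction_of (den {j}) (f + g)"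
    if j: "j < length gs" for j
    using saturation_denominator[OF assms(1) j] saturation_denominator[OF assms(2) j]
      fraction_of_add[OF multiplicative_den[of "{j}"]] j
    unfolding cech_localization_def by auto
  then show ?thesis
    by (auto simp: cech_cochains_def cochain_of_def index_1 fun_eq_iff)
qed

lemma cochain_of_smult:
  assumes "f \<in> supported saturation" "r \<in> supported S"
  shows "r \<odot>\<^bsub>cech_cochains R xs 1\<^esub> cochain_of f = cochain_of (r * f)"
proof -
  have "r \<odot>\<^bsub>loc {j}\<^esub> fraction_of (den {j}) f = fraction_of (den {j}) (r * f)"
    if j: "j < length gs" for j
    using saturation_denominator[OF assms(1) j] assms(2)
      fraction_of_smult[OF multiplicative_den[of "{j}"]] j
    unfolding cech_localization_def by auto
  then show ?thesis
    by (auto simp: cech_cochains_def cochain_of_def index_1 fun_eq_iff)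
qed

lemma cochain_of_inject:
  assumes "f \<in> supported saturation" "cochain_of f = cochain_of g"
  shows "f = g"
proof -
  obtain j where j: "j < length gs" using x_gs by (auto simp: in_set_conv_nth)
  obtain t where "t \<in> den {j}" "t * f \<in> supported S" using saturation_denominator[OF assms(1) j] by blast
  moreover have "fraction_of (den {j}) f = fraction_of (den {j}) g"
    using assms(2) cochain_of_singleton[OF j] by metis
  ultimately show ?thesis
    using fraction_of_inject[OF multiplicative_den[of "{j}"]] j by auto
qed

text \<open>The isomorphism of \<open>K[saturation] / K[S]\<close> with the first cohomology.\<close>

definition cohomology_class where
  "cohomology_class f = (\<lambda>b. cochain_of (b + f)) ` supported S"

abbreviation H1 where "H1 \<equiv> local_cohomology R xs 1"

lemma supported_saturation: "f \<in> supported S \<Longrightarrow> f \<in> supported saturation"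
  using supported_mono[OF S_subset_saturation] by blast

lemma supported_saturation_mult:
  assumes "r \<in> supported S" "f \<in> supported saturation"
  shows "r * f \<in> supported saturation"
  using assms saturation_add by (rule supported_mult)

lemma coset_eq:
  assumes "f \<in> supported saturation"
  shows "cech_coboundaries R xs 1 +>\<^bsub>(cech_cochains R xs 1)\<lparr>carrier := cech_cocycles R xs 1\<rparr>\<^esub> cochain_of f =
    cohomology_class f"
proof -
  have "cech_coboundaries R xs 1 +>\<^bsub>(cech_cochains R xs 1)\<lparr>carrier := cech_cocycles R xs 1\<rparr>\<^esub> cochain_of f =
    (\<lambda>b. cochain_of b \<oplus>\<^bsub>cech_cochains R xs 1\<^esub> cochain_of f) ` supported S"
    unfolding coboundaries_eq by (auto simp: a_r_coset_def r_coset_def simp del: One_nat_def)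
  also have "\<dots> = (\<lambda>b. cochain_of (b + f)) ` supported S"
    by (intro image_cong cochain_of_add supported_saturation assms refl)
  finally show ?thesis by (auto simp: cohomology_class_def)
qed

lemma class_eq_iff:
  assumes "f \<in> supported saturation" "g \<in> supported saturation"
  shows "cohomology_class f = cohomology_class g \<longleftrightarrow> f - g \<in> supported S"
proof
  assume eq: "cohomology_class f = cohomology_class g"
  have "cochain_of f \<in> cohomology_class f"
    unfolding cohomology_class_def by (rule image_eqI[of _ _ 0]) auto
  then have "cochain_of f \<in> cohomology_class g" using eq by simp
  then obtain b where b: "b \<in> supported S" "cochain_of f = cochain_of (b + g)"
    unfolding cohomology_class_def by blast
  then have "f = b + g" using cochain_of_inject[OF assms(1)] by blast
  then show "f - g \<in> supported S" using b by simp
next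
  have sub: "cohomology_class f \<subseteq> cohomology_class g" if "f - g \<in> supported S" for f g
    unfolding cohomology_class_def
  proof (rule image_subsetI)
    fix b :: "_ \<Rightarrow>\<^sub>0 'k" assume "b \<in> supported S"
    then have "b + (f - g) \<in> supported S" using that by auto
    then show "cochain_of (b + f) \<in> (\<lambda>b. cochain_of (b + g)) ` supported S"
      by (rule rev_image_eqI) (simp add: algebra_simps)
  qed
  assume fg: "f - g \<in> supported S"
  then have "g - f \<in> supported S" using supported_uminus[OF fg] by simp
  then show "cohomology_class f = cohomology_class g" using sub[OF fg] sub[of g f] by blast
qed

lemma carrier_H1: "carrier H1 = cohomology_class ` supported saturation"
proof -
  have "carrier H1 = (\<Union>c\<in>cech_cocycles R xs 1.
    {cech_coboundaries R xs 1 +>\<^bsub>(cech_cochains R xs 1)\<lparr>carrier := cech_cocycles R xs 1\<rparr>\<^esub> c})"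
    by (simp add: local_cohomology_def quotient_module_def A_RCOSETS_def' )
  also have "\<dots> = cohomology_class ` supported saturation"
    unfolding cocycles_eq using coset_eq by (auto simp del: One_nat_def simp: cocycles_eq)
  finally show ?thesis .
qed

lemma zero_H1: "\<zero>\<^bsub>H1\<^esub> = cohomology_class 0"
  unfolding local_cohomology_def quotient_module_def coboundaries_eq cohomology_class_def by simp

lemma add_H1:
  assumes "f \<in> supported saturation" "g \<in> supported saturation"
  shows "cohomology_class f \<oplus>\<^bsub>H1\<^esub> cohomology_class g = cohomology_class (f + g)"
proof -
  have sum: "cochain_of (b + f) \<oplus>\<^bsub>cech_cochains R xs 1\<^esub> cochain_of (b' + g) =
      cochain_of ((b + b') + (f + g))" if "b \<in> supported S" "b' \<in> supported S" for b b'
    using cochain_of_add[of "b + f" "b' + g"] that assms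
    by (simp add: supported_saturation supported_add ac_simps)
  show ?thesis
  proof (rule Set.set_eqI)
    fix z
    have "z \<in> cohomology_class f \<oplus>\<^bsub>H1\<^esub> cohomology_class g \<longleftrightarrow> (\<exists>b\<in>supported S. \<exists>b'\<in>supported S.
        z = cochain_of (b + f) \<oplus>\<^bsub>cech_cochains R xs 1\<^esub> cochain_of (b' + g))"
      by (simp add: local_cohomology_def quotient_module_def set_add_def set_mult_def cohomology_class_def)
    also have "\<dots> \<longleftrightarrow> (\<exists>b\<in>supported S. \<exists>b'\<in>supported S. z = cochain_of ((b + b') + (f + g)))"
      using sum by (intro bex_cong refl) simp
    also have "\<dots> \<longleftrightarrow> (\<exists>b\<in>supported S. z = cochain_of (b + (f + g)))"
    proof
      assume "\<exists>b\<in>supported S. z = cochain_of (b + (f + g))"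
      then obtain b where "b \<in> supported S" "z = cochain_of ((b + 0) + (f + g))" by auto
      then show "\<exists>b\<in>supported S. \<exists>b'\<in>supported S. z = cochain_of ((b + b') + (f + g))"
        using supported_0 by blast
    qed (use supported_add in blast)
    finally show "z \<in> cohomology_class f \<oplus>\<^bsub>H1\<^esub> cohomology_class g \<longleftrightarrow> z \<in> cohomology_class (f + g)"
      by (auto simp: cohomology_class_def)
  qed
qed

lemma smult_H1:
  assumes "f \<in> supported saturation" "r \<in> supported S"
  shows "r \<odot>\<^bsub>H1\<^esub> cohomology_class f = cohomology_class (r * f)"
proof -
  let ?M = "(cech_cochains R xs 1)\<lparr>carrier := cech_cocycles R xs 1\<rparr>"
  have const: "cech_coboundaries R xs 1 +>\<^bsub>?M\<^esub> (r \<odot>\<^bsub>?M\<^esub> x) = cohomology_class (r * f)"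
    if x: "x \<in> cohomology_class f" for x
  proof -
    obtain b where b: "b \<in> supported S" "x = cochain_of (b + f)"
      using x by (auto simp: cohomology_class_def)
    have bf: "b + f \<in> supported saturation"
      by (rule supported_add[OF supported_saturation[OF b(1)] assms(1)])
    have "r \<odot>\<^bsub>?M\<^esub> x = cochain_of (r * (b + f))"
      using cochain_of_smult[OF bf assms(2)] b(2) by simp
    then have "cech_coboundaries R xs 1 +>\<^bsub>?M\<^esub> (r \<odot>\<^bsub>?M\<^esub> x) = cohomology_class (r * (b + f))"
      using coset_eq[OF supported_saturation_mult[OF assms(2) bf]] by (simp only:)
    also have "\<dots> = cohomology_class (r * f)"
    proof (subst class_eq_iff)
      show "r * (b + f) - r * f \<in> supported S"
        using supported_S_mult[OF assms(2) b(1)] by (simp add: algebra_simps)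
    qed (intro supported_saturation_mult assms bf)+
    finally show ?thesis .
  qed
  have "r \<odot>\<^bsub>H1\<^esub> cohomology_class f =
    (\<Union>x\<in>cohomology_class f. cech_coboundaries R xs 1 +>\<^bsub>?M\<^esub> (r \<odot>\<^bsub>?M\<^esub> x))"
    by (simp add: local_cohomology_def quotient_module_def)
  also have "\<dots> = cohomology_class (r * f)"
  proof (rule UN_constant_eq)
    show "cochain_of (0 + f) \<in> cohomology_class f"
      unfolding cohomology_class_def by (rule imageI) simp
  qed (use const in blast)
  finally show ?thesis .
qed

end

section \<open>Structure of the first cohomology\<close>

context plane_cech
begin

abbreviation gaps where "gaps \<equiv> saturation - S"

text \<open>Both sides decompose into terms: the ideal contains the nonconstant monomials of
  \<open>R\<close> and only polynomials without constant term, and a monomial kills the class of a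
  gap exactly when the sum of the exponents is in \<open>S\<close>. This is the combinatorial form
  of the Buchsbaum condition.\<close>

lemma annihilated_iff:
  "(\<forall>x\<in>Idl\<^bsub>R\<^esub> (monomial ` (S - {0})). \<forall>y\<in>carrier H1. x \<odot>\<^bsub>H1\<^esub> y = \<zero>\<^bsub>H1\<^esub>) \<longleftrightarrow>
    (\<forall>s\<in>S - {0}. \<forall>w\<in>gaps. s + w \<in> S)"
proof
  assume *: "\<forall>x\<in>Idl\<^bsub>R\<^esub> (monomial ` (S - {0})). \<forall>y\<in>carrier H1. x \<odot>\<^bsub>H1\<^esub> y = \<zero>\<^bsub>H1\<^esub>"
  show "\<forall>s\<in>S - {0}. \<forall>w\<in>gaps. s + w \<in> S"
  proof (intro ballI)
    fix s w assume s: "s \<in> S - {0}" and w: "w \<in> gaps"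
    have "monomial ` (S - {0}) \<subseteq> carrier R" by auto
    then have "monomial s \<in> Idl\<^bsub>R\<^esub> (monomial ` (S - {0}))"
      using ring.genideal_self[OF ring_R] s by blast
    moreover have w_sat: "monomial w \<in> (supported saturation :: (_ \<Rightarrow>\<^sub>0 'k) set)" using w by simp
    then have "cohomology_class (monomial w) \<in> carrier H1" unfolding carrier_H1 by (rule imageI)
    ultimately have "monomial s \<odot>\<^bsub>H1\<^esub> cohomology_class (monomial w) = cohomology_class 0"
      using * zero_H1 by simp
    moreover have s_S: "monomial s \<in> (supported S :: (_ \<Rightarrow>\<^sub>0 'k) set)" using s by simp
    ultimately have "cohomology_class (monomial s * monomial w) = cohomology_class 0"
      using smult_H1[OF w_sat s_S] by simp
    then have "monomial s * monomial w - 0 \<in> (supported S :: (_ \<Rightarrow>\<^sub>0 'k) set)"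
      by (subst (asm) class_eq_iff) (use supported_saturation_mult[OF s_S w_sat] in auto)
    then show "s + w \<in> S" by (simp add: monomial_mult supported_single_iff)
  qed
next
  assume *: "\<forall>s\<in>S - {0}. \<forall>w\<in>gaps. s + w \<in> S"
  have sub: "Idl\<^bsub>R\<^esub> (monomial ` (S - {0})) \<subseteq> supported (S - {0})"
    by (rule ring.genideal_minimal[OF ring_R maximal_ideal(1)[OF maximal_supported]])
      (intro image_subsetI supported_single)
  show "\<forall>x\<in>Idl\<^bsub>R\<^esub> (monomial ` (S - {0})). \<forall>y\<in>carrier H1. x \<odot>\<^bsub>H1\<^esub> y = \<zero>\<^bsub>H1\<^esub>"
  proof (intro ballI)
    fix x y assume x: "x \<in> Idl\<^bsub>R\<^esub> (monomial ` (S - {0}))" and "y \<in> carrier H1"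
    then obtain f where f: "y = cohomology_class f" "f \<in> supported saturation"
      unfolding carrier_H1 by blast
    have x_m: "x \<in> supported (S - {0})" using x sub by blast
    then have xS: "x \<in> supported S" using supported_mono[of "S - {0}" S] by blast
    have "x * f \<in> supported S"
    proof (rule supported_mult[OF x_m f(2)])
      fix s t assume "s \<in> S - {0}" "t \<in> saturation"
      then show "s + t \<in> S" using * add_S[of s t] by blast
    qed
    then have "cohomology_class (x * f) = cohomology_class 0"
      by (subst class_eq_iff) (auto intro: supported_saturation)
    then show "x \<odot>\<^bsub>H1\<^esub> y = \<zero>\<^bsub>H1\<^esub>" using smult_H1[OF f(2) xS] f(1) zero_H1 by simp
  qed
qed

text \<open>A \<open>K\<close>-linear projection whose kernel, on polynomials supported in the
  saturation, is \<open>K[S]\<close>; hence a normal form for cohomology classes. The sum makes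
  sense because of \<open>finite_gaps\<close>.\<close>

definition gap_part :: "'k plane_poly \<Rightarrow> 'k plane_poly" where
  "gap_part f = (\<Sum>w\<in>gaps. single w (lookup f w))"

lemma lookup_gap_part:
  "lookup (gap_part f) w = (if w \<in> gaps then lookup f w else 0)"
  using finite_gaps by (simp add: gap_part_def lookup_sum lookup_single when_def)

lemma gap_part_supported: "gap_part f \<in> supported gaps"
  by (auto simp: supported_def in_keys_iff lookup_gap_part split: if_splits)

lemma gap_part_add: "gap_part (f + g) = gap_part f + gap_part g"
  by (rule poly_mapping_eqI) (simp add: lookup_gap_part lookup_add)

lemma gap_part_scale: "gap_part (single 0 c * f) = single 0 c * gap_part f"
proof (rule poly_mapping_eqI)
  fix w
  show "lookup (gap_part (single 0 c * f)) w =
    lookup (single 0 c * gap_part f) w"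
    using lookup_single_mult[of 0 c f w] lookup_single_mult[of 0 c "gap_part f" w]
    by (simp add: lookup_gap_part)
qed

lemma gap_part_sum: "gap_part (sum F A) = (\<Sum>i\<in>A. gap_part (F i))"
proof (induction A rule: infinite_finite_induct)
  case (infinite A)
  then show ?case by (simp add: gap_part_def)
next
  case empty
  then show ?case by (simp add: gap_part_def)
qed (simp add: gap_part_add)

lemma gap_part_id: "f \<in> supported gaps \<Longrightarrow> gap_part f = f"
  by (rule poly_mapping_eqI) (auto simp: lookup_gap_part supported_def in_keys_iff)

lemma gap_part_eq_0_iff: "f \<in> supported saturation \<Longrightarrow> gap_part f = 0 \<longleftrightarrow> f \<in> supported S"
  by (auto simp: poly_mapping_eq_iff fun_eq_iff lookup_gap_part supported_def in_keys_iff)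

lemma gap_part_eq_iff:
  assumes "f \<in> supported saturation" "g \<in> supported saturation"
  shows "gap_part f = gap_part g \<longleftrightarrow> cohomology_class f = cohomology_class g"
proof -
  have "gap_part f = gap_part (f - g) + gap_part g" by (simp flip: gap_part_add)
  then have "gap_part f = gap_part g \<longleftrightarrow> gap_part (f - g) = 0" by simp
  then show ?thesis
    using gap_part_eq_0_iff[OF supported_diff[OF assms]] class_eq_iff[OF assms] by simp
qed

lemma supported_gaps_saturation: "f \<in> supported gaps \<Longrightarrow> f \<in> supported saturation"
  using supported_mono[of gaps saturation] by blast

lemma H1_vector_space:
  "modules_isomorphic (coefficient_field :: 'k ring) (as_vector_space H1)
    (sum_of_lines gaps :: ('k, 'k plane_poly) module)"
proof -
  let ?L = "sum_of_lines gaps :: ('k, 'k plane_poly) module"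
  \<comment> \<open>The chosen representative is immaterial, since \<open>gap_part\<close> depends
    only on the class by \<open>gap_part_eq_iff\<close>.\<close>
  define \<phi> where "\<phi> X = gap_part (SOME f. f \<in> supported saturation \<and> X = cohomology_class f)" for X
  have \<phi>: "\<phi> (cohomology_class f) = gap_part f" if "f \<in> supported saturation" for f
  proof -
    let ?P = "\<lambda>g. g \<in> supported saturation \<and> cohomology_class f = cohomology_class g"
    define g where "g = (SOME g. ?P g)"
    have "?P g" unfolding g_def by (rule someI[of ?P f]) (use that in simp)
    then have "gap_part f = gap_part g" using gap_part_eq_iff[OF that] by simp
    then show ?thesis by (simp add: \<phi>_def g_def)
  qed
  have carr: "carrier (as_vector_space H1) = cohomology_class ` supported saturation"
    unfolding carrier_H1[symmetric] by (simp add: as_vector_space_def restrict_scalars_def)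
  have L: "carrier ?L = supported gaps" by (simp add: sum_of_lines_def supported_def)
  have hom: "\<phi> \<in> hom (add_monoid (as_vector_space H1)) (add_monoid ?L)"
  proof (rule homI)
    fix X assume "X \<in> carrier (add_monoid (as_vector_space H1))"
    then obtain f where f: "X = cohomology_class f" "f \<in> supported saturation" using carr by auto
    then show "\<phi> X \<in> carrier (add_monoid ?L)" using \<phi> L gap_part_supported by simp
    fix Y assume "Y \<in> carrier (add_monoid (as_vector_space H1))"
    then obtain g where g: "Y = cohomology_class g" "g \<in> supported saturation" using carr by auto
    have "X \<otimes>\<^bsub>add_monoid (as_vector_space H1)\<^esub> Y = cohomology_class (f + g)"
      using add_H1[OF f(2) g(2)] f(1) g(1) by (simp add: as_vector_space_def restrict_scalars_def)
    then show "\<phi> (X \<otimes>\<^bsub>add_monoid (as_vector_space H1)\<^esub> Y) = \<phi> X \<otimes>\<^bsub>add_monoid ?L\<^esub> \<phi> Y"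
      using f g \<phi> \<phi>[OF supported_add[OF f(2) g(2)]] by (simp add: gap_part_add sum_of_lines_def)
  qed
  have inj: "inj_on \<phi> (cohomology_class ` supported saturation)"
    using \<phi> gap_part_eq_iff by (auto intro!: inj_onI)
  have img: "\<phi> ` (cohomology_class ` supported saturation) = supported gaps"
  proof
    show "supported gaps \<subseteq> \<phi> ` (cohomology_class ` supported saturation)"
    proof
      fix f :: "_ \<Rightarrow>\<^sub>0 'k" assume f: "f \<in> supported gaps"
      then have "f = \<phi> (cohomology_class f)"
        using \<phi>[OF supported_gaps_saturation[OF f]] gap_part_id by simp
      then show "f \<in> \<phi> ` (cohomology_class ` supported saturation)"
        using supported_gaps_saturation[OF f] by blast
    qed
  qed (use \<phi> gap_part_supported in auto)
  have "\<phi> \<in> iso (add_monoid (as_vector_space H1)) (add_monoid ?L)"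
    using hom inj img carr L by (simp add: iso_def bij_betw_def)
  moreover have "\<phi> (c \<odot>\<^bsub>as_vector_space H1\<^esub> X) = c \<odot>\<^bsub>?L\<^esub> \<phi> X"
    if X: "X \<in> carrier (as_vector_space H1)" for c X
  proof -
    obtain f where f: "X = cohomology_class f" "f \<in> supported saturation"
      using X unfolding carr by blast
    have "c \<odot>\<^bsub>as_vector_space H1\<^esub> X = cohomology_class (single 0 c * f)"
      using smult_H1[OF f(2) supported_S_const] f(1)
      by (simp add: as_vector_space_def restrict_scalars_def)
    moreover have "single 0 c * f \<in> supported saturation"
      by (rule supported_saturation_mult[OF supported_S_const f(2)])
    ultimately show ?thesis
      using \<phi> f by (simp add: gap_part_scale sum_of_lines_def mult_map_scale_conv_mult)
  qed
  ultimately show ?thesis unfolding modules_isomorphic_def by blast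
qed

lemma abelian_group_H1: "abelian_group H1"
proof (rule abelian_groupI)
  show "\<zero>\<^bsub>H1\<^esub> \<in> carrier H1" unfolding carrier_H1 zero_H1 by (rule imageI) simp
  fix X assume "X \<in> carrier H1"
  then obtain f where f: "X = cohomology_class f" "f \<in> supported saturation" unfolding carrier_H1 by blast
  show "\<zero>\<^bsub>H1\<^esub> \<oplus>\<^bsub>H1\<^esub> X = X" unfolding f(1) zero_H1 add_H1[OF supported_0 f(2)] by simp
  have "cohomology_class (- f) \<oplus>\<^bsub>H1\<^esub> X = \<zero>\<^bsub>H1\<^esub>"
    unfolding f(1) zero_H1 add_H1[OF supported_uminus[OF f(2)] f(2)] by simp
  moreover have "cohomology_class (- f) \<in> carrier H1"
    unfolding carrier_H1 by (rule imageI[OF supported_uminus[OF f(2)]])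
  ultimately show "\<exists>Y\<in>carrier H1. Y \<oplus>\<^bsub>H1\<^esub> X = \<zero>\<^bsub>H1\<^esub>" by blast
  fix Y assume "Y \<in> carrier H1"
  then obtain g where g: "Y = cohomology_class g" "g \<in> supported saturation" unfolding carrier_H1 by blast
  show "X \<oplus>\<^bsub>H1\<^esub> Y \<in> carrier H1"
    unfolding f(1) g(1) add_H1[OF f(2) g(2)] carrier_H1 by (rule imageI[OF supported_add[OF f(2) g(2)]])
  show "X \<oplus>\<^bsub>H1\<^esub> Y = Y \<oplus>\<^bsub>H1\<^esub> X"
    unfolding f(1) g(1) add_H1[OF f(2) g(2)] add_H1[OF g(2) f(2)] by (simp add: add.commute)
  fix Z assume "Z \<in> carrier H1"
  then obtain h where h: "Z = cohomology_class h" "h \<in> supported saturation" unfolding carrier_H1 by blast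
  show "X \<oplus>\<^bsub>H1\<^esub> Y \<oplus>\<^bsub>H1\<^esub> Z = X \<oplus>\<^bsub>H1\<^esub> (Y \<oplus>\<^bsub>H1\<^esub> Z)"
    unfolding f(1) g(1) h(1) add_H1[OF f(2) g(2)] add_H1[OF g(2) h(2)]
      add_H1[OF supported_add[OF f(2) g(2)] h(2)] add_H1[OF f(2) supported_add[OF g(2) h(2)]]
    by (simp add: add.assoc)
qed

section \<open>Submodules of the first cohomology and its length\<close>

lemma submodule_classes:
  assumes M: "M \<subseteq> supported saturation" "0 \<in> M"
    and add: "\<And>f g. f \<in> M \<Longrightarrow> g \<in> M \<Longrightarrow> f + g \<in> M"
    and mult: "\<And>r f. r \<in> supported S \<Longrightarrow> f \<in> M \<Longrightarrow> r * f \<in> M"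
  shows "submodule (cohomology_class ` M) R H1"
proof -
  have Msat: "f \<in> supported saturation" if "f \<in> M" for f using that M(1) by blast
  have minus: "- f \<in> M" if "f \<in> M" for f
    using mult[OF supported_uminus[OF supported_S_1] that] by simp
  have "subgroup (cohomology_class ` M) (add_monoid H1)"
  proof (rule group.subgroupI[OF abelian_group.a_group[OF abelian_group_H1]])
    show "cohomology_class ` M \<subseteq> carrier (add_monoid H1)" using M(1) carrier_H1 by auto
    show "cohomology_class ` M \<noteq> {}" using M(2) by blast
    fix X assume "X \<in> cohomology_class ` M"
    then obtain f where f: "X = cohomology_class f" "f \<in> M" by blast
    have "\<ominus>\<^bsub>H1\<^esub> X = cohomology_class (- f)"
    proof (rule abelian_group.minus_equality[OF abelian_group_H1])
      show "cohomology_class (- f) \<oplus>\<^bsub>H1\<^esub> X = \<zero>\<^bsub>H1\<^esub>"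
        unfolding f(1) zero_H1 add_H1[OF Msat[OF minus[OF f(2)]] Msat[OF f(2)]] by simp
    qed (use f Msat minus carrier_H1 in auto)
    then show "inv\<^bsub>add_monoid H1\<^esub> X \<in> cohomology_class ` M"
      using minus[OF f(2)] by (simp add: a_inv_def)
    fix Y assume "Y \<in> cohomology_class ` M"
    then obtain g where g: "Y = cohomology_class g" "g \<in> M" by blast
    then show "X \<otimes>\<^bsub>add_monoid H1\<^esub> Y \<in> cohomology_class ` M"
      using f add_H1[OF Msat Msat] add by auto
  qed
  moreover have "r \<odot>\<^bsub>H1\<^esub> X \<in> cohomology_class ` M"
    if "r \<in> carrier R" "X \<in> cohomology_class ` M" for r X
    using that smult_H1[OF Msat] mult by auto
  ultimately show ?thesis by (simp add: submodule_def submodule_axioms_def)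
qed

text \<open>A submodule of the cohomology is pulled back to an \<open>R\<close>-module of
  polynomials containing \<open>K[S]\<close>, where linear combinations can be formed without
  cosets.\<close>

lemma submodule_preimage:
  assumes "submodule N R H1"
  defines "M \<equiv> {f \<in> supported saturation. cohomology_class f \<in> N}"
  shows "f \<in> supported S \<Longrightarrow> f \<in> M"
    and "f \<in> M \<Longrightarrow> g \<in> M \<Longrightarrow> f + g \<in> M"
    and "r \<in> supported S \<Longrightarrow> f \<in> M \<Longrightarrow> r * f \<in> M"
proof -
  interpret submodule N R H1 by fact
  have zero: "cohomology_class 0 \<in> N" using one_closed zero_H1 by simp
  show "f \<in> M" if "f \<in> supported S"
  proof -
    have "cohomology_class f = cohomology_class 0"
      using that by (subst class_eq_iff) (auto intro: supported_saturation)
    then show ?thesis using zero supported_saturation[OF that] by (simp add: M_def)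
  qed
  show "f + g \<in> M" if "f \<in> M" "g \<in> M"
  proof -
    have sat: "f \<in> supported saturation" "g \<in> supported saturation" using that by (simp_all add: M_def)
    have "cohomology_class f \<oplus>\<^bsub>H1\<^esub> cohomology_class g \<in> N"
      using m_closed[of "cohomology_class f" "cohomology_class g"] that by (simp add: M_def)
    then show ?thesis using sat add_H1[OF sat] supported_add[OF sat] by (simp add: M_def)
  qed
  show "r * f \<in> M" if "r \<in> supported S" "f \<in> M"
  proof -
    have sat: "f \<in> supported saturation" using that by (simp add: M_def)
    have "r \<odot>\<^bsub>H1\<^esub> cohomology_class f \<in> N" using smult_closed that by (simp add: M_def)
    then show ?thesis
      using smult_H1[OF sat that(1)] supported_saturation_mult[OF that(1) sat] by (simp add: M_def)
  qed
qed

text \<open>Since \<open>R\<close> contains the scalars, a chain of submodules is a chain of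
  subspaces. With \<open>f i\<close> chosen in step \<open>i + 1\<close> outside step
  \<open>i\<close>, more steps than gaps force a linear relation among the normal forms; solving for
  the member \<open>f i\<close> of highest index places it in step \<open>i\<close>, a
  contradiction.\<close>

lemma module_length_le: "module_length R H1 \<le> enat (card gaps)"
  unfolding module_length_def
proof (rule Sup_least, safe)
  fix n and N :: "nat \<Rightarrow> (nat set \<Rightarrow> ('k plane_poly \<times> 'k plane_poly) set) set set"
  assume N: "\<forall>i\<le>n. submodule (N i) R H1" "\<forall>i<n. N i \<subset> N (Suc i)"
  show "enat n \<le> enat (card gaps)"
  proof (rule ccontr)
    assume "\<not> enat n \<le> enat (card gaps)"
    then have n: "card gaps < n" by simp
    define M where "M i = {f \<in> supported saturation. cohomology_class f \<in> N i}" for i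
    have "\<exists>f. f \<in> M (Suc i) \<and> f \<notin> M i" if i: "i < n" for i
    proof -
      obtain X where X: "X \<in> N (Suc i)" "X \<notin> N i" using N(2) i by blast
      have "submodule (N (Suc i)) R H1" using N(1) i by simp
      then have "N (Suc i) \<subseteq> carrier H1"
        using subgroup.subset[of "N (Suc i)" "add_monoid H1"] by (simp add: submodule_def)
      then obtain f where "X = cohomology_class f" "f \<in> supported saturation"
        using X(1) carrier_H1 by blast
      then show ?thesis using X by (auto simp: M_def)
    qed
    then obtain f where f: "\<And>i. i < n \<Longrightarrow> f i \<in> M (Suc i) \<and> f i \<notin> M i" by metis
    note closed = submodule_preimage[OF N(1)[rule_format], folded M_def]
    have mono: "M i \<subseteq> M j" if "i \<le> j" "j \<le> n" for i j
      using that
    proof (induction j)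
      case (Suc j)
      then have "N j \<subseteq> N (Suc j)" using N(2)[rule_format, of j] by (simp add: psubset_imp_subset)
      then have "M j \<subseteq> M (Suc j)" by (auto simp: M_def)
      then show ?case using Suc by (cases "i = Suc j") auto
    qed simp
    have "gap_part (f i) \<in> supported gaps" for i by (rule gap_part_supported)
    then obtain q where q: "\<exists>i\<in>{..<n}. q i \<noteq> 0"
      "(\<Sum>i<n. single 0 (q i) * gap_part (f i)) = 0"
      using linear_dependence[OF finite_gaps, of "{..<n}" "\<lambda>i. gap_part (f i)"] n by auto
    define i where "i = Max {i\<in>{..<n}. q i \<noteq> 0}"
    have "i \<in> {i\<in>{..<n}. q i \<noteq> 0}" unfolding i_def by (rule Max_in) (use q(1) in auto)
    then have i: "i < n" "q i \<noteq> 0" by auto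
    have q0: "q j = 0" if "j < n" "i < j" for j
    proof (rule ccontr)
      assume "q j \<noteq> 0"
      then have "j \<le> i" unfolding i_def by (intro Max_ge) (use that(1) in auto)
      then show False using that(2) by simp
    qed
    have fsat: "f j \<in> supported saturation" if "j < n" for j using f[OF that] by (simp add: M_def)
    let ?t = "\<lambda>j. single 0 (q j) * f j"
    have "gap_part (\<Sum>j<n. ?t j) = 0" using q(2) by (simp add: gap_part_sum gap_part_scale)
    moreover have "(\<Sum>j<n. ?t j) \<in> supported saturation"
      by (intro supported_sum supported_saturation_mult supported_S_const fsat) simp
    ultimately have "(\<Sum>j<n. ?t j) \<in> supported S" using gap_part_eq_0_iff by blast
    moreover have "(\<Sum>j<n. ?t j) = (\<Sum>j<Suc i. ?t j)"
      using i(1) q0 by (intro sum.mono_neutral_right) auto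
    ultimately have total: "(\<Sum>j<i. ?t j) + ?t i \<in> M i" using closed(1)[of i] i(1) by simp
    have in_M: "f j \<in> M i" if "j < i" for j
      using f[of j] mono[of "Suc j" i] that i(1) by auto
    have "(\<Sum>j<i. - ?t j) \<in> M i"
    proof -
      have "(\<Sum>j\<in>A. - ?t j) \<in> M i" if "A \<subseteq> {..<i}" for A
        using finite_subset[OF that finite_lessThan] that
      proof (induction A)
        case empty
        then show ?case using closed(1)[of i 0] i(1) by simp
      next
        case (insert j A)
        have "- ?t j = single 0 (- q j) * f j"
          by (simp add: single_uminus)
        then have t: "- ?t j \<in> M i" using closed(3)[of i _ "f j"] in_M[of j] insert.prems i(1) by simp
        have "(\<Sum>j\<in>A. - ?t j) \<in> M i" using insert by simp
        from closed(2)[OF less_imp_le[OF i(1)] t this] show ?case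
          unfolding sum.insert[OF insert.hyps] .
      qed
      then show ?thesis by blast
    qed
    then have "(\<Sum>j<i. ?t j) + ?t i + (\<Sum>j<i. - ?t j) \<in> M i"
      using closed(2)[of i] total i(1) by simp
    then have "?t i \<in> M i" by (simp add: sum_negf)
    then have "single 0 (inverse (q i)) * ?t i \<in> M i"
      using closed(3)[of i] i(1) by simp
    moreover have "single 0 (inverse (q i)) * ?t i = f i"
      using i(2) by (simp add: mult_single flip: mult.assoc)
    ultimately show False using f[OF i(1)] by simp
  qed
qed

text \<open>Adding a nonzero element of \<open>S\<close> to a gap raises it, so if the gaps are
  adjoined to \<open>S\<close> from the largest down, each intermediate set is stable under
  \<open>S\<close>. This gives a chain with one step per gap.\<close>

lemma module_length_ge: "enat (card gaps) \<le> module_length R H1"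
proof -
  \<comment> \<open>The number of larger gaps: the largest gap has rank \<open>0\<close> and enters
    first.\<close>
  define rank where "rank w = card {v \<in> gaps. w < v}" for w
  have fin: "finite {v \<in> gaps. w < v}" for w
    by (rule finite_subset[OF _ finite_gaps]) blast
  have rank_less: "rank v < rank w" if "w < v" "v \<in> gaps" for v w
    unfolding rank_def using that by (intro psubset_card_mono fin) auto
  have "inj_on rank gaps"
    by (rule linorder_inj_onI') (metis less_irrefl rank_less)
  moreover have "rank ` gaps \<subseteq> {..<card gaps}"
    unfolding rank_def using finite_gaps by (auto intro!: psubset_card_mono)
  ultimately have rank_onto: "rank ` gaps = {..<card gaps}"
    by (intro card_subset_eq) (auto simp: card_image)
  define U where "U i = S \<union> {w \<in> gaps. rank w < i}" for i
  define N where "N i = cohomology_class ` supported (U i)" for i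
  have U_sat: "U i \<subseteq> saturation" for i using S_subset_saturation by (auto simp: U_def)
  have U_add: "s + u \<in> U i" if "s \<in> S" "u \<in> U i" for s u i
  proof (cases "s + u \<in> S \<or> s = 0")
    case True
    then show ?thesis using that(2) by (auto simp: U_def)
  next
    case False
    then have "u \<notin> S" using add_S[OF that(1)] by blast
    then have u: "u \<in> gaps" "rank u < i" using that(2) by (auto simp: U_def)
    have gap: "s + u \<in> gaps" using False saturation_add[OF _ that(1), of u] u(1) by auto
    have "u < s + u" using False by (cases s; cases u) (auto simp: less_prod_def' zero_prod_def)
    then show ?thesis using rank_less[OF _ gap, of u] u(2) gap by (auto simp: U_def)
  qed
  have "submodule (N i) R H1" for i
    unfolding N_def
    by (rule submodule_classes) (use supported_mono[OF U_sat] supported_mult[OF _ _ U_add] in auto)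
  moreover have "N i \<subset> N (Suc i)" if "i < card gaps" for i
  proof -
    obtain w where w: "w \<in> gaps" "rank w = i" using rank_onto \<open>i < card gaps\<close> by (metis imageE lessThan_iff)
    have "N i \<subseteq> N (Suc i)"
      unfolding N_def by (intro image_mono supported_mono) (auto simp: U_def)
    moreover have "cohomology_class (monomial w) \<in> N (Suc i)"
      unfolding N_def using w by (intro imageI) (simp add: U_def)
    moreover have "cohomology_class (monomial w) \<notin> N i"
    proof
      assume "cohomology_class (monomial w) \<in> N i"
      then obtain f where f: "f \<in> supported (U i)" "cohomology_class (monomial w) = cohomology_class f"
        unfolding N_def by blast
      have "monomial w - f \<in> supported S"
        using f supported_mono[OF U_sat] w(1) by (subst (asm) class_eq_iff) auto
      then have "lookup (monomial w - f) w = 0"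
        using w(1) by (auto simp: supported_def in_keys_iff)
      moreover have "w \<notin> U i" using w by (simp add: U_def)
      then have "lookup f w = 0" using f(1) by (auto simp: supported_def in_keys_iff)
      ultimately show False by (simp add: lookup_minus)
    qed
    ultimately show ?thesis by blast
  qed
  ultimately show ?thesis
    unfolding module_length_def by (intro Sup_upper) blast
qed

lemma module_length_H1: "module_length R H1 = enat (card gaps)"
  using module_length_le module_length_ge by (rule antisym)

end

section \<open>Monoids of projective monomial curves\<close>

lemma
  fixes X :: "'a::comm_monoid_add set"
  shows add_submonoid_0: "0 \<in> add_submonoid X"
    and add_submonoid_add: "s \<in> add_submonoid X \<Longrightarrow> t \<in> add_submonoid X \<Longrightarrow> s + t \<in> add_submonoid X"
    and add_submonoid_generator: "x \<in> X \<Longrightarrow> x \<in> add_submonoid X"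
  by (auto simp: add_submonoid_def submonoid_generated_def submonoid_def)

lemma add_submonoid_induct [consumes 1, case_names zero generator add]:
  assumes "s \<in> add_submonoid X"
    and "Q 0" and "\<And>x. x \<in> X \<Longrightarrow> Q x"
    and "\<And>s t. s \<in> add_submonoid X \<Longrightarrow> t \<in> add_submonoid X \<Longrightarrow> Q s \<Longrightarrow> Q t \<Longrightarrow> Q (s + t)"
  shows "Q s"
proof -
  have "submonoid {s \<in> add_submonoid X. Q s} \<lparr>carrier = UNIV, mult = (+), one = 0\<rparr>"
    using assms(2,4) add_submonoid_0 add_submonoid_add by (auto simp: submonoid_def)
  moreover have "X \<subseteq> {s \<in> add_submonoid X. Q s}"
    using assms(3) add_submonoid_generator by blast
  ultimately have "add_submonoid X \<subseteq> {s \<in> add_submonoid X. Q s}"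
    unfolding add_submonoid_def[of X] submonoid_generated_def by (intro Inter_lower) auto
  then show ?thesis using assms(1) by blast
qed

lemma add_submonoid_sum:
  "(\<And>i. i \<in> J \<Longrightarrow> f i \<in> add_submonoid X) \<Longrightarrow> sum f J \<in> add_submonoid X"
  by (induction J rule: infinite_finite_induct) (auto intro: add_submonoid_0 add_submonoid_add)

text \<open>Abstracts from the degrees \<open>a i\<close> so that \<open>reflect\<close> yields a
  second instance for the complementary degrees; statements about first coordinates then have
  counterparts for second coordinates.\<close>

locale degree_set =
  fixes A :: "nat set" and d :: nat
  assumes A_le: "A \<subseteq> {..d}" and zero_A: "0 \<in> A" and d_A: "d \<in> A" and d_pos: "d > 0"
    and Gcd_A: "Gcd A = 1"
begin

lemma finite_A: "finite A"
  using A_le finite_subset by blast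

lemma reflect: "degree_set ((\<lambda>h. d - h) ` A) d"
proof
  have "Gcd ((\<lambda>h. d - h) ` A) dvd h" if h: "h \<in> A" for h
  proof -
    have "Gcd ((\<lambda>h. d - h) ` A) dvd d - h" "Gcd ((\<lambda>h. d - h) ` A) dvd d - 0"
      using h zero_A by (intro Gcd_dvd imageI; simp)+
    moreover have "h \<le> d" using h A_le by auto
    ultimately show ?thesis by (metis diff_diff_cancel diff_zero dvd_diff_nat)
  qed
  then have "Gcd ((\<lambda>h. d - h) ` A) dvd Gcd A" by (rule Gcd_greatest)
  then show "Gcd ((\<lambda>h. d - h) ` A) = 1" using Gcd_A by simp
  show "0 \<in> (\<lambda>h. d - h) ` A" using d_A by (intro image_eqI[of _ _ d]) auto
  show "d \<in> (\<lambda>h. d - h) ` A" using zero_A by (intro image_eqI[of _ _ 0]) auto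
qed (use d_pos in auto)

lemma reflect_reflect: "(\<lambda>h. d - h) ` (\<lambda>h. d - h) ` A = A"
  using A_le by (force simp: image_image)

lemma multiple_mem:
  assumes "n \<in> add_submonoid A"
  shows "m * n \<in> add_submonoid A"
  by (induction m) (auto intro: add_submonoid_0 add_submonoid_add assms)

lemma representation:
  assumes "n \<in> add_submonoid A"
  shows "\<exists>x. n = (\<Sum>b\<in>A - {0}. x b * b)"
  using assms
proof (induction rule: add_submonoid_induct)
  case zero
  then show ?case by (intro exI[of _ "\<lambda>_. 0"]) simp
next
  case (generator h)
  have "(\<Sum>b\<in>A - {0}. (if b = h then 1 else 0) * b) = (\<Sum>b\<in>A - {0}. if b = h then b else 0)"
    by (intro sum.cong) auto
  also have "\<dots> = h" using generator finite_A by simp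
  finally show ?case by metis
next
  case (add m n)
  then obtain x y where "m = (\<Sum>b\<in>A - {0}. x b * b)" "n = (\<Sum>b\<in>A - {0}. y b * b)" by blast
  then show ?case
    by (intro exI[of _ "\<lambda>b. x b + y b"]) (simp add: sum.distrib algebra_simps)
qed

text \<open>Modulo \<open>d\<close> the submonoid is a group, because \<open>(d - 1) * n\<close>
  represents \<open>- n\<close>. The least positive member \<open>g\<close> of \<open>M\<close>
  therefore divides all of \<open>A\<close>, so it is \<open>1\<close>.\<close>

lemma residue_exists: "\<exists>n\<in>add_submonoid A. n mod d = j mod d"
proof -
  define M where "M = {m. \<exists>n\<in>add_submonoid A. n mod d = m mod d}"
  have M_add: "m + n \<in> M" if "m \<in> M" "n \<in> M" for m n
    using that add_submonoid_add unfolding M_def by (blast intro: mod_add_cong)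
  have M_A: "h \<in> M" if "h \<in> A" for h
    using that add_submonoid_generator unfolding M_def by blast
  have M_mult: "c * m \<in> M" if "m \<in> M" for c m
    using that multiple_mem unfolding M_def by (blast intro: mod_mult_cong)
  have M_diff: "m - n \<in> M" if "m \<in> M" "n \<in> M" "n \<le> m" for m n
  proof -
    have "m + (d - 1) * n = (m - n) + d * n"
      using d_pos that(3) by (cases d) (auto simp: algebra_simps)
    then have "(m + (d - 1) * n) mod d = (m - n) mod d" by simp
    moreover have "m + (d - 1) * n \<in> M" using that M_add M_mult by blast
    ultimately show ?thesis unfolding M_def by auto
  qed
  define g where "g = (LEAST g. g \<in> M \<and> g > 0)"
  have g: "g \<in> M" "g > 0" using LeastI[of "\<lambda>g. g \<in> M \<and> g > 0" d] M_A[OF d_A] d_pos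
    by (auto simp: g_def)
  have "g dvd m" if "m \<in> M" for m
  proof -
    have "m mod g = m - (m div g) * g" by (simp add: minus_div_mult_eq_mod)
    then have "m mod g \<in> M" using M_diff[OF that M_mult[OF g(1)], of "m div g"] by simp
    moreover have "m mod g < g" using g(2) by simp
    ultimately have "m mod g = 0" using not_less_Least[of "m mod g" "\<lambda>g. g \<in> M \<and> g > 0"]
      by (auto simp: g_def)
    then show ?thesis by auto
  qed
  then have "g dvd Gcd A" using M_A by (intro Gcd_greatest) auto
  then have "g = 1" using Gcd_A by simp
  then have "j \<in> M" using M_mult[OF g(1), of j] by simp
  then show ?thesis by (simp add: M_def)
qed

text \<open>The convention at \<open>j = d\<close> agrees with the least element of residue class
  \<open>0\<close>, so one characterization covers all \<open>j \<le> d\<close>.\<close>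

lemma omega:
  assumes "j \<le> d"
  shows omega_mem: "omega d A j \<in> add_submonoid A"
    and omega_mod: "omega d A j mod d = j mod d"
    and omega_le: "\<And>n. n \<in> add_submonoid A \<Longrightarrow> n mod d = j mod d \<Longrightarrow> omega d A j \<le> n"
proof -
  let ?P = "\<lambda>n. n \<in> add_submonoid A \<and> n mod d = j mod d"
  have "\<exists>n. ?P n" using residue_exists by blast
  then have "?P (LEAST n. ?P n)" by (rule LeastI_ex)
  then show "omega d A j \<in> add_submonoid A" "omega d A j mod d = j mod d"
    using add_submonoid_0[of A] by (auto simp: omega_def)
  show "omega d A j \<le> n" if "n \<in> add_submonoid A" "n mod d = j mod d" for n
    using that by (auto simp: omega_def intro: Least_le)
qed

lemma omega_generator:
  assumes "h \<in> A" "h < d"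
  shows "omega d A h = h"
proof (rule antisym)
  show "omega d A h \<le> h"
    using assms by (intro omega_le add_submonoid_generator) auto
  have "h = omega d A h mod d" using omega_mod[of h] assms by simp
  then show "h \<le> omega d A h" by (metis mod_less_eq_dividend)
qed

section \<open>The monoid of the curve and the degree criterion for membership\<close>

definition cone :: "(nat \<times> nat) set" where
  "cone = add_submonoid (e_vec d ` A)"

text \<open>The generator \<open>(0, d)\<close> is invisible in the first coordinate and left out of
  the sum, so the multiplicities add up to at most the degree \<open>m\<close>.\<close>

lemma cone_representation:
  assumes "s \<in> cone"
  shows "\<exists>m x. fst s + snd s = m * d \<and> fst s = (\<Sum>b\<in>A - {0}. x b * b) \<and> (\<Sum>b\<in>A - {0}. x b) \<le> m"
  using assms unfolding cone_def
proof (induction rule: add_submonoid_induct)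
  case zero
  then show ?case by (intro exI[of _ 0] exI[of _ "\<lambda>_. 0"]) simp
next
  case (generator s)
  then obtain h where h: "h \<in> A" "s = (h, d - h)" by (auto simp: e_vec_def)
  have "(\<Sum>b\<in>A - {0}. (if b = h then 1 else 0) * b) = (\<Sum>b\<in>A - {0}. if b = h then b else 0)"
    by (intro sum.cong) auto
  also have "\<dots> = h" using h finite_A by simp
  finally have "fst s = (\<Sum>b\<in>A - {0}. (if b = h then 1 else 0) * b)" using h by simp
  moreover have "(\<Sum>b\<in>A - {0}. if b = h then 1 else 0) \<le> (1::nat)" using finite_A by simp
  moreover have "fst s + snd s = 1 * d" using h A_le by auto
  ultimately have *: "fst s + snd s = 1 * d \<and> fst s = (\<Sum>b\<in>A - {0}. (if b = h then 1 else 0) * b) \<and>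
      (\<Sum>b\<in>A - {0}. if b = h then 1 else 0) \<le> (1::nat)" by (intro conjI)
  show ?case
    by (rule exI[of _ 1], rule exI[of _ "\<lambda>b. if b = h then 1 else 0"], rule *)
next
  case (add s t)
  then obtain m x n y where
    "fst s + snd s = m * d" "fst s = (\<Sum>b\<in>A - {0}. x b * b)" "(\<Sum>b\<in>A - {0}. x b) \<le> m"
    "fst t + snd t = n * d" "fst t = (\<Sum>b\<in>A - {0}. y b * b)" "(\<Sum>b\<in>A - {0}. y b) \<le> n" by blast
  then show ?case
    by (intro exI[of _ "m + n"] exI[of _ "\<lambda>b. x b + y b"]) (auto simp: sum.distrib algebra_simps)
qed

lemma cone_multiple:
  assumes "h \<in> A"
  shows "(n * h, n * (d - h)) \<in> cone"
proof (induction n)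
  case 0
  then show ?case using add_submonoid_0[of "e_vec d ` A"] by (simp add: cone_def zero_prod_def)
next
  case (Suc n)
  have "(h, d - h) \<in> cone"
    unfolding cone_def using assms by (intro add_submonoid_generator) (auto simp: e_vec_def)
  then have "(h, d - h) + (n * h, n * (d - h)) \<in> cone"
    using Suc unfolding cone_def by (rule add_submonoid_add)
  then show ?case by simp
qed

lemma cone_mem:
  assumes "p + q = m * d" "p = (\<Sum>b\<in>A - {0}. x b * b)" "(\<Sum>b\<in>A - {0}. x b) \<le> m"
  shows "(p, q) \<in> cone"
proof -
  define n where "n = m - (\<Sum>b\<in>A - {0}. x b)"
  define s where "s = (\<Sum>b\<in>A - {0}. (x b * b, x b * (d - b))) + (n * 0, n * (d - 0))"
  have "s \<in> cone"
    unfolding s_def cone_def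
    by (intro add_submonoid_add add_submonoid_sum cone_multiple[unfolded cone_def]) (use zero_A in auto)
  moreover have "fst s = p" by (simp add: s_def fst_sum assms(2))
  moreover have "fst s + snd s = m * d"
  proof -
    have "fst s + snd s = (\<Sum>b\<in>A - {0}. x b * b + x b * (d - b)) + n * d"
      by (simp add: s_def fst_sum snd_sum sum.distrib)
    also have "(\<Sum>b\<in>A - {0}. x b * b + x b * (d - b)) = (\<Sum>b\<in>A - {0}. x b * d)"
      using A_le by (intro sum.cong) (auto simp flip: distrib_left)
    also have "\<dots> + n * d = ((\<Sum>b\<in>A - {0}. x b) + n) * d"
      by (simp add: sum_distrib_right distrib_right)
    finally show ?thesis using assms(3) by (simp add: n_def)
  qed
  ultimately show ?thesis using assms(1) by (metis add_left_cancel prod.collapse)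
qed

text \<open>Every generator has degree one, and \<open>(0, d)\<close> adds degree without changing
  the first coordinate. So a vector of degree \<open>m\<close> is in the cone exactly when its first
  coordinate is a sum of at most \<open>m\<close> nonzero elements of \<open>A\<close>.\<close>

lemma cone_iff_delta:
  assumes "p \<in> add_submonoid A" "p + q = m * d"
  shows "(p, q) \<in> cone \<longleftrightarrow> delta A p \<le> m"
proof -
  let ?P = "\<lambda>m. \<exists>x :: nat \<Rightarrow> nat. p = (\<Sum>b\<in>A - {0}. x b * b) \<and> m = (\<Sum>b\<in>A - {0}. x b)"
  have "\<exists>m. ?P m" using representation[OF assms(1)] by blast
  then have "?P (LEAST m. ?P m)" by (rule LeastI_ex)
  then obtain x where x: "p = (\<Sum>b\<in>A - {0}. x b * b)" "delta A p = (\<Sum>b\<in>A - {0}. x b)"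
    unfolding delta_def by blast
  show ?thesis
  proof
    assume "(p, q) \<in> cone"
    from cone_representation[OF this] obtain n y where
      y: "p + q = n * d" "p = (\<Sum>b\<in>A - {0}. y b * b)" "(\<Sum>b\<in>A - {0}. y b) \<le> n" by auto
    have "delta A p \<le> (\<Sum>b\<in>A - {0}. y b)"
      unfolding delta_def using y(2) by (intro Least_le) blast
    moreover have "n = m" using y(1) assms(2) d_pos by simp
    ultimately show "delta A p \<le> m" using y(3) by simp
  next
    assume "delta A p \<le> m"
    then show "(p, q) \<in> cone" using cone_mem[OF assms(2) x(1)] x(2) by simp
  qed
qed

lemma cone_fst_mem: "s \<in> cone \<Longrightarrow> fst s \<in> add_submonoid A"
  unfolding cone_def
proof (induction rule: add_submonoid_induct)
  case (generator x)
  then show ?case by (auto simp: e_vec_def intro: add_submonoid_generator)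
qed (auto intro: add_submonoid_0 add_submonoid_add)

lemma cone_swap:
  assumes "(p, q) \<in> cone"
  shows "(q, p) \<in> degree_set.cone ((\<lambda>h. d - h) ` A) d"
proof -
  interpret B: degree_set "(\<lambda>h. d - h) ` A" d by (rule reflect)
  have "prod.swap s \<in> B.cone" if "s \<in> cone" for s
    using that unfolding cone_def
  proof (induction rule: add_submonoid_induct)
    case zero
    have "0 \<in> B.cone" unfolding B.cone_def by (rule add_submonoid_0)
    then show ?case by (simp add: zero_prod_def)
  next
    case (generator s)
    then obtain h where "h \<in> A" "s = (h, d - h)" by (auto simp: e_vec_def)
    then have "prod.swap s = e_vec d (d - h)" "d - h \<in> (\<lambda>h. d - h) ` A"
      using A_le by (auto simp: e_vec_def)
    then have "prod.swap s \<in> e_vec d ` (\<lambda>h. d - h) ` A" by (metis imageI)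
    then show ?case unfolding B.cone_def by (rule add_submonoid_generator)
  next
    case (add s t)
    then have "prod.swap s + prod.swap t \<in> B.cone" unfolding B.cone_def by (intro add_submonoid_add)
    then show ?case by (simp add: plus_prod_def)
  qed
  from this[OF assms] show ?thesis by simp
qed

end

context degree_set
begin

interpretation B: degree_set "(\<lambda>h. d - h) ` A" d
  by (rule reflect)

lemma cone_swap_iff: "(p, q) \<in> cone \<longleftrightarrow> (q, p) \<in> B.cone"
  using cone_swap B.cone_swap reflect_reflect by metis

lemma plane_monoid_cone: "R = semigroup_ring cone \<Longrightarrow> plane_monoid cone d R"
proof
  show "0 \<in> cone" "s \<in> cone \<Longrightarrow> t \<in> cone \<Longrightarrow> s + t \<in> cone" for s t
    by (auto simp: cone_def intro: add_submonoid_0 add_submonoid_add)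
  show "(d, 0) \<in> cone" "(0, d) \<in> cone"
    using cone_multiple[OF d_A, of 1] cone_multiple[OF zero_A, of 1] by simp_all
qed (use d_pos in auto)

text \<open>Adding \<open>(0, d)\<close> raises the degree and keeps the first coordinate, so by
  \<open>cone_iff_delta\<close> it eventually reaches the cone as soon as the first coordinate lies
  in the submonoid of \<open>A\<close>; for \<open>(d, 0)\<close> the coordinates are
  exchanged.\<close>

lemma saturation_cone:
  assumes "plane_monoid cone d R"
  shows "w \<in> plane_monoid.saturation cone d \<longleftrightarrow>
    fst w \<in> add_submonoid A \<and> snd w \<in> add_submonoid ((\<lambda>h. d - h) ` A) \<and> d dvd fst w + snd w"
proof -
  interpret plane_monoid cone d R by fact
  obtain p q where w: "w = (p, q)" by (cases w)
  show ?thesis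
  proof
    assume "w \<in> saturation"
    then obtain m n where "(p + m * d, q) \<in> cone" "(p, q + n * d) \<in> cone"
      by (auto simp: saturation_def w)
    note * = this
    have "(q, p + m * d) \<in> B.cone" using *(1) cone_swap_iff by blast
    then have "q \<in> add_submonoid ((\<lambda>h. d - h) ` A)" using B.cone_fst_mem by fastforce
    moreover have "p \<in> add_submonoid A" using cone_fst_mem[OF *(2)] by simp
    moreover have "d dvd p + q"
    proof -
      obtain c where "p + (q + n * d) = c * d" using cone_representation[OF *(2)] by auto
      then have "d dvd (p + q) + n * d" by (simp add: add.assoc)
      then show ?thesis using dvd_add_left_iff[of d "n * d" "p + q"] by simp
    qed
    ultimately show "fst w \<in> add_submonoid A \<and> snd w \<in> add_submonoid ((\<lambda>h. d - h) ` A) \<and> d dvd fst w + snd w"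
      by (simp add: w)
  next
    assume "fst w \<in> add_submonoid A \<and> snd w \<in> add_submonoid ((\<lambda>h. d - h) ` A) \<and> d dvd fst w + snd w"
    then have *: "p \<in> add_submonoid A" "q \<in> add_submonoid ((\<lambda>h. d - h) ` A)" "d dvd p + q"
      by (simp_all add: w)
    then obtain c where c: "p + q = c * d" by (metis dvdE mult.commute)
    have "(p, q + delta A p * d) \<in> cone"
      using cone_iff_delta[OF *(1), of "q + delta A p * d" "c + delta A p"] c
      by (simp add: algebra_simps)
    moreover have "(q, p + delta ((\<lambda>h. d - h) ` A) q * d) \<in> B.cone"
      using B.cone_iff_delta[OF *(2), of "p + delta ((\<lambda>h. d - h) ` A) q * d" "c + delta ((\<lambda>h. d - h) ` A) q"] c
      by (simp add: algebra_simps)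
    then have "(p + delta ((\<lambda>h. d - h) ` A) q * d, q) \<in> cone" using cone_swap_iff by blast
    ultimately show "w \<in> saturation"
      unfolding saturation_def w by (auto intro: exI[of _ "delta A p"] exI[of _ "delta ((\<lambda>h. d - h) ` A) q"])
  qed
qed

text \<open>The vectors \<open>w\<^sub>j\<close> of the paper.\<close>

definition apery :: "nat \<Rightarrow> nat \<times> nat" where
  "apery j = (omega d A j, omega d ((\<lambda>h. d - h) ` A) (d - j))"

lemma apery_saturation:
  assumes "plane_monoid cone d R" "j < d"
  shows "apery j \<in> plane_monoid.saturation cone d"
proof -
  have "(omega d A j + omega d ((\<lambda>h. d - h) ` A) (d - j)) mod d = (j + (d - j)) mod d"
    using omega_mod[of j] B.omega_mod[of "d - j"] assms(2) by (intro mod_add_cong) auto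
  then have "d dvd omega d A j + omega d ((\<lambda>h. d - h) ` A) (d - j)"
    using assms(2) by (simp add: mod_eq_0_iff_dvd)
  then show ?thesis
    using saturation_cone[OF assms(1)] omega_mem[of j] B.omega_mem[of "d - j"] assms(2)
    by (simp add: apery_def)
qed

text \<open>Each coordinate exceeds the least element of its residue class by a multiple of
  \<open>d\<close>. As \<open>d\<close> divides the sum, the residue of the first coordinate forces
  that of the second, and both classes have the same index \<open>j\<close>.\<close>

lemma saturation_apery:
  assumes "plane_monoid cone d R" "s \<in> plane_monoid.saturation cone d"
  shows "\<exists>j<d. \<exists>m n. s = apery j + (m * d, n * d)"
proof -
  obtain p q where s: "s = (p, q)" by (cases s)
  have pq: "p \<in> add_submonoid A" "q \<in> add_submonoid ((\<lambda>h. d - h) ` A)" "d dvd p + q"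
    using saturation_cone[OF assms(1), of s] assms(2) by (simp_all add: s)
  define j where "j = p mod d"
  have j: "j < d" using d_pos by (simp add: j_def)
  have q_mod: "q mod d = (d - j) mod d"
  proof -
    \<comment> \<open>The residue of \<open>- p\<close> without negative numbers:
      \<open>p + (d - j)\<close> is a multiple of \<open>d\<close>, and adding it to
      \<open>q\<close> gives \<open>(p + q) + (d - j)\<close>.\<close>
    have "p = d * (p div d) + j" by (simp add: j_def)
    then have "p + (d - j) = d * (p div d) + d" using j by linarith
    then have "p + (d - j) = d * Suc (p div d)" by simp
    then have "q mod d = (q + (p + (d - j))) mod d" by (simp only: mod_mult_self2)
    also have "q + (p + (d - j)) = (p + q) + (d - j)" by simp
    also obtain c where "p + q = d * c" using pq(3) by (rule dvdE)
    then have "((p + q) + (d - j)) mod d = (d - j) mod d" by simp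
    finally show ?thesis .
  qed
  have "omega d A j \<le> p" using j pq(1) by (intro omega_le) (auto simp: j_def)
  moreover have "p mod d = omega d A j mod d" using omega_mod[of j] j by (simp add: j_def)
  ultimately obtain m where m: "p = omega d A j + d * m" using mod_eq_nat1E by metis
  have "omega d ((\<lambda>h. d - h) ` A) (d - j) \<le> q" using j pq(2) q_mod by (intro B.omega_le) auto
  moreover have "q mod d = omega d ((\<lambda>h. d - h) ` A) (d - j) mod d"
    using B.omega_mod[of "d - j"] q_mod by simp
  ultimately obtain n where n: "q = omega d ((\<lambda>h. d - h) ` A) (d - j) + d * n" using mod_eq_nat1E by metis
  show ?thesis
    using j m n by (intro exI[of _ j] conjI exI[of _ m] exI[of _ n]) (auto simp: apery_def s mult.commute)
qed

lemma apery_0: "apery 0 = 0"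
proof -
  have "omega d A 0 = 0" using omega_generator[OF zero_A d_pos] .
  moreover have "omega d ((\<lambda>h. d - h) ` A) d = 0" by (simp add: omega_def)
  ultimately show ?thesis by (simp add: apery_def zero_prod_def)
qed

lemma apery_generator:
  assumes "h \<in> A" "0 < h" "h < d"
  shows "apery h = e_vec d h"
  using omega_generator[OF assms(1,3)] B.omega_generator[of "d - h"] assms
  by (simp add: apery_def e_vec_def)

text \<open>A shift by \<open>(0, d)\<close> keeps the first coordinate and raises the degree by
  one, so the first coordinate measures it; a shift by \<open>(d, 0)\<close> is measured by the
  second coordinate. For \<open>w\<close> itself either one decides.\<close>

lemma cone_criteria:
  assumes "fst w \<in> add_submonoid A" "snd w \<in> add_submonoid ((\<lambda>h. d - h) ` A)" "fst w + snd w = m * d"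
  shows "w \<in> cone \<longleftrightarrow> delta A (fst w) \<le> m"
    and "w \<in> cone \<longleftrightarrow> delta ((\<lambda>h. d - h) ` A) (snd w) \<le> m"
    and "w + (0, d) \<in> cone \<longleftrightarrow> delta A (fst w) \<le> m + 1"
    and "w + (d, 0) \<in> cone \<longleftrightarrow> delta ((\<lambda>h. d - h) ` A) (snd w) \<le> m + 1"
proof -
  obtain p q where w: "w = (p, q)" by (cases w)
  have p: "p \<in> add_submonoid A" and q: "q \<in> add_submonoid ((\<lambda>h. d - h) ` A)" and pq: "p + q = m * d"
    using assms by (simp_all add: w)
  have "q + p = m * d" "p + (q + d) = (m + 1) * d" "q + (p + d) = (m + 1) * d" using pq by simp_all
  then show "w \<in> cone \<longleftrightarrow> delta A (fst w) \<le> m"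
    "w \<in> cone \<longleftrightarrow> delta ((\<lambda>h. d - h) ` A) (snd w) \<le> m"
    "w + (0, d) \<in> cone \<longleftrightarrow> delta A (fst w) \<le> m + 1"
    "w + (d, 0) \<in> cone \<longleftrightarrow> delta ((\<lambda>h. d - h) ` A) (snd w) \<le> m + 1"
    using cone_iff_delta[OF p pq] B.cone_iff_delta[OF q, of p m]
      cone_iff_delta[OF p, of "q + d" "m + 1"] B.cone_iff_delta[OF q, of "p + d" "m + 1"]
    by (simp_all add: w cone_swap_iff[of p q] cone_swap_iff[of "p + d" q])
qed

end

section \<open>The three statements for projective monomial curves\<close>

theorem theorem3p5:
  fixes a :: "nat \<Rightarrow> nat" and k d :: nat
    and R :: "((nat \<times> nat) \<Rightarrow>\<^sub>0 'k::field) ring"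
    and H :: "((nat \<times> nat) \<Rightarrow>\<^sub>0 'k,
               (nat set \<Rightarrow> (((nat \<times> nat) \<Rightarrow>\<^sub>0 'k) \<times> ((nat \<times> nat) \<Rightarrow>\<^sub>0 'k)) set) set) module"
    and I :: "nat set"
  assumes k: "k \<ge> 3"
    and a_0: "a 0 = 0"
    and a_increasing: "\<And>i j. i < j \<Longrightarrow> j \<le> k \<Longrightarrow> a i < a j"
    and a_k: "a k = d"
    and a_gcd: "Gcd (a ` {1..k}) = 1"
    and R: "R = semigroup_ring (curve_monoid a k)"
    and H: "H = curve_cohomology a k 1"
    and I: "I = {i. 1 \<le> i \<and> i \<le> d - 1 \<and> i \<notin> a ` {1..k - 1} \<and>
                    delta1 a k (w_vec a k i) > proj_degree d (w_vec a k i)}"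
  shows
    "(cohen_macaulay R \<longleftrightarrow> I = {}) \<and>
     (I \<noteq> {} \<longrightarrow>
       (\<forall>i\<in>I. delta1 a k (w_vec a k i) = proj_degree d (w_vec a k i) + 1 \<and>
              delta2 a k (w_vec a k i) = proj_degree d (w_vec a k i) + 1) \<longrightarrow>
       modules_isomorphic (coefficient_field :: 'k ring)
         (as_vector_space H) (sum_of_lines (w_vec a k ` I) :: ('k, (nat \<times> nat) \<Rightarrow>\<^sub>0 'k) module) \<and>
       module_length R H = enat (card I) \<and> card I \<le> d - k) \<and>
     (\<not> cohen_macaulay R \<and> buchsbaum_curve TYPE('k) a k \<longleftrightarrow>
       I \<noteq> {} \<and>
       (\<forall>i\<in>I. delta1 a k (w_vec a k i) = proj_degree d (w_vec a k i) + 1 \<and>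
              delta2 a k (w_vec a k i) = proj_degree d (w_vec a k i) + 1) \<and>
       \<not> (\<exists>i\<in>I. \<exists>j\<in>I. \<exists>h\<in>a ` {1..k - 1}. w_vec a k j = w_vec a k i + e_vec d h))"
proof -
  let ?w = "w_vec a k"
  define A where "A = a ` {0..k}"
  have a_less_d: "a i < d" if "i < k" for i using a_increasing[OF that] a_k by simp
  have a_le_d: "a i \<le> d" if "i \<le> k" for i
    using a_less_d[of i] a_k that by (cases "i = k") auto
  have A_eq: "A = insert 0 (insert d (a ` {1..k - 1}))"
  proof -
    have "{0..k} = insert 0 (insert k {1..k - 1})" using k by auto
    then show ?thesis using a_0 a_k by (simp add: A_def)
  qed
  have inner: "0 < h" "h < d" if "h \<in> a ` {1..k - 1}" for h
    using that a_increasing[of 0] a_less_d a_0 by fastforce+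
  interpret D: degree_set A d
  proof
    have "Gcd A = Gcd (insert 0 (a ` {1..k}))"
    proof -
      have "{0..k} = insert 0 {1..k}" by auto
      then show ?thesis using a_0 by (simp add: A_def)
    qed
    then show "Gcd A = 1" using a_gcd by simp
  qed (use A_eq a_less_d[of 0] a_le_d k in \<open>auto simp: A_def\<close>)
  have A1: "set_A1 a k = A" by (simp add: set_A1_def A_def)
  have A2: "set_A2 a k = (\<lambda>h. d - h) ` A" by (simp add: set_A2_def A_def image_image a_k)
  have S: "curve_monoid a k = D.cone"
    unfolding curve_monoid_def D.cone_def unfolding A_def image_image a_k ..
  have w: "?w i = D.apery i" for i by (simp add: w_vec_def D.apery_def A1 A2 a_k)
  define gs where "gs = map (\<lambda>i. e_vec d (a i)) [0..<Suc k]"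
  have gs: "set gs = e_vec d ` A"
    by (auto simp: gs_def A_def image_image atLeast0AtMost simp del: upt_Suc)
  have PM: "plane_monoid D.cone d R" using R unfolding S by (rule D.plane_monoid_cone)
  interpret plane_cech D.cone d R gs
  proof (intro plane_cech.intro PM plane_cech_axioms.intro)
    show "set gs \<subseteq> D.cone - {0}"
      unfolding gs D.cone_def using D.d_pos
      by (auto intro!: add_submonoid_generator simp: e_vec_def zero_prod_def)
    show "(d, 0) \<in> set gs" "(0, d) \<in> set gs"
      unfolding gs using D.zero_A D.d_A by (auto simp: e_vec_def image_iff intro: bexI[of _ 0] bexI[of _ d])
  qed
  have H1: "H = H1"
    unfolding H curve_cohomology_def gs_def a_k R[symmetric] map_map comp_def ..
  have sat: "?w i \<in> saturation" if "i < d" for i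
    unfolding w using D.apery_saturation[OF PM that] .
  have sat_E: "\<exists>i<d. \<exists>m n. s = ?w i + (m * d, n * d)" if "s \<in> saturation" for s
    unfolding w using D.saturation_apery[OF PM that] .
  have criteria: "v \<in> D.cone \<longleftrightarrow> delta1 a k v \<le> proj_degree d v"
      "v \<notin> D.cone \<Longrightarrow> v + (0, d) \<in> D.cone \<longleftrightarrow> delta1 a k v = proj_degree d v + 1"
      "v \<notin> D.cone \<Longrightarrow> v + (d, 0) \<in> D.cone \<longleftrightarrow> delta2 a k v = proj_degree d v + 1"
    if v: "v \<in> saturation" for v
  proof -
    note v' = v[unfolded D.saturation_cone[OF PM]]
    then obtain m where m: "fst v + snd v = m * d" by (metis dvdE mult.commute)
    have deg: "proj_degree d v = of_nat m"
      unfolding proj_degree_def m using D.d_pos by simp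
    note crit = D.cone_criteria[OF _ _ m]
    have crit': "v \<in> D.cone \<longleftrightarrow> delta A (fst v) \<le> m"
      "v \<in> D.cone \<longleftrightarrow> delta ((\<lambda>h. d - h) ` A) (snd v) \<le> m"
      "v + (0, d) \<in> D.cone \<longleftrightarrow> delta A (fst v) \<le> m + 1"
      "v + (d, 0) \<in> D.cone \<longleftrightarrow> delta ((\<lambda>h. d - h) ` A) (snd v) \<le> m + 1"
      using crit v' by blast+
    have plus1: "of_nat m + 1 = (of_nat (m + 1) :: rat)" by simp
    show "v \<in> D.cone \<longleftrightarrow> delta1 a k v \<le> proj_degree d v"
      unfolding delta1_def deg A1 crit'(1) by (rule of_nat_le_iff[symmetric])
    \<comment> \<open>For \<open>v\<close> outside the cone \<open>delta\<close> is at least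
      \<open>m + 1\<close>, so the bound \<open>m + 1\<close> for the shifted vector amounts to
      equality.\<close>
    show "v + (0, d) \<in> D.cone \<longleftrightarrow> delta1 a k v = proj_degree d v + 1" if "v \<notin> D.cone"
      using that crit'(1) unfolding delta1_def deg A1 crit'(3) plus1 of_nat_eq_iff by linarith
    show "v + (d, 0) \<in> D.cone \<longleftrightarrow> delta2 a k v = proj_degree d v + 1" if "v \<notin> D.cone"
      using that crit'(2) unfolding delta2_def deg A2 crit'(4) plus1 of_nat_eq_iff by linarith
  qed
  have w_inner: "?w h \<in> D.cone" if "h \<in> a ` {1..k - 1}" for h
    using D.apery_generator[of h] inner[OF that] that A_eq unfolding w D.cone_def
    by (auto intro!: add_submonoid_generator)
  have w_0: "?w 0 \<in> D.cone" unfolding w D.apery_0 by (rule zero_S)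
  \<comment> \<open>The indices removed in the definition of \<open>I\<close>, namely
    \<open>0\<close> and the inner degrees, have \<open>?w\<close> in the cone, so \<open>I\<close>
    consists of all residues whose \<open>?w\<close> is a gap.\<close>
  have I_iff: "i \<in> I \<longleftrightarrow> i < d \<and> ?w i \<notin> D.cone" for i
  proof -
    have "i \<in> I \<longleftrightarrow> 1 \<le> i \<and> i < d \<and> i \<notin> a ` {1..k - 1} \<and> ?w i \<notin> D.cone"
    proof -
      have "i \<le> d - 1 \<longleftrightarrow> i < d" using D.d_pos by auto
      then show ?thesis unfolding I mem_Collect_eq using criteria(1)[OF sat, of i] by auto
    qed
    moreover have "1 \<le> i \<and> i \<notin> a ` {1..k - 1}" if "?w i \<notin> D.cone"
      using w_inner w_0 that by (cases "i = 0") auto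
    ultimately show ?thesis by blast
  qed
  have gap_I: "?w i \<in> gaps" if "i \<in> I" for i
    using that sat I_iff by simp
  have gaps_empty: "saturation \<subseteq> D.cone \<longleftrightarrow> I = {}"
  proof
    assume "I = {}"
    then have "?w i \<in> D.cone" if "i < d" for i using that I_iff by blast
    then show "saturation \<subseteq> D.cone" using sat_E add_S base_S by blast
  qed (use gap_I in blast)
  let ?cond = "\<forall>i\<in>I. delta1 a k (?w i) = proj_degree d (?w i) + 1 \<and>
    delta2 a k (?w i) = proj_degree d (?w i) + 1"
  have cond: "?cond \<longleftrightarrow> (\<forall>i\<in>I. ?w i + (0, d) \<in> D.cone \<and> ?w i + (d, 0) \<in> D.cone)"
    using criteria(2,3) gap_I by blast
  \<comment> \<open>Under the condition, one axis step from \<open>?w i\<close> with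
    \<open>i\<close> in \<open>I\<close> already enters the cone, so a gap is some
    \<open>?w i\<close> without any shift.\<close>
  have gaps_eq: "gaps = ?w ` I" if c: ?cond
  proof
    show "gaps \<subseteq> ?w ` I"
    proof
      fix s assume s: "s \<in> gaps"
      then obtain i m n where i: "i < d" "s = ?w i + (m * d, n * d)" using sat_E[of s] by blast
      have iI: "i \<in> I"
      proof (rule ccontr)
        assume "i \<notin> I"
        then have "?w i \<in> D.cone" using i(1) I_iff by blast
        from add_S[OF this base_S] show False using s i(2) by blast
      qed
      then have edges: "?w i + (0, d) \<in> D.cone" "?w i + (d, 0) \<in> D.cone" using c cond by blast+
      have "m = 0"
      proof (rule ccontr)
        assume "m \<noteq> 0"
        then have "s = (?w i + (d, 0)) + ((m - 1) * d, n * d)"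
          using i(2) by (cases m) (auto simp: add.assoc)
        then show False using add_S[OF edges(2) base_S] s by (metis DiffD2)
      qed
      moreover have "n = 0"
      proof (rule ccontr)
        assume "n \<noteq> 0"
        then have "s = (?w i + (0, d)) + (m * d, (n - 1) * d)"
          using i(2) by (cases n) (auto simp: add.assoc)
        then show False using add_S[OF edges(1) base_S] s by (metis DiffD2)
      qed
      ultimately have "s = ?w i" using i(2) by (simp flip: zero_prod_def)
      then show "s \<in> ?w ` I" using iI by blast
    qed
  qed (use gap_I in blast)
  have inj: "inj_on ?w I"
  proof (rule inj_onI)
    fix i j assume ij: "i \<in> I" "j \<in> I" "?w i = ?w j"
    have "fst (?w l) mod d = l" if "l \<in> I" for l
      using that I_iff D.omega_mod[of l] unfolding w D.apery_def by simp
    then show "i = j" using ij by metis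
  qed
  have card_I: "card I \<le> d - k"
  proof -
    have sub: "a ` {1..k - 1} \<subseteq> {1..d - 1}"
    proof
      fix h assume "h \<in> a ` {1..k - 1}"
      from inner[OF this] show "h \<in> {1..d - 1}" unfolding atLeastAtMost_iff by linarith
    qed
    \<comment> \<open>The inner degrees are \<open>k - 1\<close> of the \<open>d - 1\<close>
      candidates, which leaves \<open>d - k\<close>.\<close>
    have "I \<subseteq> {1..d - 1} - a ` {1..k - 1}" unfolding I by auto
    then have "card I \<le> card ({1..d - 1} - a ` {1..k - 1})" by (intro card_mono) auto
    also have "\<dots> = card {1..d - 1} - card (a ` {1..k - 1})"
      by (rule card_Diff_subset[OF _ sub]) simp
    also have "card (a ` {1..k - 1}) = k - 1"
    proof -
      have "inj_on a {1..k - 1}"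
      proof (rule linorder_inj_onI')
        fix i j assume "i \<in> {1..k - 1}" "j \<in> {1..k - 1}" "i < j"
        then have "j \<le> k" by auto
        then show "a i \<noteq> a j" using a_increasing[OF \<open>i < j\<close>] by simp
      qed
      then show ?thesis by (simp add: card_image)
    qed
    finally show ?thesis using k by simp
  qed
  have CM: "cohen_macaulay R \<longleftrightarrow> I = {}" using cohen_macaulay_iff gaps_empty by simp
  have buchsbaum: "buchsbaum_curve TYPE('k) a k \<longleftrightarrow> (\<forall>s\<in>D.cone - {0}. \<forall>v\<in>gaps. s + v \<in> D.cone)"
    unfolding annihilated_iff[symmetric] buchsbaum_curve_def Let_def H[symmetric] H1
      maximal_homogeneous_ideal_def S R[unfolded S, symmetric] ..
  \<comment> \<open>The condition says that both axis generators move every \<open>?w i\<close> with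
    \<open>i\<close> in \<open>I\<close> into the cone. Once it holds, these are all the gaps, and
    an inner generator moves a gap either into the cone or to another \<open>?w j\<close>, which is
    the excluded pair.\<close>
  have final: "(\<forall>s\<in>D.cone - {0}. \<forall>v\<in>gaps. s + v \<in> D.cone) \<longleftrightarrow>
    ?cond \<and> \<not> (\<exists>i\<in>I. \<exists>j\<in>I. \<exists>h\<in>a ` {1..k - 1}. ?w j = ?w i + e_vec d h)" (is "?B \<longleftrightarrow> _ \<and> \<not> ?pair")
  proof
    assume B: ?B
    have "(0, d) \<in> D.cone - {0}" "(d, 0) \<in> D.cone - {0}"
      using x_S y_S D.d_pos by (auto simp: zero_prod_def)
    then have ?cond using B gap_I unfolding cond by (metis add.commute)
    moreover have "\<not> ?pair"
    proof
      assume ?pair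
      then obtain i j h where p: "i \<in> I" "j \<in> I" "h \<in> a ` {1..k - 1}" "?w j = ?w i + e_vec d h" by blast
      have "e_vec d h \<in> D.cone"
        using p(3) A_eq unfolding D.cone_def by (intro add_submonoid_generator imageI) auto
      moreover have "e_vec d h \<noteq> 0" using inner[OF p(3)] by (simp add: e_vec_def zero_prod_def)
      ultimately have "?w j \<in> D.cone" using B gap_I[OF p(1)] p(4) by (metis DiffI add.commute singletonD)
      then show False using p(2) I_iff by blast
    qed
    ultimately show "?cond \<and> \<not> ?pair" ..
  next
    assume cp: "?cond \<and> \<not> ?pair"
    then have gaps: "gaps = ?w ` I" using gaps_eq by blast
    \<comment> \<open>The generators suffice: in a sum \<open>s + t\<close>, a nonzero
      \<open>t\<close> moves the gap into the cone before \<open>s\<close> is added. The alternative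
      \<open>s = 0\<close> keeps the claim true for the empty sum.\<close>
    have "s = 0 \<or> (\<forall>v\<in>gaps. s + v \<in> D.cone)" if "s \<in> D.cone" for s
      using that unfolding D.cone_def
    proof (induction rule: add_submonoid_induct)
      case (generator s)
      then obtain h where h: "h \<in> A" "s = e_vec d h" by blast
      have sS: "s \<in> D.cone" unfolding D.cone_def using generator by (rule add_submonoid_generator)
      have "s + v \<in> D.cone" if "v \<in> gaps" for v
      proof -
        obtain i where i: "i \<in> I" "v = ?w i" using \<open>v \<in> gaps\<close> gaps by blast
        consider "h = 0" | "h = d" | "h \<in> a ` {1..k - 1}" using h(1) A_eq by blast
        then show ?thesis
        proof cases
          case 1
          then show ?thesis using cp i cond h(2) by (simp add: e_vec_def add.commute)
        next
          case 2
          then show ?thesis using cp i cond h(2) by (simp add: e_vec_def add.commute)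
        next
          case 3
          show ?thesis
          proof (rule ccontr)
            assume "s + v \<notin> D.cone"
            moreover have "s + v \<in> saturation" using \<open>v \<in> gaps\<close> sS by (intro saturation_add) auto
            ultimately obtain j where "j \<in> I" "s + v = ?w j" using gaps by blast
            then show False using cp i 3 h(2) by (metis add.commute)
          qed
        qed
      qed
      then show ?case unfolding D.cone_def by blast
    next
      case (add s t)
      then show ?case unfolding D.cone_def[symmetric] using add_S by (metis add.assoc add.left_neutral)
    qed simp
    then show ?B by blast
  qed
  have "modules_isomorphic (coefficient_field :: 'k ring) (as_vector_space H)
      (sum_of_lines (?w ` I) :: ('k, 'k plane_poly) module) \<and>
    module_length R H = enat (card I)" if ?cond
    using H1_vector_space module_length_H1 unfolding H1 gaps_eq[OF that] card_image[OF inj] by blast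
  then show ?thesis
    unfolding CM buchsbaum final using card_I by blast
qed

end
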